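(* Let $H$ be a separable Hilbert space, let $a>0$, $b\ge0$, and let $(A,B)$ be a pair of linear operators on $H$ such that: $A$ is skew-adjoint with domain $D(A)$; $\mathrm{i}A$ is bounded from below; $B$ is skew-symmetric; and $\|B\psi\|\le a\|A\psi\|+b\|\psi\|$ for every $\psi\in D(A)$. Let $\delta\in(0,1)$. Then: (1) For every $u\in\mathcal{U}_{\delta,a}$ and every $t\ge0$, the propagator $\Upsilon^u_{t,0}$ maps $D(|A|)$ into $D(|A|)$ and is continuous from $D(|A|)$ to $D(|A|)$ (for the graph norm of $A$). (2) For every $\eta>0$ there exists $\lambda\in\mathbf{R}$ such that, for every $\psi\in D(A)$, every $u\in\mathcal{U}_{\delta,a}$ and every $t\ge0$, $$\|(A+\mathrm{i}\lambda)\Upsilon^u_{t,0}\psi\|\le e^{\frac{2a+\eta}{\delta}\,TV_{[0,t]}(u)}\,\|(A+\mathrm{i}\lambda)\psi\|.$$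
   Context: $\mathcal{U}_{\delta,a}$ is the set of functions $u:\mathbf{R}\to\left(-\frac{1-\delta}{a},\frac{1-\delta}{a}\right)$ of bounded variation on $\mathbf{R}$ with $u(t)=0$ for all $t\le 0$. The total variation $TV_{[0,t]}(u)$ is the supremum over all partitions $0=a_0<\dots<a_n=t$ of $\sum_{k=1}^n|u(a_k)-u(a_{k-1})|$. For real $v$ with $|v|<1/a$, by the Kato-Rellich theorem $A+vB$ is skew-adjoint with domain $D(A)$ and generates a unitary group. For a piecewise constant control $u$ taking successively the values $v_1,\dots,v_p$ on intervals of lengths $t_1,\dots,t_p\ge0$ with $t_1+\dots+t_p=t$, the propagator of $\frac{\mathrm{d}\psi}{\mathrm{d}t}=(A+u(t)B)\psi$ is $\Upsilon^u_{t,0}=e^{t_p(A+v_pB)}\cdots e^{t_1(A+v_1B)}$. For general $u\in\mathcal{U}_{\delta,a}$ and $t\in[0,T]$, $\Upsilon^u_{t,0}$ is the strong limit in $H$ of $\Upsilon^{u_n}_{t,0}$, where $(u_n)_n$ is any sequence of piecewise constant functions in $\mathcal{U}_{\delta,a}$ converging pointwise to $u$ with $TV_{[0,T]}(u_n)\le TV_{[0,T]}(u)$ for all $n$; such sequences exist, and the limit exists and does not depend on the sequence. (In the case $b>0$ this limit is obtained by replacing $A$ by $A_\lambda=A+\mathrm{i}\lambda\,\mathrm{Id}$, for a real $\lambda$ with $|\lambda|$ large and of the appropriate sign so that $\|B\psi\|\le(a+\eta)\|A_\lambda\psi\|$ with $\eta>0$ small, and setting $\Upsilon^u_{t,0}=e^{-\mathrm{i}\lambda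 t}\Upsilon^{u,\lambda}_{t,0}$, where $\Upsilon^{u,\lambda}$ is the propagator of $x'=(A_\lambda+uB)x$.) *)

theory Defs
  imports "HOL-Analysis.Analysis"
begin

subsection \<open>Complex Hilbert spaces\<close>

(* The inner product is antilinear in its first argument. Positive definiteness is part of
   the last axiom: norm is nonnegative and vanishes only at 0, and sqrt is negative on
   negative reals. *)
class complex_inner = real_normed_vector +
  fixes scaleC :: "complex \<Rightarrow> 'a \<Rightarrow> 'a" (infixr \<open>*\<^sub>C\<close> 75)
    and cinner :: "'a \<Rightarrow> 'a \<Rightarrow> complex"
  assumes scaleC_add_right: "c *\<^sub>C (x + y) = c *\<^sub>C x + c *\<^sub>C y"
    and scaleC_add_left: "(c + d) *\<^sub>C x = c *\<^sub>C x + d *\<^sub>C x"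
    and scaleC_scaleC: "c *\<^sub>C d *\<^sub>C x = (c * d) *\<^sub>C x"
    and scaleR_scaleC: "r *\<^sub>R x = complex_of_real r *\<^sub>C x"
    and cinner_commute: "cinner x y = cnj (cinner y x)"
    and cinner_add_left: "cinner (x + y) z = cinner x z + cinner y z"
    and cinner_scaleC_left: "cinner (c *\<^sub>C x) y = cnj c * cinner x y"
    and norm_eq_sqrt_cinner: "norm x = sqrt (Re (cinner x x))"

class chilbert_space = complex_inner + complete_space

instantiation complex :: chilbert_space
begin

definition scaleC_complex :: "complex \<Rightarrow> complex \<Rightarrow> complex"
  where "scaleC_complex c x = c * x"

definition cinner_complex :: "complex \<Rightarrow> complex \<Rightarrow> complex"
  where "cinner_complex x y = cnj x * y"

instance
  by standard
    (auto simp: scaleC_complex_def cinner_complex_def algebra_simps scaleR_conv_of_real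
      cmod_def power2_eq_square)

end


subsection \<open>Unbounded operators\<close>

(* An operator T is represented by its graph; its domain is Domain T, the composition
   "first S, then T" is S O T, the identity operator is Id, and equality of operators is
   equality of graphs (hence includes equality of domains). *)
type_synonym 'a operator = "('a \<times> 'a) set"

definition linear_operator :: "'a::complex_inner operator \<Rightarrow> bool"
  where "linear_operator T \<longleftrightarrow> single_valued T \<and> (0, 0) \<in> T \<and>
    (\<forall>(x, x') \<in> T. \<forall>(y, y') \<in> T. (x + y, x' + y') \<in> T) \<and>
    (\<forall>c. \<forall>(x, x') \<in> T. (c *\<^sub>C x, c *\<^sub>C x') \<in> T)"

definition op_app :: "'a operator \<Rightarrow> 'a \<Rightarrow> 'a"
  where "op_app T x = (THE y. (x, y) \<in> T)"

definition op_add :: "'a::complex_inner operator \<Rightarrow> 'a operator \<Rightarrow> 'a operator"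
  where "op_add S T = {(x, y + z) | x y z. (x, y) \<in> S \<and> (x, z) \<in> T}"

definition op_scale :: "complex \<Rightarrow> 'a::complex_inner operator \<Rightarrow> 'a operator"
  where "op_scale c T = {(x, c *\<^sub>C y) | x y. (x, y) \<in> T}"

definition densely_defined :: "'a::complex_inner operator \<Rightarrow> bool"
  where "densely_defined T \<longleftrightarrow> closure (Domain T) = UNIV"

definition op_adjoint :: "'a::complex_inner operator \<Rightarrow> 'a operator"
  where "op_adjoint T = {(y, z). \<forall>(x, x') \<in> T. cinner y x' = cinner z x}"

definition self_adjoint :: "'a::complex_inner operator \<Rightarrow> bool"
  where "self_adjoint T \<longleftrightarrow> linear_operator T \<and> densely_defined T \<and> op_adjoint T = T"

definition skew_adjoint :: "'a::complex_inner operator \<Rightarrow> bool"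
  where "skew_adjoint T \<longleftrightarrow>
    linear_operator T \<and> densely_defined T \<and> op_adjoint T = op_scale (- 1) T"

definition skew_symmetric :: "'a::complex_inner operator \<Rightarrow> bool"
  where "skew_symmetric T \<longleftrightarrow> (\<forall>(x, x') \<in> T. \<forall>(y, y') \<in> T. cinner x' y = - cinner x y')"

definition bounded_from_below :: "'a::complex_inner operator \<Rightarrow> bool"
  where "bounded_from_below T \<longleftrightarrow> (\<exists>c. \<forall>(x, x') \<in> T. c * (norm x)\<^sup>2 \<le> Re (cinner x x'))"

definition positive_operator :: "'a::complex_inner operator \<Rightarrow> bool"
  where "positive_operator T \<longleftrightarrow> (\<forall>(x, x') \<in> T. 0 \<le> Re (cinner x x'))"

(* The modulus |T|: the positive self-adjoint square root of T* T. It exists and is unique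
   for every densely defined closed T on a Hilbert space. *)
definition op_modulus :: "'a::complex_inner operator \<Rightarrow> 'a operator"
  where "op_modulus T =
    (SOME P. self_adjoint P \<and> positive_operator P \<and> P O P = T O op_adjoint T)"

definition graph_norm :: "'a::complex_inner operator \<Rightarrow> 'a \<Rightarrow> real"
  where "graph_norm T x = norm x + norm (op_app T x)"

definition graph_norm_continuous_on ::
    "'a::complex_inner operator \<Rightarrow> 'a set \<Rightarrow> ('a \<Rightarrow> 'a) \<Rightarrow> bool"
  where "graph_norm_continuous_on T E f \<longleftrightarrow>
    (\<forall>x\<in>E. \<forall>e>0. \<exists>d>0. \<forall>y\<in>E.
      graph_norm T (y - x) < d \<longrightarrow> graph_norm T (f y - f x) < e)"


subsection \<open>Unitary groups\<close>

definition unitary_group :: "(real \<Rightarrow> 'a::complex_inner \<Rightarrow> 'a) \<Rightarrow> bool"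
  where "unitary_group U \<longleftrightarrow>
    (\<forall>t x y. U t (x + y) = U t x + U t y) \<and>
    (\<forall>t c x. U t (c *\<^sub>C x) = c *\<^sub>C U t x) \<and>
    (\<forall>t x. norm (U t x) = norm x) \<and>
    (\<forall>x. U 0 x = x) \<and>
    (\<forall>s t x. U (s + t) x = U s (U t x)) \<and>
    (\<forall>x. continuous_on UNIV (\<lambda>t. U t x))"

definition group_generator :: "(real \<Rightarrow> 'a::complex_inner \<Rightarrow> 'a) \<Rightarrow> 'a operator"
  where "group_generator U = {(x, y). ((\<lambda>h. (U h x - x) /\<^sub>R h) \<longlongrightarrow> y) (at 0)}"

(* op_exp t T is exp(t T) for a skew-adjoint T. *)
definition op_exp :: "real \<Rightarrow> 'a::complex_inner operator \<Rightarrow> 'a \<Rightarrow> 'a"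
  where "op_exp t T = (THE U. unitary_group U \<and> group_generator U = T) t"


subsection \<open>Controls of bounded variation\<close>

definition is_partition :: "real \<Rightarrow> real \<Rightarrow> nat \<Rightarrow> (nat \<Rightarrow> real) \<Rightarrow> bool"
  where "is_partition s t n p \<longleftrightarrow> p 0 = s \<and> p n = t \<and> (\<forall>k<n. p k < p (Suc k))"

definition variation_sum :: "(real \<Rightarrow> real) \<Rightarrow> nat \<Rightarrow> (nat \<Rightarrow> real) \<Rightarrow> real"
  where "variation_sum u n p = (\<Sum>k=1..n. \<bar>u (p k) - u (p (k - 1))\<bar>)"

definition bounded_variation :: "(real \<Rightarrow> real) \<Rightarrow> bool"
  where "bounded_variation u \<longleftrightarrow>
    (\<exists>M. \<forall>s t n p. is_partition s t n p \<longrightarrow> variation_sum u n p \<le> M)"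

definition total_variation :: "real \<Rightarrow> real \<Rightarrow> (real \<Rightarrow> real) \<Rightarrow> real"
  where "total_variation s t u = Sup {variation_sum u n p | n p. is_partition s t n p}"

definition controls :: "real \<Rightarrow> real \<Rightarrow> (real \<Rightarrow> real) set"
  where "controls \<delta> a = {u. (\<forall>t. u t \<in> {- ((1 - \<delta>) / a) <..< (1 - \<delta>) / a}) \<and>
    bounded_variation u \<and> (\<forall>t\<le>0. u t = 0)}"

definition piecewise_constant :: "(real \<Rightarrow> real) \<Rightarrow> bool"
  where "piecewise_constant u \<longleftrightarrow>
    (\<exists>F. finite F \<and> (\<forall>s t. s \<le> t \<and> {s..t} \<inter> F = {} \<longrightarrow> u s = u t))"


subsection \<open>Propagators\<close>

(* takes_values u s vs t: from time s to time t, u takes successively the values v on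
   intervals of lengths \<tau>, for the (v, \<tau>) in vs. Intervals of length 0 contribute the
   identity to the propagator, so the values at the finitely many end points are free. *)
fun takes_values :: "(real \<Rightarrow> real) \<Rightarrow> real \<Rightarrow> (real \<times> real) list \<Rightarrow> real \<Rightarrow> bool"
  where
    "takes_values u s [] t \<longleftrightarrow> s = t"
  | "takes_values u s ((v, \<tau>) # vs) t \<longleftrightarrow>
      0 \<le> \<tau> \<and> v \<in> range u \<and> (\<forall>r. s < r \<and> r < s + \<tau> \<longrightarrow> u r = v) \<and>
      takes_values u (s + \<tau>) vs t"

definition pc_propagator ::
    "'a::complex_inner operator \<Rightarrow> 'a operator \<Rightarrow> (real \<Rightarrow> real) \<Rightarrow> real \<Rightarrow> 'a \<Rightarrow> 'a"
  where "pc_propagator A B u t \<psi> =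
    (THE \<phi>. \<exists>vs. takes_values u 0 vs t \<and>
      \<phi> = fold (\<lambda>(v, \<tau>). op_exp \<tau> (op_add A (op_scale (complex_of_real v) B))) vs \<psi>)"

definition pc_approximation ::
    "real \<Rightarrow> real \<Rightarrow> real \<Rightarrow> (real \<Rightarrow> real) \<Rightarrow> (nat \<Rightarrow> real \<Rightarrow> real) \<Rightarrow> bool"
  where "pc_approximation \<delta> a T u us \<longleftrightarrow>
    (\<forall>n. us n \<in> controls \<delta> a \<and> piecewise_constant (us n) \<and>
      total_variation 0 T (us n) \<le> total_variation 0 T u) \<and>
    (\<forall>t. (\<lambda>n. us n t) \<longlonglongrightarrow> u t)"

(* The common limit along all approximating sequences, for all horizons T. *)
definition propagator ::
    "real \<Rightarrow> real \<Rightarrow> 'a::complex_inner operator \<Rightarrow> 'a operator \<Rightarrow> (real \<Rightarrow> real) \<Rightarrow>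
      real \<Rightarrow> 'a \<Rightarrow> 'a"
  where "propagator \<delta> a A B u t \<psi> =
    (THE \<phi>. \<forall>T\<ge>t. \<forall>us. pc_approximation \<delta> a T u us \<longrightarrow>
      (\<lambda>n. pc_propagator A B (us n) t \<psi>) \<longlonglongrightarrow> \<phi>)"

end

theory Submission
  imports Defs
begin

text \<open>
While a piecewise constant control has the value \<open>v\<close>, the evolution commutes with its generator
\<open>A + v B\<close>, so the norm of \<open>(A + v B + \<i> \<mu>) \<psi>\<close> does not change. It changes only when the control jumps
from \<open>v\<close> to \<open>w\<close>, and then by at most \<open>\<bar>w - v\<bar> norm (B \<psi>)\<close>. Because \<open>\<i> A\<close> is bounded from below, a
very negative \<open>\<mu>\<close> makes both \<open>norm (A \<psi>)\<close> and \<open>\<bar>\<mu>\<bar> norm \<psi>\<close> controllable by \<open>norm ((A + \<i> \<mu>) \<psi>)\<close>; the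
term \<open>b norm \<psi>\<close> of the relative bound becomes negligible, and for all values \<open>v\<close> of a control
\<open>norm (B \<psi>)\<close> is at most \<open>\<kappa>\<close> times the norm of \<open>(A + v B + \<i> \<mu>) \<psi>\<close>, with \<open>\<kappa>\<close> as close to \<open>a / \<delta>\<close>
as desired (\<open>dominating_shift_exists\<close>). A jump thus costs a factor \<open>exp (\<kappa> \<bar>w - v\<bar>)\<close>, all jumps together
at most the exponential of \<open>\<kappa>\<close> times the total variation, and the final return from \<open>A + v B + \<i> \<mu>\<close> to
\<open>A + \<i> \<mu>\<close> once more the same amount, since \<open>\<bar>v\<bar>\<close> is at most the total variation
(\<open>pc_propagator_regularity\<close>). This explains the exponent \<open>2 a / \<delta>\<close>.

For a control of bounded variation, an energy estimate bounds the squared distance of the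
evolutions of two piecewise constant approximations by a multiple of the integral of the absolute
difference of the controls, because \<open>B\<close> stays bounded along trajectories by the first part
(\<open>pc_propagator_distance\<close>). So the limit that defines the propagator exists and does not depend on the
sequence (\<open>propagator_tendsto\<close>); approximating sequences are obtained by sampling the control along the
level sets of its variation function (\<open>pc_approximation_exists\<close>). The bound survives in the limit,
since the graph of \<open>A + \<i> \<mu>\<close> is closed and convex (\<open>shifted_norm_lower_semicontinuous\<close>).

This needs some operator theory: the Kato-Rellich theorem in the form \<open>perturbed_skew_adjoint\<close>,
Stone's theorem \<open>Stone\<close>, proved with Yosida approximations, and the equality \<open>Domain_modulus\<close> of the
domains of \<open>A\<close> and of its modulus. The last one rests on the construction of a modulus from the
bounded operator \<open>A (A - \<i> m)\<close> with the second factor inverted, and on the fact that skew-adjoint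
operators with equal squares have equal domains.\<close>

section \<open>The real inner product of a complex Hilbert space\<close>

instance chilbert_space \<subseteq> banach ..

text \<open>Only the real part of the inner product enters the analysis. A complex linear operator is
symmetric or skew-symmetric for it if and only if it is so for the complex inner product, because
the imaginary part is recovered by testing with \<open>\<i> x\<close>.\<close>

definition rinner :: "'a::complex_inner \<Rightarrow> 'a \<Rightarrow> real"
  where "rinner x y = Re (cinner x y)"

lemma scaleC_minus1: "(-1) *\<^sub>C (x::'a::complex_inner) = - x"
  using scaleR_scaleC[of "-1" x] by simp

lemma scaleC_one: "1 *\<^sub>C (x::'a::complex_inner) = x"
  using scaleR_scaleC[of 1 x] by simp

lemma scaleC_zero_right: "c *\<^sub>C (0::'a::complex_inner) = 0"
  using scaleC_add_right[of c 0 "0::'a"] by simp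

lemma scaleC_minus_right: "c *\<^sub>C (- x) = - (c *\<^sub>C (x::'a::complex_inner))"
  using scaleC_add_right[of c x "- x"] by (simp add: scaleC_zero_right add_eq_0_iff)

lemma scaleC_diff_right: "c *\<^sub>C (x - y) = c *\<^sub>C x - c *\<^sub>C (y::'a::complex_inner)"
  using scaleC_add_right[of c x "- y"] by (simp add: scaleC_minus_right)

lemma scaleC_scaleR: "c *\<^sub>C (r *\<^sub>R x) = r *\<^sub>R (c *\<^sub>C (x::'a::complex_inner))"
  by (simp add: scaleR_scaleC scaleC_scaleC mult.commute)

lemma rinner_commute: "rinner x y = rinner y x"
  unfolding rinner_def by (subst cinner_commute) simp

lemma rinner_add_left: "rinner (x + y) z = rinner x z + rinner y z"
  by (simp add: rinner_def cinner_add_left)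

lemma rinner_scaleR_left: "rinner (r *\<^sub>R x) y = r * rinner x y"
  by (simp add: rinner_def scaleR_scaleC cinner_scaleC_left)

lemma rinner_self: "rinner x x = (norm x)\<^sup>2"
proof -
  have "0 \<le> Re (cinner x x)"
    using norm_ge_zero[of x] unfolding norm_eq_sqrt_cinner by simp
  then show ?thesis
    by (simp add: rinner_def norm_eq_sqrt_cinner)
qed

lemma rinner_add_right: "rinner z (x + y) = rinner z x + rinner z y"
  by (metis rinner_add_left rinner_commute)

lemma rinner_scaleR_right: "rinner y (r *\<^sub>R x) = r * rinner y x"
  by (metis rinner_scaleR_left rinner_commute)

lemma rinner_zero_left [simp]: "rinner 0 x = 0"
  using rinner_add_left[of 0 0 x] by simp

lemma rinner_zero_right [simp]: "rinner x 0 = 0"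
  using rinner_commute[of x 0] by simp

lemma rinner_minus_left: "rinner (- x) y = - rinner x y"
  using rinner_scaleR_left[of "-1" x y] by simp

lemma rinner_minus_right: "rinner x (- y) = - rinner x y"
  using rinner_scaleR_right[of x "-1" y] by simp

lemma rinner_diff_left: "rinner (x - y) z = rinner x z - rinner y z"
  using rinner_add_left[of x "- y" z] by (simp add: rinner_minus_left)

lemma rinner_diff_right: "rinner z (x - y) = rinner z x - rinner z y"
  using rinner_add_right[of z x "- y"] by (simp add: rinner_minus_right)

lemmas rinner_simps = rinner_add_left rinner_add_right rinner_diff_left rinner_diff_right
  rinner_scaleR_left rinner_scaleR_right rinner_minus_left rinner_minus_right

lemma norm_add_sq: "(norm (x + y))\<^sup>2 = (norm x)\<^sup>2 + 2 * rinner x y + (norm (y::'a::complex_inner))\<^sup>2"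
  using rinner_commute[of y x] by (simp add: rinner_self[symmetric] rinner_simps)

lemma norm_diff_sq: "(norm (x - y))\<^sup>2 = (norm x)\<^sup>2 - 2 * rinner x y + (norm (y::'a::complex_inner))\<^sup>2"
  using rinner_commute[of y x] by (simp add: rinner_self[symmetric] rinner_simps)

lemma parallelogram:
  "(norm (x - y))\<^sup>2 = 2 * (norm x)\<^sup>2 + 2 * (norm y)\<^sup>2 - (norm (x + (y::'a::complex_inner)))\<^sup>2"
  by (simp add: norm_add_sq norm_diff_sq)

lemma norm_sq_minus_projection:
  fixes x y :: "'a::complex_inner"
  assumes "y \<noteq> 0"
  shows "(norm (x - (rinner x y / (norm y)\<^sup>2) *\<^sub>R y))\<^sup>2 = (norm x)\<^sup>2 - (rinner x y)\<^sup>2 / (norm y)\<^sup>2"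
proof -
  have "(norm (x - (rinner x y / (norm y)\<^sup>2) *\<^sub>R y))\<^sup>2
      = (norm x)\<^sup>2 - 2 * (rinner x y / (norm y)\<^sup>2) * rinner x y
        + (rinner x y / (norm y)\<^sup>2)\<^sup>2 * (norm y)\<^sup>2"
    by (simp only: norm_diff_sq rinner_scaleR_right norm_scaleR power_mult_distrib power2_abs mult.assoc)
  then show ?thesis
    using assms by (simp add: power2_eq_square)
qed

lemma rinner_Cauchy_Schwarz: "\<bar>rinner x y\<bar> \<le> norm x * norm y"
proof (cases "y = 0")
  case False
  define r where "r = rinner x y / (norm y)\<^sup>2"
  have "0 \<le> (norm (x - r *\<^sub>R y))\<^sup>2" by simp
  also have "\<dots> = (norm x)\<^sup>2 - (rinner x y)\<^sup>2 / (norm y)\<^sup>2"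
    unfolding r_def by (rule norm_sq_minus_projection[OF False])
  finally have "(rinner x y)\<^sup>2 \<le> (norm x * norm y)\<^sup>2"
    using False by (simp add: field_simps power_mult_distrib)
  then show ?thesis
    by (simp add: abs_le_square_iff[symmetric])
qed simp

lemma bounded_bilinear_rinner: "bounded_bilinear rinner"
proof
  show "\<exists>K. \<forall>a b. norm (rinner a b) \<le> norm a * norm b * K"
    by (rule exI[of _ 1]) (simp add: rinner_Cauchy_Schwarz)
qed (simp_all add: rinner_simps)

lemma cinner_scaleC_right: "cinner x (c *\<^sub>C y) = c * cinner x y"
  by (metis cinner_commute cinner_scaleC_left complex_cnj_cnj complex_cnj_mult)

lemma norm_scaleC: "norm (c *\<^sub>C x) = cmod c * norm (x::'a::complex_inner)"
proof -
  have "c * cnj c = complex_of_real ((cmod c)\<^sup>2)"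
    by (metis complex_norm_square)
  then have "cinner (c *\<^sub>C x) (c *\<^sub>C x) = complex_of_real ((cmod c)\<^sup>2) * cinner x x"
    unfolding cinner_scaleC_left cinner_scaleC_right by (simp only: mult.assoc[symmetric])
  then have "rinner (c *\<^sub>C x) (c *\<^sub>C x) = (cmod c)\<^sup>2 * rinner x x"
    by (simp add: rinner_def)
  then have "(norm (c *\<^sub>C x))\<^sup>2 = (cmod c * norm x)\<^sup>2"
    by (simp add: rinner_self power_mult_distrib)
  then show ?thesis
    by (rule power2_eq_imp_eq) auto
qed

lemma bounded_linear_scaleC: "bounded_linear (\<lambda>x::'a::complex_inner. c *\<^sub>C x)"
  by (rule bounded_linear_intro[of _ "cmod c"])
    (simp_all add: scaleC_add_right scaleC_scaleR norm_scaleC mult.commute)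

lemma Im_cinner: "Im (cinner x y) = rinner (\<i> *\<^sub>C x) y"
  by (simp add: rinner_def cinner_scaleC_left)

lemma rinner_ii: "rinner (\<i> *\<^sub>C x) y = - rinner x (\<i> *\<^sub>C y)"
  by (simp add: rinner_def cinner_scaleC_left cinner_scaleC_right)

section \<open>Points of minimal norm in convex sets\<close>

text \<open>Choose points of almost minimal norm. The midpoint of \<open>y n\<close> and \<open>y m\<close> lies in the larger of the
two sets, so the parallelogram law bounds the distance of the two points by the increment of the
infimum of the squared norm, and these infima converge since they increase and are bounded. For a
constant sequence of sets this is the projection theorem; for the convex hulls of the tails of a
bounded sequence it does the work of weak compactness.\<close>

lemma nested_convex_selection:
  fixes S :: "nat \<Rightarrow> 'h::chilbert_space set"
  assumes cvx: "\<And>n. convex (S n)" and dec: "\<And>n m. n \<le> m \<Longrightarrow> S m \<subseteq> S n"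
    and bdd: "\<And>n. \<exists>x\<in>S n. norm x \<le> C"
  shows "\<exists>y l. (\<forall>n. y n \<in> S n \<and> (\<forall>x\<in>S n. (norm (y n))\<^sup>2 \<le> (norm x)\<^sup>2 + 1 / Suc n)) \<and> y \<longlonglongrightarrow> l"
proof -
  define d where "d n = Inf ((\<lambda>x. (norm x)\<^sup>2) ` S n)" for n
  have ne: "(\<lambda>x. (norm x)\<^sup>2) ` S n \<noteq> {}" for n using bdd[of n] by auto
  have bb: "bdd_below ((\<lambda>x. (norm x)\<^sup>2) ` S n)" for n
    by (rule bdd_belowI[of _ 0]) auto
  have d_le: "d n \<le> (norm x)\<^sup>2" if "x \<in> S n" for x n
    unfolding d_def using that bb by (intro cInf_lower) auto
  have "\<exists>x\<in>S n. (norm x)\<^sup>2 < d n + 1 / Suc n" for n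
    using cInf_lessD[OF ne[of n], of "d n + 1 / Suc n"] unfolding d_def by auto
  then obtain y where y: "\<And>n. y n \<in> S n" "\<And>n. (norm (y n))\<^sup>2 < d n + 1 / Suc n"
    by metis
  have inc: "incseq d"
  proof (rule incseq_SucI)
    fix n show "d n \<le> d (Suc n)"
      unfolding d_def[of "Suc n"]
      using ne[of "Suc n"] d_le dec[of n "Suc n"] by (intro cInf_greatest) auto
  qed
  have "d n \<le> C\<^sup>2" for n
  proof -
    obtain x where "x \<in> S n" "norm x \<le> C" using bdd by blast
    then show ?thesis using d_le[of x n] power_mono[of "norm x" C 2] by simp
  qed
  then have "convergent d"
    using incseq_convergent[OF inc] by (metis convergentI)
  then have dC: "Cauchy d" by (rule convergent_Cauchy)
  have key: "(norm (y n - y m))\<^sup>2 \<le> 2 * (d m - d n) + 4 / Suc n" if "n \<le> m" for n m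
  proof -
    have "(1/2) *\<^sub>R y n + (1/2) *\<^sub>R y m \<in> S n"
      using cvx[of n] y(1)[of n] y(1)[of m] dec[OF that] unfolding convex_def by auto
    then have "d n \<le> (norm ((1/2) *\<^sub>R y n + (1/2) *\<^sub>R y m))\<^sup>2" by (rule d_le)
    also have "\<dots> = (norm (y n + y m))\<^sup>2 / 4"
      by (simp add: scaleR_add_right[symmetric] power_divide)
    finally have "4 * d n \<le> (norm (y n + y m))\<^sup>2" by simp
    moreover have "1 / real (Suc m) \<le> 1 / Suc n" using that by (simp add: field_simps)
    ultimately show ?thesis
      using y(2)[of n] y(2)[of m] parallelogram[of "y n" "y m"] by simp
  qed
  have "Cauchy y"
  proof (rule metric_CauchyI)
    fix e :: real assume e: "e > 0"
    obtain N1 where N1: "\<And>m n. m \<ge> N1 \<Longrightarrow> n \<ge> N1 \<Longrightarrow> dist (d m) (d n) < e\<^sup>2 / 8"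
      using metric_CauchyD[OF dC, of "e\<^sup>2 / 8"] e by auto
    obtain N2 :: nat where N2: "real N2 > 8 / e\<^sup>2" using reals_Archimedean2 by blast
    have *: "dist (y n) (y m) < e" if "max N1 N2 \<le> n" "n \<le> m" for n m
    proof -
      have "real N2 < real (Suc n)" using that by auto
      then have "8 / e\<^sup>2 < real (Suc n)" using N2 by linarith
      then have "4 / real (Suc n) < e\<^sup>2 / 2" using e by (simp add: field_simps)
      moreover have "d m - d n < e\<^sup>2 / 8"
        using N1[of m n] that unfolding dist_real_def by (smt (verit) max.boundedE order_trans)
      ultimately have "(norm (y n - y m))\<^sup>2 < e\<^sup>2"
      proof -
        have "X < E" if "q < E / 2" "D < E / 8" "X \<le> 2 * D + q" "0 < E" for X D q E :: real
          using that by linarith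
        then show ?thesis
          using \<open>4 / real (Suc n) < e\<^sup>2 / 2\<close> \<open>d m - d n < e\<^sup>2 / 8\<close> key[OF that(2)] zero_less_power[OF e, of 2] by blast
      qed
      then show ?thesis
        using e by (simp add: dist_norm power_less_imp_less_base)
    qed
    show "\<exists>M. \<forall>m\<ge>M. \<forall>n\<ge>M. dist (y m) (y n) < e"
      by (intro exI[of _ "max N1 N2"]) (metis * dist_commute nle_le)
  qed
  then obtain l where "y \<longlonglongrightarrow> l"
    using Cauchy_convergent_iff convergent_def by blast
  moreover have "(norm (y n))\<^sup>2 \<le> (norm x)\<^sup>2 + 1 / Suc n" if "x \<in> S n" for x n
    using y(2)[of n] d_le[OF that] by linarith
  ultimately show ?thesis using y(1) by blast
qed

text \<open>The vector \<open>z\<close> is the point of minimal norm in the translate \<open>w + V\<close>.\<close>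

lemma closed_subspace_orthogonal:
  fixes V :: "'h::chilbert_space set"
  assumes V: "subspace V" "closed V" and w: "w \<notin> V"
  shows "\<exists>z. z \<noteq> 0 \<and> (\<forall>v\<in>V. rinner z v = 0)"
proof -
  define S where "S = (+) w ` V"
  have cS: "convex S"
    unfolding S_def using V(1) subspace_imp_convex convex_translation by blast
  have "w \<in> S" unfolding S_def using subspace_0[OF V(1)] by force
  then obtain y l where y: "\<And>n::nat. y n \<in> S"
    "\<And>n x. x \<in> S \<Longrightarrow> (norm (y n))\<^sup>2 \<le> (norm x)\<^sup>2 + 1 / Suc n" and l: "y \<longlonglongrightarrow> l"
    using nested_convex_selection[of "\<lambda>_. S" "norm w"] cS by blast
  have "closed S" unfolding S_def using V(2) by (rule closed_translation)
  then have lS: "l \<in> S" using y(1) l by (metis closed_sequentially)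
  have lmin: "(norm l)\<^sup>2 \<le> (norm x)\<^sup>2" if "x \<in> S" for x
  proof (rule LIMSEQ_le)
    show "(\<lambda>n. (norm (y n))\<^sup>2) \<longlonglongrightarrow> (norm l)\<^sup>2" by (intro tendsto_intros l)
    show "(\<lambda>n. (norm x)\<^sup>2 + 1 / Suc n) \<longlonglongrightarrow> (norm x)\<^sup>2"
      using tendsto_add[OF tendsto_const[of "(norm x)\<^sup>2"] LIMSEQ_inverse_real_of_nat]
      by (simp add: inverse_eq_divide)
    show "\<exists>N. \<forall>n\<ge>N. (norm (y n))\<^sup>2 \<le> (norm x)\<^sup>2 + 1 / Suc n" using y(2) that by blast
  qed
  have "l \<noteq> 0"
  proof
    assume "l = 0"
    then have "- w \<in> V" using lS unfolding S_def by (auto simp: add_eq_0_iff2 minus_equation_iff)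
    then show False using subspace_neg[OF V(1)] w by fastforce
  qed
  moreover have "rinner l v = 0" if v: "v \<in> V" for v
  proof (cases "v = 0")
    case False
    define r where "r = rinner l v / (norm v)\<^sup>2"
    obtain v0 where v0: "v0 \<in> V" "l = w + v0" using lS unfolding S_def by auto
    have "v0 - r *\<^sub>R v \<in> V" using V(1) v v0(1) by (simp add: subspace_diff subspace_scale)
    then have "l - r *\<^sub>R v \<in> S" unfolding S_def v0(2) by (intro image_eqI[of _ _ "v0 - r *\<^sub>R v"]) auto
    then have "(norm l)\<^sup>2 \<le> (norm (l - r *\<^sub>R v))\<^sup>2" by (rule lmin)
    also have "\<dots> = (norm l)\<^sup>2 - (rinner l v)\<^sup>2 / (norm v)\<^sup>2"
      unfolding r_def by (rule norm_sq_minus_projection[OF False])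
    finally have "(rinner l v)\<^sup>2 / (norm v)\<^sup>2 \<le> 0" by simp
    then show ?thesis using False by (simp add: divide_le_0_iff)
  qed simp
  ultimately show ?thesis by blast
qed

text \<open>In place of a weak limit of \<open>z\<close> itself: closed convex conditions satisfied by all late members
of the sequence hold for the limit \<open>l\<close>.\<close>

lemma convex_combinations_converge:
  fixes z :: "nat \<Rightarrow> 'h::chilbert_space"
  assumes "\<And>n. norm (z n) \<le> C"
  shows "\<exists>y l. (\<forall>n. y n \<in> convex hull (z ` {n..})) \<and> y \<longlonglongrightarrow> l"
proof -
  have "\<exists>x\<in>convex hull (z ` {n..}). norm x \<le> C" for n
    by (rule bexI[of _ "z n"]) (auto simp: assms hull_inc)
  moreover have "convex hull (z ` {m..}) \<subseteq> convex hull (z ` {n..})" if "n \<le> m" for n m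
    using that by (intro hull_mono) auto
  ultimately show ?thesis
    using nested_convex_selection[of "\<lambda>n. convex hull (z ` {n..})" C] convex_convex_hull by blast
qed

section \<open>Skew-adjoint operators and their resolvents\<close>

lemma linear_operatorD:
  assumes "linear_operator T"
  shows "(x, y) \<in> T \<Longrightarrow> (x, z) \<in> T \<Longrightarrow> y = z" "(0, 0) \<in> T"
    "(x, x') \<in> T \<Longrightarrow> (y, y') \<in> T \<Longrightarrow> (x + y, x' + y') \<in> T"
    "(x, x') \<in> T \<Longrightarrow> (c *\<^sub>C x, c *\<^sub>C x') \<in> T"
    "(x, x') \<in> T \<Longrightarrow> (r *\<^sub>R x, r *\<^sub>R x') \<in> T"
    "(x, x') \<in> T \<Longrightarrow> (- x, - x') \<in> T"
    "(x, x') \<in> T \<Longrightarrow> (y, y') \<in> T \<Longrightarrow> (x - y, x' - y') \<in> T"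
proof -
  note * = assms[unfolded linear_operator_def single_valued_def]
  show "(x, y) \<in> T \<Longrightarrow> (x, z) \<in> T \<Longrightarrow> y = z" "(0, 0) \<in> T" using * by blast+
  show add: "(x, x') \<in> T \<Longrightarrow> (y, y') \<in> T \<Longrightarrow> (x + y, x' + y') \<in> T" for x x' y y' using * by blast
  show sc: "(x, x') \<in> T \<Longrightarrow> (c *\<^sub>C x, c *\<^sub>C x') \<in> T" for x x' c using * by blast
  show "(x, x') \<in> T \<Longrightarrow> (r *\<^sub>R x, r *\<^sub>R x') \<in> T" by (simp add: scaleR_scaleC sc)
  show neg: "(x, x') \<in> T \<Longrightarrow> (- x, - x') \<in> T" for x x' using sc[of x x' "-1"] by (simp add: scaleC_minus1)
  show "(x, x') \<in> T \<Longrightarrow> (y, y') \<in> T \<Longrightarrow> (x - y, x' - y') \<in> T"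
    using add[of x x' "- y" "- y'"] neg by simp
qed

lemma op_app_eq: "linear_operator T \<Longrightarrow> (x, y) \<in> T \<Longrightarrow> op_app T x = y"
  unfolding op_app_def using linear_operatorD(1) by (intro the_equality) blast+

lemma linear_op_add:
  assumes "linear_operator S" "linear_operator T"
  shows "linear_operator (op_add S T)"
proof -
  note S = linear_operatorD[OF assms(1)] and T = linear_operatorD[OF assms(2)]
  have "single_valued (op_add S T)"
    unfolding single_valued_def op_add_def using S(1) T(1) by blast
  moreover have "(0, 0) \<in> op_add S T"
    unfolding op_add_def using S(2) T(2) by force
  moreover have "(x + y, x' + y') \<in> op_add S T"
    if "(x, x') \<in> op_add S T" "(y, y') \<in> op_add S T" for x x' y y'
  proof -
    obtain p q r s where "x' = p + q" "y' = r + s" "(x, p) \<in> S" "(x, q) \<in> T" "(y, r) \<in> S" "(y, s) \<in> T"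
      using \<open>(x, x') \<in> op_add S T\<close> \<open>(y, y') \<in> op_add S T\<close> unfolding op_add_def by auto
    moreover from this have "x' + y' = (p + r) + (q + s)" "(x + y, p + r) \<in> S" "(x + y, q + s) \<in> T"
      using S(3) T(3) by simp_all
    ultimately show ?thesis unfolding op_add_def by blast
  qed
  moreover have "(c *\<^sub>C x, c *\<^sub>C x') \<in> op_add S T" if "(x, x') \<in> op_add S T" for x x' c
    using that S(4) T(4) unfolding op_add_def by clarify (metis scaleC_add_right)
  ultimately show ?thesis unfolding linear_operator_def by blast
qed

lemma linear_op_scale:
  assumes "linear_operator T"
  shows "linear_operator (op_scale c T)"
proof -
  note T = linear_operatorD[OF assms(1)]
  have "single_valued (op_scale c T)"
    unfolding single_valued_def op_scale_def using T(1) by blast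
  moreover have "(0, 0) \<in> op_scale c T"
    unfolding op_scale_def using T(2) by (force simp: scaleC_zero_right)
  moreover have "(x + y, x' + y') \<in> op_scale c T"
    if "(x, x') \<in> op_scale c T" "(y, y') \<in> op_scale c T" for x x' y y'
    using that T(3) unfolding op_scale_def by (auto simp flip: scaleC_add_right)
  moreover have "(d *\<^sub>C x, d *\<^sub>C x') \<in> op_scale c T" if "(x, x') \<in> op_scale c T" for x x' d
    using that T(4)[of x _ d] unfolding op_scale_def by (auto simp: scaleC_scaleC) (metis mult.commute scaleC_scaleC)
  ultimately show ?thesis unfolding linear_operator_def by blast
qed

text \<open>The last part is maximality. The operator is minus its adjoint, hence it contains every pair that
is formally skew to all of its elements.\<close>

lemma skew_adjointD:
  assumes "skew_adjoint T"
  shows "linear_operator T" "closure (Domain T) = UNIV"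
    "(x, x') \<in> T \<Longrightarrow> (y, y') \<in> T \<Longrightarrow> rinner x' y = - rinner x y'"
    "(\<And>x x'. (x, x') \<in> T \<Longrightarrow> rinner z x' = - rinner z' x) \<Longrightarrow> (z, z') \<in> T"
proof -
  show L: "linear_operator T" and "closure (Domain T) = UNIV"
    using assms unfolding skew_adjoint_def densely_defined_def by auto
  have adj: "op_adjoint T = op_scale (- 1) T" using assms unfolding skew_adjoint_def by auto
  show "rinner x' y = - rinner x y'" if "(x, x') \<in> T" "(y, y') \<in> T"
  proof -
    have "(y, - y') \<in> op_adjoint T"
      unfolding adj op_scale_def using that(2) by (auto simp: scaleC_minus1)
    then have "cinner y x' = cinner (- y') x" unfolding op_adjoint_def using that(1) by auto
    then have "rinner y x' = rinner (- y') x" by (simp add: rinner_def)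
    then show ?thesis by (simp add: rinner_commute rinner_simps)
  qed
  show "(z, z') \<in> T" if *: "\<And>x x'. (x, x') \<in> T \<Longrightarrow> rinner z x' = - rinner z' x"
  proof -
    have "cinner z x' = cinner (- z') x" if x: "(x, x') \<in> T" for x x'
    proof (rule complex_eqI)
      show "Re (cinner z x') = Re (cinner (- z') x)"
        using *[OF x] by (simp add: rinner_def[symmetric] rinner_simps)
      have "rinner z (\<i> *\<^sub>C x') = - rinner z' (\<i> *\<^sub>C x)"
        using * linear_operatorD(4)[OF L x] by blast
      then show "Im (cinner z x') = Im (cinner (- z') x)"
        by (simp add: Im_cinner rinner_ii rinner_simps)
    qed
    then have "(z, - z') \<in> op_adjoint T" unfolding op_adjoint_def by auto
    then obtain w where w: "(z, w) \<in> T" "- z' = (- 1) *\<^sub>C w" unfolding adj op_scale_def by auto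
    then have "z' = w" by (simp add: scaleC_minus1)
    with w show ?thesis by simp
  qed
qed

lemma skew_adjointI:
  assumes L: "linear_operator T" and D: "closure (Domain T) = UNIV"
    and skew: "\<And>x x' y y'. (x, x') \<in> T \<Longrightarrow> (y, y') \<in> T \<Longrightarrow> rinner x' y = - rinner x y'"
    and max: "\<And>z z'. (\<And>x x'. (x, x') \<in> T \<Longrightarrow> rinner z x' = - rinner z' x) \<Longrightarrow> (z, z') \<in> T"
  shows "skew_adjoint T"
proof -
  have "op_adjoint T = op_scale (- 1) T"
  proof (intro set_eqI iffI; clarify)
    fix z w assume "(z, w) \<in> op_adjoint T"
    then have "cinner z x' = cinner w x" if "(x, x') \<in> T" for x x'
      using that unfolding op_adjoint_def by auto
    then have "rinner z x' = - rinner (- w) x" if "(x, x') \<in> T" for x x'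
      using that by (simp add: rinner_simps) (simp add: rinner_def)
    then have "(z, - w) \<in> T" using max by blast
    then show "(z, w) \<in> op_scale (- 1) T"
      unfolding op_scale_def by (auto intro!: exI[of _ "- w"] simp: scaleC_minus1)
  next
    fix z w assume "(z, w) \<in> op_scale (- 1) T"
    then obtain z' where z: "(z, z') \<in> T" "w = - z'" unfolding op_scale_def by (auto simp: scaleC_minus1)
    have "cinner z x' = cinner w x" if x: "(x, x') \<in> T" for x x'
    proof (rule complex_eqI)
      show "Re (cinner z x') = Re (cinner w x)"
        using skew[OF x z(1)] unfolding z(2)
        by (simp add: rinner_def[symmetric] rinner_simps rinner_commute[of z] rinner_commute[of z'])
      have "rinner (\<i> *\<^sub>C x') z = - rinner (\<i> *\<^sub>C x) z'"
        using skew linear_operatorD(4)[OF L x] z(1) by blast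
      then show "Im (cinner z x') = Im (cinner w x)"
        unfolding z(2) by (simp add: Im_cinner rinner_ii rinner_simps rinner_commute[of z] rinner_commute[of z'])
    qed
    then show "(z, w) \<in> op_adjoint T" unfolding op_adjoint_def by auto
  qed
  then show ?thesis unfolding skew_adjoint_def densely_defined_def using L D by simp
qed

lemma skew_adjoint_rinner_self:
  assumes "skew_adjoint T" "(x, x') \<in> T"
  shows "rinner x x' = 0"
  using skew_adjointD(3)[OF assms(1,2,2)] by (simp add: rinner_commute)

text \<open>By maximality, membership in \<open>T\<close> is tested by inner products, which are continuous.\<close>

lemma skew_adjoint_closed:
  assumes T: "skew_adjoint T" and f: "\<And>n::nat. (f n, g n) \<in> T" "f \<longlonglongrightarrow> x" "g \<longlonglongrightarrow> y"
  shows "(x, y) \<in> T"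
proof (rule skew_adjointD(4)[OF T])
  fix z z' assume z: "(z, z') \<in> T"
  have "(\<lambda>n. rinner (f n) z') \<longlonglongrightarrow> rinner x z'"
    by (intro bounded_bilinear.tendsto[OF bounded_bilinear_rinner] tendsto_const f)
  moreover have "rinner (f n) z' = - rinner (g n) z" for n
    using skew_adjointD(3)[OF T f(1)[of n] z] by simp
  moreover have "(\<lambda>n. - rinner (g n) z) \<longlonglongrightarrow> - rinner y z"
    by (intro tendsto_minus bounded_bilinear.tendsto[OF bounded_bilinear_rinner] tendsto_const f)
  ultimately show "rinner x z' = - rinner y z"
    using LIMSEQ_unique by fastforce
qed

text \<open>The lower bound makes the range of \<open>T - z\<close> closed. A vector orthogonal to the range is an
eigenvector of the adjoint \<open>- T\<close> for the eigenvalue \<open>cnj z\<close>, which \<open>inj\<close> excludes.\<close>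

lemma skew_adjoint_resolvent_surj:
  fixes T :: "'h::chilbert_space operator"
  assumes T: "skew_adjoint T" and e: "e > 0"
    and bound: "\<And>x x'. (x, x') \<in> T \<Longrightarrow> e * norm x \<le> norm (x' - z *\<^sub>C x)"
    and inj: "\<And>x. (x, - (cnj z *\<^sub>C x)) \<in> T \<Longrightarrow> x = 0"
  shows "\<exists>x x'. (x, x') \<in> T \<and> x' - z *\<^sub>C x = w"
proof (rule ccontr)
  define V where "V = {x' - z *\<^sub>C x | x x'. (x, x') \<in> T}"
  note L = linear_operatorD[OF skew_adjointD(1)[OF T]]
  assume "\<not> ?thesis"
  then have w: "w \<notin> V" unfolding V_def by blast
  have "subspace V"
    unfolding subspace_def
  proof (intro conjI ballI allI)
    have "0 = 0 - z *\<^sub>C (0::'h)" by (simp add: scaleC_zero_right)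
    then show "0 \<in> V" unfolding V_def using L(2) by blast
  next
    fix p q assume "p \<in> V" "q \<in> V"
    then obtain x x' y y' where *: "(x, x') \<in> T" "p = x' - z *\<^sub>C x" "(y, y') \<in> T" "q = y' - z *\<^sub>C y"
      unfolding V_def by blast
    have "p + q = (x' + y') - z *\<^sub>C (x + y)" unfolding * by (simp add: scaleC_add_right)
    then show "p + q \<in> V" unfolding V_def using L(3)[OF *(1,3)] by blast
  next
    fix c :: real and p assume "p \<in> V"
    then obtain x x' where *: "(x, x') \<in> T" "p = x' - z *\<^sub>C x"
      unfolding V_def by blast
    have "c *\<^sub>R p = (c *\<^sub>R x') - z *\<^sub>C (c *\<^sub>R x)" unfolding * by (simp add: scaleC_scaleR scaleR_diff_right)
    then show "c *\<^sub>R p \<in> V" unfolding V_def using L(5)[OF *(1)] by blast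
  qed
  moreover have "closed V"
    unfolding closed_sequential_limits
  proof (intro allI impI; elim conjE)
    fix p l assume p: "\<forall>n. p n \<in> V" "p \<longlonglongrightarrow> l"
    then obtain f g where f: "\<And>n::nat. (f n, g n) \<in> T" and fp: "\<And>n. p n = g n - z *\<^sub>C f n"
      unfolding V_def by simp metis
    have "e * norm (f n - f m) \<le> norm (p n - p m)" for n m
    proof -
      have "p n - p m = (g n - g m) - z *\<^sub>C (f n - f m)" unfolding fp by (simp add: scaleC_diff_right)
      then show ?thesis using bound[OF L(7)[OF f f]] by metis
    qed
    then have nb: "norm (f n - f m) \<le> norm (p n - p m) / e" for n m
      using e by (simp add: field_simps)
    have "Cauchy p" using p(2) by (rule LIMSEQ_imp_Cauchy)
    have "Cauchy f"
    proof (rule metric_CauchyI)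
      fix d :: real assume d: "d > 0"
      obtain N where N: "\<And>m n. m \<ge> N \<Longrightarrow> n \<ge> N \<Longrightarrow> dist (p m) (p n) < d * e"
        using metric_CauchyD[OF \<open>Cauchy p\<close>, of "d * e"] d e by auto
      have "dist (f m) (f n) < d" if "m \<ge> N" "n \<ge> N" for m n
        using N[OF that] nb[of m n] e unfolding dist_norm by (smt (verit) pos_divide_less_eq)
      then show "\<exists>M. \<forall>m\<ge>M. \<forall>n\<ge>M. dist (f m) (f n) < d" by blast
    qed
    then obtain x where x: "f \<longlonglongrightarrow> x" using Cauchy_convergent_iff convergent_def by blast
    have "(\<lambda>n. p n + z *\<^sub>C f n) \<longlonglongrightarrow> l + z *\<^sub>C x"
      by (intro tendsto_add p bounded_linear.tendsto[OF bounded_linear_scaleC] x)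
    then have "g \<longlonglongrightarrow> l + z *\<^sub>C x" by (simp add: fp)
    then have "(x, l + z *\<^sub>C x) \<in> T" using skew_adjoint_closed[OF T f x] by simp
    moreover have "l = (l + z *\<^sub>C x) - z *\<^sub>C x" by simp
    ultimately show "l \<in> V" unfolding V_def by blast
  qed
  ultimately obtain y where y: "y \<noteq> 0" "\<And>v. v \<in> V \<Longrightarrow> rinner y v = 0"
    using closed_subspace_orthogonal w by blast
  have adj: "rinner y (z *\<^sub>C x) = rinner (cnj z *\<^sub>C y) x" for x
    by (simp add: rinner_def cinner_scaleC_left cinner_scaleC_right)
  have "rinner y x' = - rinner (- (cnj z *\<^sub>C y)) x" if "(x, x') \<in> T" for x x'
  proof -
    have "rinner y (x' - z *\<^sub>C x) = 0" using y(2) that unfolding V_def by blast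
    then show ?thesis using adj by (simp add: rinner_simps)
  qed
  then have "(y, - (cnj z *\<^sub>C y)) \<in> T" by (rule skew_adjointD(4)[OF T])
  with inj y(1) show False by blast
qed

text \<open>Surjectivity leaves no room for a proper extension: if \<open>(z, z')\<close> is formally skew to \<open>T\<close> and
\<open>y\<close> solves \<open>(T - l) y = z' - l z\<close>, then \<open>z - y\<close> is orthogonal to the range of \<open>T + l\<close>.\<close>

lemma skew_adjoint_criterion:
  fixes T :: "'h::chilbert_space operator"
  assumes L: "linear_operator T" and D: "closure (Domain T) = UNIV"
    and skew: "\<And>x x' y y'. (x, x') \<in> T \<Longrightarrow> (y, y') \<in> T \<Longrightarrow> rinner x' y = - rinner x y'"
    and surj: "\<And>w. \<exists>x x'. (x, x') \<in> T \<and> x' - l *\<^sub>R x = w" "\<And>w. \<exists>x x'. (x, x') \<in> T \<and> x' + l *\<^sub>R x = w"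
  shows "skew_adjoint T"
proof (rule skew_adjointI[OF L D skew])
  fix z z' assume *: "\<And>x x'. (x, x') \<in> T \<Longrightarrow> rinner z x' = - rinner z' x"
  obtain y y' where y: "(y, y') \<in> T" "y' - l *\<^sub>R y = z' - l *\<^sub>R z" using surj(1) by blast
  obtain x x' where x: "(x, x') \<in> T" "x' + l *\<^sub>R x = z - y" using surj(2) by blast
  have yz: "y' - z' = l *\<^sub>R (y - z)" using y(2) by (simp add: algebra_simps)
  have "rinner (z - y) x' = - rinner z' x + rinner y' x"
    using *[OF x(1)] skew[OF y(1) x(1)] by (simp add: rinner_simps)
  also have "\<dots> = rinner (y' - z') x" by (simp add: rinner_simps)
  also have "\<dots> = l * rinner (y - z) x" by (simp add: yz rinner_simps)
  finally have "rinner (z - y) (x' + l *\<^sub>R x) = 0" by (simp add: rinner_simps algebra_simps)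
  then have "z = y" unfolding x(2) by (simp add: rinner_self)
  with y show "(z, z') \<in> T" by (simp add: algebra_simps)
qed

lemma skew_adjoint_norm_shift:
  assumes "skew_adjoint T" "(x, x') \<in> T"
  shows "(norm (x' - l *\<^sub>R x))\<^sup>2 = (norm x')\<^sup>2 + l\<^sup>2 * (norm x)\<^sup>2"
  using skew_adjoint_rinner_self[OF assms]
  by (simp add: norm_diff_sq rinner_simps rinner_commute power_mult_distrib)

lemma skew_adjoint_real_resolvent:
  fixes T :: "'h::chilbert_space operator"
  assumes T: "skew_adjoint T" and l: "l \<noteq> 0"
  shows "\<exists>x x'. (x, x') \<in> T \<and> x' - l *\<^sub>R x = w"
proof -
  have b: "\<bar>m\<bar> * norm x \<le> norm (x' - m *\<^sub>R x)" if "(x, x') \<in> T" for x x' m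
  proof (rule power2_le_imp_le)
    show "(\<bar>m\<bar> * norm x)\<^sup>2 \<le> (norm (x' - m *\<^sub>R x))\<^sup>2"
      by (simp add: skew_adjoint_norm_shift[OF T that] power_mult_distrib)
  qed simp
  have "\<exists>x x'. (x, x') \<in> T \<and> x' - complex_of_real l *\<^sub>C x = w"
  proof (rule skew_adjoint_resolvent_surj[OF T])
    show "\<bar>l\<bar> > 0" using l by simp
    show "\<bar>l\<bar> * norm x \<le> norm (x' - complex_of_real l *\<^sub>C x)" if "(x, x') \<in> T" for x x'
      using b[OF that] by (simp add: scaleR_scaleC)
    show "x = 0" if "(x, - (cnj (complex_of_real l) *\<^sub>C x)) \<in> T" for x
      using b[OF that, of "- l"] l by (simp add: scaleR_scaleC[symmetric] mult_le_0_iff)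
  qed
  then show ?thesis by (simp add: scaleR_scaleC)
qed

text \<open>This is the inverse of \<open>1 - r T\<close>, for skew-adjoint \<open>T\<close> and real \<open>r \<noteq> 0\<close> a contraction. In this
normalization the resolvents tend to the identity as \<open>r\<close> tends to \<open>0\<close>.\<close>

definition resolvent :: "'a::complex_inner operator \<Rightarrow> real \<Rightarrow> 'a \<Rightarrow> 'a"
  where "resolvent T r w = (THE x. \<exists>x'. (x, x') \<in> T \<and> x - r *\<^sub>R x' = w)"

context
  fixes T :: "'h::chilbert_space operator"
  assumes T: "skew_adjoint T"
begin

private lemmas L = linear_operatorD[OF skew_adjointD(1)[OF T]]

lemma resolvent_norm:
  assumes "(x, x') \<in> T"
  shows "norm x \<le> norm (x - r *\<^sub>R x')"
proof (rule power2_le_imp_le)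
  show "(norm x)\<^sup>2 \<le> (norm (x - r *\<^sub>R x'))\<^sup>2"
    using skew_adjoint_rinner_self[OF T assms] by (simp add: norm_diff_sq rinner_simps)
qed simp

lemma resolvent_unique:
  assumes "(x, x') \<in> T" "(y, y') \<in> T" "x - r *\<^sub>R x' = y - r *\<^sub>R y'"
  shows "x = y"
proof -
  have "(x - y) - r *\<^sub>R (x' - y') = 0" using assms(3) by (simp add: algebra_simps)
  then have "norm (x - y) \<le> 0" using resolvent_norm[OF L(7)[OF assms(1,2)], of r] by (metis norm_zero)
  then show ?thesis by simp
qed

lemma resolvent_eq: "(x, x') \<in> T \<Longrightarrow> resolvent T r (x - r *\<^sub>R x') = x"
  unfolding resolvent_def by (rule the_equality) (auto dest: resolvent_unique)

lemma resolvent_ex: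
  assumes "r \<noteq> 0"
  shows "\<exists>x'. (resolvent T r w, x') \<in> T \<and> resolvent T r w - r *\<^sub>R x' = w"
proof -
  obtain x x' where x: "(x, x') \<in> T" "x' - (1/r) *\<^sub>R x = - (1/r) *\<^sub>R w"
    using skew_adjoint_real_resolvent[OF T, of "1/r" "- (1/r) *\<^sub>R w"] assms by auto
  have "r *\<^sub>R (x' - (1/r) *\<^sub>R x) = - w" unfolding x(2) using assms by simp
  then have "x - r *\<^sub>R x' = w" using assms by (simp add: algebra_simps)
  then show ?thesis using resolvent_eq[OF x(1), of r] x(1) by auto
qed

lemma resolvent_in:
  assumes "r \<noteq> 0"
  shows "(resolvent T r w, (1/r) *\<^sub>R (resolvent T r w - w)) \<in> T"
proof -
  obtain x' where x: "(resolvent T r w, x') \<in> T" "resolvent T r w - r *\<^sub>R x' = w"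
    using resolvent_ex[OF assms] by blast
  have "resolvent T r w - w = r *\<^sub>R x'" using x(2) by (simp add: algebra_simps)
  then have "(1/r) *\<^sub>R (resolvent T r w - w) = x'" using assms by simp
  with x show ?thesis by metis
qed

lemma resolvent_bounded_linear:
  assumes r: "r \<noteq> 0"
  shows "bounded_linear (resolvent T r)"
proof (rule bounded_linear_intro[of _ 1])
  fix x y
  obtain x' where x: "(resolvent T r x, x') \<in> T" "resolvent T r x - r *\<^sub>R x' = x" using resolvent_ex[OF r] by blast
  obtain y' where y: "(resolvent T r y, y') \<in> T" "resolvent T r y - r *\<^sub>R y' = y" using resolvent_ex[OF r] by blast
  have *: "(resolvent T r x + resolvent T r y) - r *\<^sub>R (x' + y') = x + y"
    using arg_cong2[OF x(2) y(2), of "(+)"] by (simp add: algebra_simps)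
  show "resolvent T r (x + y) = resolvent T r x + resolvent T r y"
    using resolvent_eq[OF L(3)[OF x(1) y(1)], of r] unfolding * .
next
  fix c x
  obtain x' where x: "(resolvent T r x, x') \<in> T" "resolvent T r x - r *\<^sub>R x' = x" using resolvent_ex[OF r] by blast
  have *: "c *\<^sub>R resolvent T r x - r *\<^sub>R (c *\<^sub>R x') = c *\<^sub>R x"
    using arg_cong[OF x(2), of "(*\<^sub>R) c"] by (simp add: algebra_simps)
  show "resolvent T r (c *\<^sub>R x) = c *\<^sub>R resolvent T r x"
    using resolvent_eq[OF L(5)[OF x(1), of c], of r] unfolding * .
next
  fix x
  obtain x' where x: "(resolvent T r x, x') \<in> T" "resolvent T r x - r *\<^sub>R x' = x" using resolvent_ex[OF r] by blast
  show "norm (resolvent T r x) \<le> norm x * 1" using resolvent_norm[OF x(1), of r] x(2) by simp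
qed

lemma resolvent_contraction: "r \<noteq> 0 \<Longrightarrow> norm (resolvent T r x) \<le> norm x"
  using resolvent_ex[of r x] resolvent_norm by metis

lemma resolvent_commutes:
  assumes "r \<noteq> 0" "(x, x') \<in> T"
  shows "(resolvent T r x, resolvent T r x') \<in> T"
proof -
  have "resolvent T r x - r *\<^sub>R resolvent T r x' = resolvent T r (x - r *\<^sub>R x')"
    using resolvent_bounded_linear[OF assms(1)]
    by (simp add: bounded_linear.linear linear_diff linear_scale)
  also have "\<dots> = x" by (rule resolvent_eq[OF assms(2)])
  finally have "(1/r) *\<^sub>R (resolvent T r x - x) = resolvent T r x'"
    using assms(1) by (simp add: algebra_simps)
  then show ?thesis using resolvent_in[OF assms(1), of x] by simp
qed

lemma resolvent_resolvent:
  assumes "r \<noteq> 0" "s \<noteq> 0"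
  shows "resolvent T r (resolvent T s x) = resolvent T s (resolvent T r x)"
proof -
  obtain x' where x: "(resolvent T s x, x') \<in> T" "resolvent T s x - s *\<^sub>R x' = x" using resolvent_ex[OF assms(2)] by blast
  have "resolvent T r x = resolvent T r (resolvent T s x - s *\<^sub>R x')" by (simp add: x(2))
  also have "\<dots> = resolvent T r (resolvent T s x) - s *\<^sub>R resolvent T r x'"
    using resolvent_bounded_linear[OF assms(1)]
    by (simp add: bounded_linear.linear linear_diff linear_scale)
  finally show ?thesis using resolvent_eq[OF resolvent_commutes[OF assms(1) x(1)], of s] by simp
qed

lemma resolvent_adjoint:
  assumes r: "r \<noteq> 0"
  shows "rinner (resolvent T r x) y = rinner x (resolvent T (- r) y)"
proof -
  obtain x' where x: "(resolvent T r x, x') \<in> T" "resolvent T r x - r *\<^sub>R x' = x" using resolvent_ex[OF r] by blast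
  obtain y' where y: "(resolvent T (- r) y, y') \<in> T" "resolvent T (- r) y - (- r) *\<^sub>R y' = y" using resolvent_ex[of "- r"] r by auto
  have "rinner (resolvent T r x) (resolvent T (- r) y - (- r) *\<^sub>R y') = rinner (resolvent T r x - r *\<^sub>R x') (resolvent T (- r) y)"
    using skew_adjointD(3)[OF T x(1) y(1)] by (simp add: rinner_simps)
  then show ?thesis unfolding x(2) y(2) .
qed

text \<open>On the domain the difference to the identity is \<open>r\<close> times a vector of bounded norm; density and
contractivity give the rest.\<close>

lemma resolvent_tendsto_id:
  assumes r: "\<And>n::nat. r n \<noteq> 0" "r \<longlonglongrightarrow> 0"
  shows "(\<lambda>n. resolvent T (r n) x) \<longlonglongrightarrow> x"
proof (rule LIMSEQ_I)
  fix e :: real assume e: "e > 0"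
  obtain y y' where y: "(y, y') \<in> T" "norm (x - y) < e / 3"
  proof -
    have "x \<in> closure (Domain T)" using skew_adjointD(2)[OF T] by simp
    then obtain y where "y \<in> Domain T" "dist y x < e / 3" unfolding closure_approachable
      using e by (metis divide_pos_pos zero_less_numeral)
    then show ?thesis using that by (auto simp: dist_norm norm_minus_commute)
  qed
  have "(\<lambda>n. \<bar>r n\<bar> * norm y') \<longlonglongrightarrow> 0"
    using tendsto_mult_left_zero[OF tendsto_rabs_zero[OF r(2)]] .
  then obtain N where N: "\<And>n. n \<ge> N \<Longrightarrow> \<bar>r n\<bar> * norm y' < e / 3"
    using e by (force dest!: LIMSEQ_D[where r = "e/3"])
  have "norm (resolvent T (r n) x - x) < e" if "n \<ge> N" for n
  proof -
    interpret R: bounded_linear "resolvent T (r n)" by (rule resolvent_bounded_linear[OF r(1)])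
    have "y = resolvent T (r n) y - r n *\<^sub>R resolvent T (r n) y'"
      using resolvent_eq[OF y(1), of "r n"] by (simp add: R.diff R.scaleR)
    then have "resolvent T (r n) y - y = r n *\<^sub>R resolvent T (r n) y'" by (metis add_diff_cancel_left' diff_add_cancel)
    then have "norm (resolvent T (r n) y - y) \<le> \<bar>r n\<bar> * norm y'"
      using resolvent_contraction[OF r(1), of n y'] by (simp add: mult_left_mono)
    moreover have "norm (resolvent T (r n) (x - y)) \<le> norm (x - y)"
      using resolvent_contraction[OF r(1)] .
    moreover have "resolvent T (r n) x - x = resolvent T (r n) (x - y) + (resolvent T (r n) y - y) - (x - y)"
      by (simp add: R.diff)
    ultimately have "norm (resolvent T (r n) x - x) \<le> norm (x - y) + \<bar>r n\<bar> * norm y' + norm (x - y)"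
      by (smt (verit, best) norm_triangle_ineq norm_triangle_ineq4)
    then show ?thesis using N[OF that] y(2) by simp
  qed
  then show "\<exists>N. \<forall>n\<ge>N. norm (resolvent T (r n) x - x) < e" by blast
qed

end

section \<open>Evolution equations with bounded generators\<close>

lemma has_vector_derivative_iff_difference_quotient:
  fixes y :: "real \<Rightarrow> 'a::real_normed_vector"
  shows "(y has_vector_derivative y') (at t) \<longleftrightarrow> ((\<lambda>h. (y (t + h) - y t) /\<^sub>R h) \<longlongrightarrow> y') (at 0)"
proof -
  have "((\<lambda>h. (y (t + h) - y t) /\<^sub>R h) \<longlongrightarrow> y') (at 0) \<longleftrightarrow>
      ((\<lambda>h. norm ((y (t + h) - y t) /\<^sub>R h - y')) \<longlongrightarrow> 0) (at 0)"
    by (metis (mono_tags) tendsto_norm_zero_iff LIM_zero_iff)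
  also have "\<dots> \<longleftrightarrow> ((\<lambda>h. norm (y (t + h) - y t - h *\<^sub>R y') / norm h) \<longlongrightarrow> 0) (at 0)"
  proof (rule filterlim_cong[OF refl refl])
    have "norm ((y (t + h) - y t) /\<^sub>R h - y') = norm (y (t + h) - y t - h *\<^sub>R y') / norm h" if "h \<noteq> 0" for h
    proof -
      have "(y (t + h) - y t) /\<^sub>R h - y' = (y (t + h) - y t - h *\<^sub>R y') /\<^sub>R h"
        using that by (simp add: algebra_simps)
      then show ?thesis by (simp add: divide_inverse_commute)
    qed
    then show "\<forall>\<^sub>F h in at 0. norm ((y (t + h) - y t) /\<^sub>R h - y') = norm (y (t + h) - y t - h *\<^sub>R y') / norm h"
      by (auto simp: eventually_at_filter)
  qed
  also have "\<dots> \<longleftrightarrow> (y has_vector_derivative y') (at t)"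
    unfolding has_vector_derivative_def has_derivative_at
    by (simp add: bounded_linear_scaleR_left)
  finally show ?thesis by simp
qed

lemma has_vector_derivative_uniform_limit:
  fixes f :: "nat \<Rightarrow> real \<Rightarrow> 'a::banach"
  assumes f: "\<And>n t. (f n has_vector_derivative f' n t) (at t)"
    and f': "\<And>R. uniform_limit {-R<..<R} f' g' sequentially"
    and lim: "\<And>t. (\<lambda>n. f n t) \<longlonglongrightarrow> g t"
  shows "(g has_vector_derivative g' t) (at t)"
proof -
  define S where "S = {-(\<bar>t\<bar> + 1)<..<\<bar>t\<bar> + 1}"
  have t: "t \<in> S" by (auto simp: S_def)
  have "\<exists>k. \<forall>s\<in>S. (\<lambda>n. f n s) \<longlonglongrightarrow> k s \<and> (k has_derivative (\<lambda>h. h *\<^sub>R g' s)) (at s within S)"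
  proof (rule has_derivative_sequence[OF _ _ _ t lim])
    show "(f n has_derivative (\<lambda>h. h *\<^sub>R f' n s)) (at s within S)" for n s
      using f[of n s] unfolding has_vector_derivative_def by (rule has_derivative_at_withinI)
    fix e :: real assume "e > 0"
    with f' have "\<forall>\<^sub>F n in sequentially. \<forall>s\<in>S. dist (f' n s) (g' s) < e"
      unfolding S_def uniform_limit_iff by blast
    then show "\<forall>\<^sub>F n in sequentially. \<forall>s\<in>S. \<forall>h. norm (h *\<^sub>R f' n s - h *\<^sub>R g' s) \<le> e * norm h"
    proof (rule eventually_mono, intro ballI allI)
      fix n s h assume "\<forall>s\<in>S. dist (f' n s) (g' s) < e" and s: "s \<in> S"
      then have "norm (f' n s - g' s) \<le> e" by (simp add: dist_norm less_imp_le)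
      from mult_left_mono[OF this abs_ge_zero[of h]]
      show "norm (h *\<^sub>R f' n s - h *\<^sub>R g' s) \<le> e * norm h"
        by (simp add: scaleR_diff_right[symmetric] mult.commute)
    qed
  qed (simp add: S_def)
  then obtain k where k: "\<And>s. s \<in> S \<Longrightarrow> (\<lambda>n. f n s) \<longlonglongrightarrow> k s"
    "\<And>s. s \<in> S \<Longrightarrow> (k has_derivative (\<lambda>h. h *\<^sub>R g' s)) (at s within S)" by blast
  have "(g has_derivative (\<lambda>h. h *\<^sub>R g' t)) (at t within S)"
    by (rule has_derivative_transform[OF t _ k(2)[OF t]]) (rule LIMSEQ_unique[OF lim k(1)])
  then show ?thesis
    unfolding has_vector_derivative_def using at_within_open[OF t] by (simp add: S_def)
qed

lemma norm_sq_has_real_derivative: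
  assumes "(y has_vector_derivative y') (at t within S)"
  shows "((\<lambda>t. (norm (y t))\<^sup>2) has_real_derivative 2 * rinner (y t) y') (at t within S)"
proof -
  have "((\<lambda>t. rinner (y t) (y t)) has_vector_derivative rinner (y t) y' + rinner y' (y t)) (at t within S)"
    by (rule bounded_bilinear.has_vector_derivative[OF bounded_bilinear_rinner assms assms])
  then show ?thesis
    by (simp add: rinner_self has_real_derivative_iff_has_vector_derivative rinner_commute)
qed

lemma skew_evolution_norm:
  assumes "\<And>t. (y has_vector_derivative y' t) (at t)" "\<And>t. rinner (y t) (y' t) = 0"
  shows "norm (y t) = norm (y 0)"
proof -
  have "((\<lambda>t. (norm (y t))\<^sup>2) has_real_derivative 0) (at t)" for t
    using norm_sq_has_real_derivative[OF assms(1)[of t]] assms(2)[of t] by simp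
  then have "(norm (y t))\<^sup>2 = (norm (y 0))\<^sup>2" by (intro DERIV_isconst_all) auto
  then show ?thesis by (simp add: power2_eq_iff_nonneg)
qed

text \<open>The solution is the exponential series. The derivative of a partial sum is \<open>C\<close> applied to the
preceding partial sum, so the derivatives converge locally uniformly as well.\<close>

lemma bounded_linear_flow_ex:
  fixes C :: "'a::banach \<Rightarrow> 'a"
  assumes C: "bounded_linear C"
  shows "\<exists>y. y 0 = x \<and> (\<forall>t. (y has_vector_derivative C (y t)) (at t))"
proof -
  interpret C: bounded_linear C by (rule C)
  obtain K where K: "K > 0" "\<And>x. norm (C x) \<le> norm x * K" using C.pos_bounded by blast
  define P where "P n t = (\<Sum>k<n. (t ^ k / fact k) *\<^sub>R (C ^^ k) x)" for n and t :: real
  define y where "y t = (\<Sum>k. (t ^ k / fact k) *\<^sub>R (C ^^ k) x)" for t :: real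
  have Ck: "norm ((C ^^ k) x) \<le> K ^ k * norm x" for k
  proof (induction k)
    case (Suc k)
    have "norm ((C ^^ Suc k) x) \<le> norm ((C ^^ k) x) * K" using K(2) by simp
    also have "\<dots> \<le> (K ^ k * norm x) * K" using Suc K(1) by (intro mult_right_mono) auto
    finally show ?case by (simp add: ac_simps)
  qed simp
  have ul: "uniform_limit {-R<..<R} P y sequentially" for R
    unfolding P_def y_def
  proof (rule Weierstrass_m_test)
    fix k and t :: real assume t: "t \<in> {-R<..<R}"
    have "norm ((t ^ k / fact k) *\<^sub>R (C ^^ k) x) \<le> (R ^ k / fact k) * (K ^ k * norm x)"
      unfolding norm_scaleR using Ck[of k] t
      by (intro mult_mono) (auto simp: power_abs intro!: divide_right_mono power_mono)
    also have "\<dots> = (inverse (fact k) * (R * K) ^ k) * norm x" by (simp add: power_mult_distrib divide_inverse)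
    finally show "norm ((t ^ k / fact k) *\<^sub>R (C ^^ k) x) \<le> (inverse (fact k) * (R * K) ^ k) * norm x" .
  next
    show "summable (\<lambda>k. (inverse (fact k) * (R * K) ^ k) * norm x)"
      by (intro summable_mult2 summable_exp)
  qed
  have ptw: "(\<lambda>n. P n t) \<longlonglongrightarrow> y t" for t
    using tendsto_uniform_limitI[OF ul[of "\<bar>t\<bar> + 1"], of t] by (simp add: abs_if)
  have Pd: "((\<lambda>t. P (Suc n) t) has_vector_derivative C (P n t)) (at t)" for n t
  proof -
    have d: "((\<lambda>t. t ^ k / fact k) has_real_derivative (if k = 0 then 0 else t ^ (k - 1) / fact (k - 1))) (at t)" for k
    proof (cases k)
      case (Suc m)
      have "real (Suc m) * t ^ m / fact (Suc m) = t ^ m / fact m"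
        unfolding fact_Suc of_nat_mult by simp
      then show ?thesis
        using DERIV_cdivide[OF DERIV_pow[of k t], of "fact k"] unfolding Suc by simp
    qed simp
    have "((\<lambda>t. (t ^ k / fact k) *\<^sub>R (C ^^ k) x) has_vector_derivative
        (if k = 0 then 0 else t ^ (k - 1) / fact (k - 1)) *\<^sub>R (C ^^ k) x) (at t)" for k
      using has_vector_derivative_scaleR[OF d[of k] has_vector_derivative_const, of "(C ^^ k) x"] by auto
    then have "((\<lambda>t. P (Suc n) t) has_vector_derivative
        (\<Sum>k<Suc n. (if k = 0 then 0 else t ^ (k - 1) / fact (k - 1)) *\<^sub>R (C ^^ k) x)) (at t)"
      unfolding P_def by (intro has_vector_derivative_sum)
    also have "(\<Sum>k<Suc n. (if k = 0 then 0 else t ^ (k - 1) / fact (k - 1)) *\<^sub>R (C ^^ k) x) = C (P n t)"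
      unfolding sum.lessThan_Suc_shift P_def by (simp add: C.sum C.scaleR)
    finally show ?thesis .
  qed
  have "(y has_vector_derivative C (y t)) (at t)" for t
    by (rule has_vector_derivative_uniform_limit[OF Pd bounded_linear.uniform_limit[OF C ul] LIMSEQ_Suc[OF ptw]])
  moreover have "y 0 = x"
  proof -
    have "P (Suc n) 0 = x" for n unfolding P_def sum.lessThan_Suc_shift by simp
    then show ?thesis using LIMSEQ_unique[OF LIMSEQ_Suc[OF ptw[of 0]], of x] by simp
  qed
  ultimately show ?thesis by blast
qed

definition exp_flow :: "('a::real_normed_vector \<Rightarrow> 'a) \<Rightarrow> real \<Rightarrow> 'a \<Rightarrow> 'a"
  where "exp_flow C t x = (SOME y. y 0 = x \<and> (\<forall>t. (y has_vector_derivative C (y t)) (at t))) t"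

context
  fixes C :: "'h::chilbert_space \<Rightarrow> 'h"
  assumes C: "bounded_linear C" and skew: "\<And>x y. rinner (C x) y = - rinner x (C y)"
begin

interpretation C: bounded_linear C by (rule C)

lemma exp_flow_0: "exp_flow C 0 x = x"
  and exp_flow_deriv: "((\<lambda>t. exp_flow C t x) has_vector_derivative C (exp_flow C t x)) (at t)"
  using someI_ex[OF bounded_linear_flow_ex[OF C, of x]] unfolding exp_flow_def by auto

lemma skew_self: "rinner x (C x) = 0"
  using skew[of x x] by (simp add: rinner_commute)

lemma exp_flow_norm: "norm (exp_flow C t x) = norm x"
  using skew_evolution_norm[OF exp_flow_deriv skew_self, of t x] by (simp add: exp_flow_0)

text \<open>The difference of two solutions has constant norm. Linearity, the group law and the commutation
with other operators are instances of this uniqueness.\<close>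

lemma exp_flow_unique:
  assumes y: "\<And>t. (y has_vector_derivative C (y t)) (at t)" "y 0 = x"
  shows "y t = exp_flow C t x"
proof -
  have "((\<lambda>t. y t - exp_flow C t x) has_vector_derivative C (y t - exp_flow C t x)) (at t)" for t
    unfolding C.diff by (intro has_vector_derivative_diff y exp_flow_deriv)
  from skew_evolution_norm[OF this skew_self, of t] show ?thesis by (simp add: y exp_flow_0)
qed

lemma exp_flow_commutes:
  assumes P: "bounded_linear P" "\<And>x. P (C x) = C (P x)"
  shows "P (exp_flow C t x) = exp_flow C t (P x)"
proof -
  have "((\<lambda>t. P (exp_flow C t x)) has_vector_derivative C (P (exp_flow C t x))) (at t)" for t
    using bounded_linear.has_vector_derivative[OF P(1) exp_flow_deriv[where x = x and t = t]] P(2) by simp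
  from exp_flow_unique[OF this] show ?thesis by (simp add: exp_flow_0)
qed

lemma exp_flow_add: "exp_flow C t (x + y) = exp_flow C t x + exp_flow C t y"
proof -
  have "((\<lambda>t. exp_flow C t x + exp_flow C t y) has_vector_derivative C (exp_flow C t x + exp_flow C t y)) (at t)" for t
    unfolding C.add by (intro has_vector_derivative_add exp_flow_deriv)
  from exp_flow_unique[OF this] show ?thesis by (simp add: exp_flow_0)
qed

lemma exp_flow_scaleR: "exp_flow C t (r *\<^sub>R x) = r *\<^sub>R exp_flow C t x"
  using exp_flow_commutes[OF bounded_linear_scaleR_right[of r]] by (simp add: C.scaleR)

lemma exp_flow_bounded_linear: "bounded_linear (exp_flow C t)"
  by (rule bounded_linear_intro[of _ 1]) (simp_all add: exp_flow_add exp_flow_scaleR exp_flow_norm)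

lemma exp_flow_group: "exp_flow C (s + t) x = exp_flow C s (exp_flow C t x)"
proof -
  have "((\<lambda>s. exp_flow C (s + t) x) has_vector_derivative C (exp_flow C (s + t) x)) (at s)" for s
    using exp_flow_deriv[where x = x and t = "s + t"] unfolding has_vector_derivative_iff_difference_quotient
    by (simp add: add.assoc add.commute add.left_commute)
  from exp_flow_unique[OF this] show ?thesis by simp
qed

end

section \<open>Unitary groups and their generators\<close>

context
  fixes U :: "real \<Rightarrow> 'h::chilbert_space \<Rightarrow> 'h"
  assumes U: "unitary_group U"
begin

lemma unitary_groupD:
  shows "U t (x + y) = U t x + U t y" "U t (c *\<^sub>C x) = c *\<^sub>C U t x" "norm (U t x) = norm x"
    "U 0 x = x" "U (s + t) x = U s (U t x)" "continuous_on UNIV (\<lambda>t. U t x)"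
    "U t (r *\<^sub>R x) = r *\<^sub>R U t x" "bounded_linear (U t)" "U t (x - y) = U t x - U t y"
proof -
  show 1: "U t (x + y) = U t x + U t y" "U t (c *\<^sub>C x) = c *\<^sub>C U t x" "norm (U t x) = norm x"
    "U 0 x = x" "U (s + t) x = U s (U t x)" "continuous_on UNIV (\<lambda>t. U t x)" for t x y c s
    using U unfolding unitary_group_def by auto
  show 2: "U t (r *\<^sub>R x) = r *\<^sub>R U t x" for t r x by (simp add: scaleR_scaleC 1)
  show *: "bounded_linear (U t)" for t
    by (rule bounded_linear_intro[of _ 1]) (simp_all add: 1 2)
  show "U t (x - y) = U t x - U t y" using * by (simp add: bounded_linear.linear linear_diff)
qed

lemma unitary_group_rinner: "rinner (U t x) (U t y) = rinner x y"
proof -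
  have "(norm (U t x + U t y))\<^sup>2 = (norm (x + y))\<^sup>2"
    using unitary_groupD(1)[of t x y] unitary_groupD(3) by metis
  then show ?thesis by (simp add: norm_add_sq unitary_groupD(3))
qed

lemma group_generator_invariant:
  assumes "(x, x') \<in> group_generator U"
  shows "(U t x, U t x') \<in> group_generator U"
proof -
  have "((\<lambda>h. U t ((U h x - x) /\<^sub>R h)) \<longlongrightarrow> U t x') (at 0)"
    by (rule bounded_linear.tendsto[OF unitary_groupD(8)]) (use assms in \<open>simp add: group_generator_def\<close>)
  moreover have "U t ((U h x - x) /\<^sub>R h) = (U h (U t x) - U t x) /\<^sub>R h" for h
    using unitary_groupD(5)[of t h x] unitary_groupD(5)[of h t x]
    by (simp add: unitary_groupD(7,9) add.commute)
  ultimately show ?thesis by (simp add: group_generator_def)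
qed

lemma group_generator_deriv:
  assumes "(x, x') \<in> group_generator U"
  shows "((\<lambda>t. U t x) has_vector_derivative U t x') (at t)"
  using group_generator_invariant[OF assms, of t] unitary_groupD(5)[of _ t x]
  unfolding has_vector_derivative_iff_difference_quotient group_generator_def
  by (simp add: add.commute)

lemma group_generator_skew:
  assumes x: "(x, x') \<in> group_generator U" and y: "(y, y') \<in> group_generator U"
  shows "rinner x' y = - rinner x y'"
proof -
  have "((\<lambda>t. rinner (U t x) (U t y)) has_vector_derivative rinner (U 0 x) (U 0 y') + rinner (U 0 x') (U 0 y)) (at 0)"
    by (rule bounded_bilinear.has_vector_derivative[OF bounded_bilinear_rinner group_generator_deriv[OF x] group_generator_deriv[OF y]])
  then have "((\<lambda>t::real. rinner x y) has_vector_derivative rinner x y' + rinner x' y) (at 0)"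
    by (simp add: unitary_group_rinner)
  then show ?thesis
    using vector_derivative_unique_at[OF _ has_vector_derivative_const] by fastforce
qed

lemma group_generator_linear: "linear_operator (group_generator U)"
proof -
  have "single_valued (group_generator U)"
    unfolding single_valued_def group_generator_def using tendsto_unique[OF at_neq_bot] by blast
  moreover have "(0, 0) \<in> group_generator U"
    using unitary_groupD(7)[of _ 0 0] by (simp add: group_generator_def)
  moreover have "(x + y, x' + y') \<in> group_generator U"
    if "(x, x') \<in> group_generator U" "(y, y') \<in> group_generator U" for x x' y y'
    using tendsto_add[of "\<lambda>h. (U h x - x) /\<^sub>R h" x' "at 0" "\<lambda>h. (U h y - y) /\<^sub>R h" y'] that
    by (simp add: group_generator_def unitary_groupD(1) scaleR_add_right[symmetric] add_diff_add)
  moreover have "(c *\<^sub>C x, c *\<^sub>C x') \<in> group_generator U"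
    if "(x, x') \<in> group_generator U" for x x' c
    using bounded_linear.tendsto[OF bounded_linear_scaleC, of "\<lambda>h. (U h x - x) /\<^sub>R h" x' "at 0" c] that
    by (simp add: group_generator_def unitary_groupD(2) scaleC_diff_right scaleC_scaleR)
  ultimately show ?thesis unfolding linear_operator_def by blast
qed

end

text \<open>For initial values in the domain the difference of the two evolutions stays in the domain of the
common generator, which is skew-symmetric, and so its norm is constant.\<close>

lemma unitary_group_unique:
  fixes U V :: "real \<Rightarrow> 'h::chilbert_space \<Rightarrow> 'h"
  assumes U: "unitary_group U" and V: "unitary_group V"
    and gen: "group_generator U = T" "group_generator V = T" and D: "closure (Domain T) = UNIV"
  shows "U = V"
proof -
  have eq: "U t x = V t x" if x: "(x, x') \<in> T" for t x x'
  proof -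
    have "((\<lambda>t. U t x - V t x) has_vector_derivative U t x' - V t x') (at t)" for t
      using x gen by (intro has_vector_derivative_diff group_generator_deriv[OF U] group_generator_deriv[OF V]) auto
    moreover have "rinner (U t x - V t x) (U t x' - V t x') = 0" for t
    proof -
      have "(U t x - V t x, U t x' - V t x') \<in> T"
        using group_generator_invariant[OF U, of x x' t] group_generator_invariant[OF V, of x x' t] x gen
          linear_operatorD(7)[OF group_generator_linear[OF U]] by simp
      then show ?thesis
        using group_generator_skew[OF U, of "U t x - V t x" "U t x' - V t x'" "U t x - V t x" "U t x' - V t x'"] gen
        by (simp add: rinner_commute)
    qed
    ultimately have "norm (U t x - V t x) = norm (U 0 x - V 0 x)"
      by (rule skew_evolution_norm)
    then show ?thesis by (simp add: unitary_groupD(4)[OF U] unitary_groupD(4)[OF V])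
  qed
  show ?thesis
  proof (intro ext)
    fix t x
    have "x \<in> closure (Domain T)" using D by simp
    then obtain f where f: "\<And>n. f n \<in> Domain T" "f \<longlonglongrightarrow> x" unfolding closure_sequential by blast
    have "(\<lambda>n. U t (f n)) \<longlonglongrightarrow> U t x" "(\<lambda>n. V t (f n)) \<longlonglongrightarrow> V t x"
      using bounded_linear.tendsto[OF unitary_groupD(8)[OF U] f(2)]
        bounded_linear.tendsto[OF unitary_groupD(8)[OF V] f(2)] by auto
    moreover have "U t (f n) = V t (f n)" for n using eq f(1) by blast
    ultimately show "U t x = V t x" using LIMSEQ_unique by fastforce
  qed
qed

section \<open>Stone's theorem\<close>

context
  fixes T :: "'h::chilbert_space operator"
  assumes T: "skew_adjoint T"
begin

text \<open>With \<open>r = 1 / (n + 1)\<close> this is the bounded operator \<open>T (1 - r\<^sup>2 T\<^sup>2)\<close> with the second factor inverted.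
Written as a difference of two resolvents that are adjoint to each other it is visibly
skew-symmetric, so its flow is isometric for positive and negative times.\<close>

definition yosida :: "nat \<Rightarrow> 'h \<Rightarrow> 'h"
  where "yosida n x = (real (Suc n) / 2) *\<^sub>R (resolvent T (1 / Suc n) x - resolvent T (- (1 / Suc n)) x)"

lemma yosida_bounded_linear: "bounded_linear (yosida n)"
  unfolding yosida_def
  by (intro bounded_linear_compose[OF bounded_linear_scaleR_right] bounded_linear_sub resolvent_bounded_linear[OF T]) auto

lemma yosida_skew: "rinner (yosida n x) y = - rinner x (yosida n y)"
  using resolvent_adjoint[OF T, of "1 / Suc n" x y] resolvent_adjoint[OF T, of "- (1 / Suc n)" x y]
  by (simp add: yosida_def rinner_simps algebra_simps)

lemma yosida_commute: "yosida n (yosida m x) = yosida m (yosida n x)"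
proof -
  have R: "linear (resolvent T (1 / Suc k))" "linear (resolvent T (- (1 / Suc k)))" for k
    by (intro bounded_linear.linear resolvent_bounded_linear[OF T]; simp)+
  have c: "resolvent T r (resolvent T s x) = resolvent T s (resolvent T r x)"
    if "r \<noteq> 0" "s \<noteq> 0" for r s using resolvent_resolvent[OF T that] .
  show ?thesis
    unfolding yosida_def linear_scale[OF R(1)] linear_scale[OF R(2)] linear_diff[OF R(1)] linear_diff[OF R(2)]
    using c[of "1 / Suc n" "1 / Suc m"] c[of "1 / Suc n" "- (1 / Suc m)"]
      c[of "- (1 / Suc n)" "1 / Suc m"] c[of "- (1 / Suc n)" "- (1 / Suc m)"]
    by (simp add: algebra_simps)
qed

lemma yosida_tendsto:
  assumes x: "(x, x') \<in> T"
  shows "(\<lambda>n. yosida n x) \<longlonglongrightarrow> x'"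
proof -
  have a: "resolvent T r x - x = r *\<^sub>R resolvent T r x'" if r: "r \<noteq> 0" for r
  proof -
    have "(1/r) *\<^sub>R (resolvent T r x - x) = resolvent T r x'"
      using linear_operatorD(1)[OF skew_adjointD(1)[OF T] resolvent_in[OF T r, of x] resolvent_commutes[OF T r x]] .
    then show ?thesis using r by (metis scaleR_scaleR right_inverse scaleR_one inverse_eq_divide)
  qed
  have "yosida n x = (1/2) *\<^sub>R resolvent T (1 / Suc n) x' + (1/2) *\<^sub>R resolvent T (- (1 / Suc n)) x'" for n
  proof -
    let ?r = "1 / real (Suc n)"
    have "resolvent T ?r x - resolvent T (- ?r) x = ?r *\<^sub>R resolvent T ?r x' + ?r *\<^sub>R resolvent T (- ?r) x'"
      using a[of ?r] a[of "- ?r"] by (simp add: algebra_simps)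
    then have "yosida n x = (real (Suc n) / 2) *\<^sub>R (?r *\<^sub>R resolvent T ?r x' + ?r *\<^sub>R resolvent T (- ?r) x')"
      unfolding yosida_def by simp
    moreover have "real (Suc n) / 2 * ?r = 1 / 2" by simp
    ultimately show ?thesis by (simp only: scaleR_add_right scaleR_scaleR)
  qed
  moreover have "(\<lambda>n. (1/2) *\<^sub>R resolvent T (1 / Suc n) x' + (1/2) *\<^sub>R resolvent T (- (1 / Suc n)) x') \<longlonglongrightarrow> (1/2) *\<^sub>R x' + (1/2) *\<^sub>R x'"
  proof -
    have "(\<lambda>n. 1 / real (Suc n)) \<longlonglongrightarrow> 0"
      using LIMSEQ_inverse_real_of_nat by (simp add: inverse_eq_divide)
    then show ?thesis
      using tendsto_minus[of "\<lambda>n. 1 / real (Suc n)" 0 sequentially]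
      by (intro tendsto_add tendsto_scaleR[OF tendsto_const] resolvent_tendsto_id[OF T]) auto
  qed
  ultimately show ?thesis by (simp add: scaleR_add_left[symmetric])
qed

definition approx_flow :: "nat \<Rightarrow> real \<Rightarrow> 'h \<Rightarrow> 'h"
  where "approx_flow n = exp_flow (yosida n)"

lemmas approx_flow_0 = exp_flow_0[OF yosida_bounded_linear yosida_skew, folded approx_flow_def]
lemmas approx_flow_deriv = exp_flow_deriv[OF yosida_bounded_linear yosida_skew, folded approx_flow_def]
lemmas approx_flow_norm = exp_flow_norm[OF yosida_bounded_linear yosida_skew, folded approx_flow_def]
lemmas approx_flow_group = exp_flow_group[OF yosida_bounded_linear yosida_skew, folded approx_flow_def]
lemmas approx_flow_linear = exp_flow_bounded_linear[OF yosida_bounded_linear yosida_skew, folded approx_flow_def]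

lemma approx_flow_yosida: "approx_flow n t (yosida m x) = yosida m (approx_flow n t x)"
  unfolding approx_flow_def
  by (rule exp_flow_commutes[where C = "yosida n" and P = "yosida m", symmetric])
    (rule yosida_bounded_linear yosida_skew yosida_commute)+

lemma approx_flow_diff: "approx_flow n t (x - y) = approx_flow n t x - approx_flow n t y"
  using approx_flow_linear by (simp add: bounded_linear.linear linear_diff)

lemma yosida_scaleC: "yosida n (c *\<^sub>C x) = c *\<^sub>C yosida n x"
proof -
  have "resolvent T r (c *\<^sub>C x) = c *\<^sub>C resolvent T r x" if r: "r \<noteq> 0" for r
  proof -
    obtain x' where x: "(resolvent T r x, x') \<in> T" "resolvent T r x - r *\<^sub>R x' = x"
      using resolvent_ex[OF T r] by blast
    have "c *\<^sub>C resolvent T r x - r *\<^sub>R (c *\<^sub>C x') = c *\<^sub>C x"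
      using arg_cong[OF x(2), of "(*\<^sub>C) c"] by (simp add: scaleC_diff_right scaleC_scaleR)
    then show ?thesis
      using resolvent_eq[OF T linear_operatorD(4)[OF skew_adjointD(1)[OF T] x(1)], of r c] by simp
  qed
  then show ?thesis
    by (simp add: yosida_def scaleC_diff_right[symmetric] scaleC_scaleR)
qed

lemma approx_flow_scaleC: "approx_flow n t (c *\<^sub>C x) = c *\<^sub>C approx_flow n t x"
  unfolding approx_flow_def
  by (rule exp_flow_commutes[where C = "yosida n" and P = "\<lambda>x. c *\<^sub>C x", symmetric])
    (rule yosida_bounded_linear yosida_skew bounded_linear_scaleC yosida_scaleC[symmetric])+

text \<open>The difference \<open>d\<close> of the two flows solves an equation with the skew-symmetric generator \<open>yosida n\<close>,
which does not change the norm, and the forcing term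
\<open>approx_flow m t (yosida n x - yosida m x)\<close>. The crude bound \<open>norm d \<le> 2 norm x\<close> then suffices,
since a bound on the square of the norm is enough for the Cauchy property.\<close>

lemma approx_flow_difference:
  "(norm (approx_flow n t x - approx_flow m t x))\<^sup>2 \<le> 4 * norm x * norm (yosida n x - yosida m x) * \<bar>t\<bar>"
proof -
  define d where "d t = approx_flow n t x - approx_flow m t x" for t
  define d' where "d' t = 2 * rinner (d t) (yosida n (approx_flow n t x) - yosida m (approx_flow m t x))" for t
  have "((\<lambda>t. (norm (d t))\<^sup>2) has_real_derivative d' t) (at t)" for t
    unfolding d_def d'_def
    by (intro norm_sq_has_real_derivative has_vector_derivative_diff approx_flow_deriv)
  moreover have "\<bar>d' t\<bar> \<le> 4 * norm x * norm (yosida n x - yosida m x)" for t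
  proof -
    let ?b = "approx_flow m t x"
    have "yosida n (approx_flow n t x) - yosida m ?b = yosida n (d t) + approx_flow m t (yosida n x - yosida m x)"
      using yosida_bounded_linear[of n] by (simp add: d_def approx_flow_diff approx_flow_yosida bounded_linear.linear linear_diff)
    then have "d' t = 2 * rinner (d t) (approx_flow m t (yosida n x - yosida m x))"
      using yosida_skew[of n "d t" "d t"] by (simp add: d'_def rinner_simps rinner_commute)
    moreover have "norm (d t) \<le> 2 * norm x"
      using norm_triangle_ineq4[of "approx_flow n t x" ?b] by (simp add: d_def approx_flow_norm)
    then have "norm (d t) * norm (yosida n x - yosida m x) \<le> (2 * norm x) * norm (yosida n x - yosida m x)"
      by (intro mult_right_mono) auto
    ultimately show ?thesis
      using rinner_Cauchy_Schwarz[of "d t" "approx_flow m t (yosida n x - yosida m x)"]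
      by (simp add: approx_flow_norm abs_mult)
  qed
  ultimately have "norm ((norm (d t))\<^sup>2 - (norm (d 0))\<^sup>2) \<le> 4 * norm x * norm (yosida n x - yosida m x) * norm (t - 0)"
    by (intro field_differentiable_bound[where f' = d' and S = UNIV]) auto
  moreover have "d 0 = 0" by (simp add: d_def approx_flow_0)
  ultimately show ?thesis by (simp add: d_def)
qed

definition stone_group :: "real \<Rightarrow> 'h \<Rightarrow> 'h"
  where "stone_group t x = lim (\<lambda>n. approx_flow n t x)"

lemma approx_flow_uniform_limit:
  "uniform_limit {-R..R} (\<lambda>n t. approx_flow n t x) (\<lambda>t. stone_group t x) sequentially"
proof -
  have "uniformly_Cauchy_on {-R..R} (\<lambda>n t. approx_flow n t x)"
    unfolding uniformly_Cauchy_on_def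
  proof (intro allI impI)
    fix e :: real assume e: "e > 0"
    have "x \<in> closure (Domain T)" using skew_adjointD(2)[OF T] by simp
    then obtain y y' where y: "(y, y') \<in> T" "norm (x - y) < e / 3"
      unfolding closure_approachable using e by (metis Domain.cases dist_commute dist_norm divide_pos_pos zero_less_numeral)
    have "Cauchy (\<lambda>n. yosida n y)" using yosida_tendsto[OF y(1)] by (rule LIMSEQ_imp_Cauchy)
    moreover define c where "c = (e / 3)\<^sup>2 / (4 * norm y * \<bar>R\<bar> + 1)"
    moreover have "c > 0" unfolding c_def using e by (intro divide_pos_pos) (auto intro: add_nonneg_pos)
    ultimately obtain N where N: "\<And>m n. m \<ge> N \<Longrightarrow> n \<ge> N \<Longrightarrow> norm (yosida m y - yosida n y) < c"
      unfolding Cauchy_def dist_norm by metis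
    have "dist (approx_flow m t x) (approx_flow n t x) < e" if t: "t \<in> {-R..R}" and mn: "m \<ge> N" "n \<ge> N" for t m n
    proof -
      have "(norm (approx_flow m t y - approx_flow n t y))\<^sup>2 \<le> 4 * norm y * norm (yosida m y - yosida n y) * \<bar>t\<bar>"
        by (rule approx_flow_difference)
      also have "\<dots> \<le> 4 * norm y * c * \<bar>R\<bar>"
        using N[OF mn] t by (intro mult_mono) (auto simp: \<open>c > 0\<close> less_imp_le)
      also have "\<dots> < (4 * norm y * \<bar>R\<bar> + 1) * c" using \<open>c > 0\<close> by (simp add: algebra_simps)
      also have "\<dots> = (e / 3)\<^sup>2" unfolding c_def
        using add_nonneg_pos[of "4 * norm y * \<bar>R\<bar>" 1] by simp
      finally have "norm (approx_flow m t y - approx_flow n t y) < e / 3"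
        by (rule power_less_imp_less_base) (use e in simp)
      moreover have "approx_flow m t x - approx_flow n t x =
          approx_flow m t (x - y) + (approx_flow m t y - approx_flow n t y) - approx_flow n t (x - y)"
        by (simp add: approx_flow_diff)
      ultimately show ?thesis
        using y(2) norm_triangle_ineq4[of "approx_flow m t (x - y) + (approx_flow m t y - approx_flow n t y)" "approx_flow n t (x - y)"]
          norm_triangle_ineq[of "approx_flow m t (x - y)" "approx_flow m t y - approx_flow n t y"]
        unfolding dist_norm approx_flow_norm by simp
    qed
    then show "\<exists>M. \<forall>t\<in>{-R..R}. \<forall>m\<ge>M. \<forall>n\<ge>M. dist (approx_flow m t x) (approx_flow n t x) < e" by blast
  qed
  then have "uniformly_convergent_on {-R..R} (\<lambda>n t. approx_flow n t x)"
    by (rule Cauchy_uniformly_convergent)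
  then show ?thesis
    unfolding uniformly_convergent_uniform_limit_iff stone_group_def .
qed

lemma approx_flow_tendsto: "(\<lambda>n. approx_flow n t x) \<longlonglongrightarrow> stone_group t x"
  by (rule tendsto_uniform_limitI[OF approx_flow_uniform_limit[where R = "\<bar>t\<bar>"]]) (auto simp: abs_if)

lemma stone_group_norm: "norm (stone_group t x) = norm x"
  using tendsto_norm[OF approx_flow_tendsto[of t x]] by (simp add: approx_flow_norm LIMSEQ_const_iff)

lemma stone_group_unitary: "unitary_group stone_group"
  unfolding unitary_group_def
proof (intro conjI allI)
  fix t x y
  have "approx_flow n t (x + y) = approx_flow n t x + approx_flow n t y" for n
    using approx_flow_linear by (simp add: bounded_linear.linear linear_add)
  then show "stone_group t (x + y) = stone_group t x + stone_group t y"
    using tendsto_add[OF approx_flow_tendsto[of t x] approx_flow_tendsto[of t y]] approx_flow_tendsto[of t "x + y"]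
    by (simp add: LIMSEQ_unique)
next
  fix t c x
  show "stone_group t (c *\<^sub>C x) = c *\<^sub>C stone_group t x"
    using bounded_linear.tendsto[OF bounded_linear_scaleC approx_flow_tendsto[of t x]] approx_flow_tendsto[of t "c *\<^sub>C x"]
    by (simp add: approx_flow_scaleC LIMSEQ_unique)
next
  fix t x show "norm (stone_group t x) = norm x" by (rule stone_group_norm)
next
  fix x show "stone_group 0 x = x"
    using approx_flow_tendsto[of 0 x] by (simp add: approx_flow_0 LIMSEQ_const_iff)
next
  fix s t x
  have "(\<lambda>n. approx_flow n s (approx_flow n t x - stone_group t x)) \<longlonglongrightarrow> 0"
    by (rule tendsto_norm_zero_cancel) (use approx_flow_tendsto[of t x] in \<open>simp add: approx_flow_norm LIM_zero tendsto_norm_zero\<close>)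
  from tendsto_add[OF this approx_flow_tendsto[of s "stone_group t x"]]
  have "(\<lambda>n. approx_flow n (s + t) x) \<longlonglongrightarrow> stone_group s (stone_group t x)"
    by (simp add: approx_flow_diff approx_flow_group)
  then show "stone_group (s + t) x = stone_group s (stone_group t x)"
    using approx_flow_tendsto LIMSEQ_unique by blast
next
  fix x
  have "isCont (\<lambda>t. stone_group t x) t" for t
  proof -
    have "continuous_on {-(\<bar>t\<bar>+1)..\<bar>t\<bar>+1} (\<lambda>t. stone_group t x)"
    proof (rule uniform_limit_theorem[OF _ approx_flow_uniform_limit])
      show "\<forall>\<^sub>F n in sequentially. continuous_on {- (\<bar>t\<bar> + 1)..\<bar>t\<bar> + 1} (\<lambda>t. approx_flow n t x)"
        using approx_flow_deriv has_vector_derivative_continuous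
        by (intro always_eventually allI continuous_at_imp_continuous_on ballI) blast
    qed simp
    then show ?thesis by (rule continuous_on_interior) (auto simp: abs_if)
  qed
  then show "continuous_on UNIV (\<lambda>t. stone_group t x)" by (simp add: continuous_at_imp_continuous_on)
qed

lemma stone_group_deriv:
  assumes x: "(x, x') \<in> T"
  shows "((\<lambda>t. stone_group t x) has_vector_derivative stone_group t x') (at t)"
proof (rule has_vector_derivative_uniform_limit[OF _ _ approx_flow_tendsto])
  show "((\<lambda>s. approx_flow n s x) has_vector_derivative approx_flow n s (yosida n x)) (at s)" for n s
    unfolding approx_flow_yosida by (rule approx_flow_deriv)
  fix R
  have "uniform_limit {-R<..<R} (\<lambda>n s. approx_flow n s (yosida n x - x')) (\<lambda>s. 0) sequentially"
    unfolding uniform_limit_iff dist_norm diff_zero approx_flow_norm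
    using tendstoD[OF yosida_tendsto[OF x]] by (auto simp: dist_norm elim: eventually_mono)
  moreover have "uniform_limit {-R<..<R} (\<lambda>n s. approx_flow n s x') (\<lambda>s. stone_group s x') sequentially"
    by (rule uniform_limit_on_subset[OF approx_flow_uniform_limit[where R = R]]) auto
  ultimately have "uniform_limit {-R<..<R} (\<lambda>n s. approx_flow n s (yosida n x - x') + approx_flow n s x')
      (\<lambda>s. 0 + stone_group s x') sequentially" by (rule uniform_limit_add)
  then show "uniform_limit {-R<..<R} (\<lambda>n s. approx_flow n s (yosida n x)) (\<lambda>s. stone_group s x') sequentially"
    by (simp add: approx_flow_diff)
qed

text \<open>The generator extends \<open>T\<close> and is skew-symmetric, so it cannot be larger than the maximal \<open>T\<close>.\<close>

lemma stone_group_generator: "group_generator stone_group = T"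
proof (intro set_eqI iffI; clarify)
  fix x x' assume x: "(x, x') \<in> T"
  then show "(x, x') \<in> group_generator stone_group"
    using stone_group_deriv[OF x, of 0] unitary_groupD(4)[OF stone_group_unitary]
    unfolding has_vector_derivative_iff_difference_quotient group_generator_def by simp
next
  fix x x' assume x: "(x, x') \<in> group_generator stone_group"
  show "(x, x') \<in> T"
  proof (rule skew_adjointD(4)[OF T])
    fix y y' assume y: "(y, y') \<in> T"
    then have "(y, y') \<in> group_generator stone_group"
      using stone_group_deriv[OF y, of 0] unitary_groupD(4)[OF stone_group_unitary]
      unfolding has_vector_derivative_iff_difference_quotient group_generator_def by simp
    then show "rinner x y' = - rinner x' y"
      using group_generator_skew[OF stone_group_unitary x] by simp
  qed
qed

end

theorem Stone:
  fixes T :: "'h::chilbert_space operator"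
  assumes T: "skew_adjoint T"
  shows "unitary_group (\<lambda>t. op_exp t T)" "group_generator (\<lambda>t. op_exp t T) = T"
proof -
  have "(THE U. unitary_group U \<and> group_generator U = T) = stone_group T"
    using stone_group_unitary[OF T] stone_group_generator[OF T] unitary_group_unique[OF _ _ _ _ skew_adjointD(2)[OF T]]
    by (intro the_equality) blast+
  then have "(\<lambda>t. op_exp t T) = stone_group T" unfolding op_exp_def by simp
  then show "unitary_group (\<lambda>t. op_exp t T)" "group_generator (\<lambda>t. op_exp t T) = T"
    using stone_group_unitary[OF T] stone_group_generator[OF T] by simp_all
qed

section \<open>Relatively bounded perturbations\<close>

locale kato_rellich =
  fixes A B :: "'h::chilbert_space operator" and a b :: real
  assumes A: "skew_adjoint A" and B: "linear_operator B"
    and B_skew: "\<And>x x' y y'. (x, x') \<in> B \<Longrightarrow> (y, y') \<in> B \<Longrightarrow> rinner x' y = - rinner x y'"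
    and dom: "Domain A \<subseteq> Domain B"
    and a_pos: "a > 0" and b_nonneg: "b \<ge> 0"
    and rel_bound: "\<And>x x' x''. (x, x') \<in> A \<Longrightarrow> (x, x'') \<in> B \<Longrightarrow> norm x'' \<le> a * norm x' + b * norm x"
begin

definition perturbed :: "real \<Rightarrow> 'h operator"
  where "perturbed v = op_add A (op_scale (complex_of_real v) B)"

lemma perturbed_iff: "(x, y) \<in> perturbed v \<longleftrightarrow> (\<exists>x' x''. (x, x') \<in> A \<and> (x, x'') \<in> B \<and> y = x' + v *\<^sub>R x'')"
  unfolding perturbed_def op_add_def op_scale_def by (auto simp: scaleR_scaleC)

lemma perturbed_linear: "linear_operator (perturbed v)"
  unfolding perturbed_def by (intro linear_op_add linear_op_scale B skew_adjointD(1)[OF A])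

lemma Domain_perturbed: "Domain (perturbed v) = Domain A"
  using dom by (auto simp: perturbed_iff Domain_iff) blast

lemma perturbed_0: "perturbed 0 = A"
proof (intro set_eqI iffI; clarify)
  fix x y assume "(x, y) \<in> perturbed 0" then show "(x, y) \<in> A" by (auto simp: perturbed_iff)
next
  fix x y assume "(x, y) \<in> A"
  moreover obtain z where "(x, z) \<in> B" using dom \<open>(x, y) \<in> A\<close> by blast
  ultimately show "(x, y) \<in> perturbed 0" by (auto simp: perturbed_iff)
qed

lemma perturbed_skew:
  assumes "(x, x') \<in> perturbed v" "(y, y') \<in> perturbed v"
  shows "rinner x' y = - rinner x y'"
proof -
  obtain p q where x: "(x, p) \<in> A" "(x, q) \<in> B" "x' = p + v *\<^sub>R q" using assms(1) perturbed_iff by blast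
  obtain r s where y: "(y, r) \<in> A" "(y, s) \<in> B" "y' = r + v *\<^sub>R s" using assms(2) perturbed_iff by blast
  show ?thesis using skew_adjointD(3)[OF A x(1) y(1)] B_skew[OF x(2) y(2)] x(3) y(3)
    by (simp add: rinner_simps)
qed

text \<open>With the solution operator \<open>G\<close> of \<open>A - l\<close> the equation for \<open>x = G g\<close> reads \<open>g + v B G g = w\<close>. By
\<open>skew_adjoint_norm_shift\<close> the operator \<open>B G\<close> has norm at most \<open>a + b / \<bar>l\<bar>\<close>, so that Banach's fixed
point theorem applies.\<close>

lemma perturbed_surj:
  assumes v: "\<bar>v\<bar> * a < 1" and l: "l \<noteq> 0" "\<bar>v\<bar> * (a + b / \<bar>l\<bar>) < 1"
  shows "\<exists>x x'. (x, x') \<in> perturbed v \<and> x' - l *\<^sub>R x = w"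
proof -
  have "\<exists>x x' x''. (x, x') \<in> A \<and> (x, x'') \<in> B \<and> x' - l *\<^sub>R x = g" for g
    using skew_adjoint_real_resolvent[OF A l(1), of g] dom by blast
  then obtain X X' X'' where X: "\<And>g. (X g, X' g) \<in> A" "\<And>g. (X g, X'' g) \<in> B" "\<And>g. X' g - l *\<^sub>R X g = g"
    by metis
  have lip: "norm (X'' g - X'' h) \<le> (a + b / \<bar>l\<bar>) * norm (g - h)" for g h
  proof -
    have dA: "(X g - X h, X' g - X' h) \<in> A" using linear_operatorD(7)[OF skew_adjointD(1)[OF A] X(1) X(1)] .
    have dB: "(X g - X h, X'' g - X'' h) \<in> B" using linear_operatorD(7)[OF B X(2) X(2)] .
    have "(X' g - X' h) - l *\<^sub>R (X g - X h) = g - h"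
      using X(3)[of g] X(3)[of h] by (simp add: algebra_simps)
    then have n: "(norm (g - h))\<^sup>2 = (norm (X' g - X' h))\<^sup>2 + l\<^sup>2 * (norm (X g - X h))\<^sup>2"
      using skew_adjoint_norm_shift[OF A dA, of l] by simp
    have 1: "norm (X' g - X' h) \<le> norm (g - h)"
      by (rule power2_le_imp_le) (simp_all add: n)
    have "\<bar>l\<bar> * norm (X g - X h) \<le> norm (g - h)"
      by (rule power2_le_imp_le) (simp_all add: n power_mult_distrib)
    then have 2: "norm (X g - X h) \<le> norm (g - h) / \<bar>l\<bar>" using l(1) by (simp add: field_simps)
    have "norm (X'' g - X'' h) \<le> a * norm (X' g - X' h) + b * norm (X g - X h)" by (rule rel_bound[OF dA dB])
    also have "\<dots> \<le> a * norm (g - h) + b * (norm (g - h) / \<bar>l\<bar>)"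
      using 1 2 a_pos b_nonneg by (intro add_mono mult_left_mono) auto
    finally show ?thesis by (simp add: algebra_simps)
  qed
  have "\<exists>!g. w - v *\<^sub>R X'' g = g"
  proof (rule banach_fix_type)
    show "0 \<le> \<bar>v\<bar> * (a + b / \<bar>l\<bar>)" using a_pos b_nonneg by simp
    show "\<forall>x y. dist (w - v *\<^sub>R X'' x) (w - v *\<^sub>R X'' y) \<le> \<bar>v\<bar> * (a + b / \<bar>l\<bar>) * dist x y"
    proof (intro allI)
      fix x y
      have "dist (w - v *\<^sub>R X'' x) (w - v *\<^sub>R X'' y) = \<bar>v\<bar> * norm (X'' x - X'' y)"
        by (simp add: dist_norm scaleR_diff_right[symmetric] norm_minus_commute)
      also have "\<dots> \<le> \<bar>v\<bar> * ((a + b / \<bar>l\<bar>) * norm (x - y))" by (intro mult_left_mono lip) simp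
      finally show "dist (w - v *\<^sub>R X'' x) (w - v *\<^sub>R X'' y) \<le> \<bar>v\<bar> * (a + b / \<bar>l\<bar>) * dist x y"
        by (simp add: dist_norm mult.assoc)
    qed
  qed (rule l(2))
  then obtain g where g: "w - v *\<^sub>R X'' g = g" by blast
  have "(X g, X' g + v *\<^sub>R X'' g) \<in> perturbed v" using X perturbed_iff by blast
  moreover have "X' g + v *\<^sub>R X'' g - l *\<^sub>R X g = w" using X(3)[of g] g by (simp add: algebra_simps)
  ultimately show ?thesis by blast
qed

text \<open>The Kato-Rellich theorem: for large \<open>l\<close> the constant \<open>\<bar>v\<bar> (a + b / l)\<close> is as close to \<open>\<bar>v\<bar> a < 1\<close> as
needed.\<close>

theorem perturbed_skew_adjoint:
  assumes v: "\<bar>v\<bar> * a < 1"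
  shows "skew_adjoint (perturbed v)"
proof -
  define l where "l = (\<bar>v\<bar> * b + 1) / (1 - \<bar>v\<bar> * a)"
  have lpos: "l > 0" unfolding l_def using v b_nonneg by (intro divide_pos_pos) (auto intro: add_nonneg_pos)
  have "\<bar>v\<bar> * b < l * (1 - \<bar>v\<bar> * a)" unfolding l_def using v by simp
  then have "\<bar>v\<bar> * (a + b / l) < 1" using lpos by (simp add: field_simps)
  then have "\<exists>x x'. (x, x') \<in> perturbed v \<and> x' - l *\<^sub>R x = w"
    "\<exists>x x'. (x, x') \<in> perturbed v \<and> x' + l *\<^sub>R x = w" for w
    using perturbed_surj[OF v, of l w] perturbed_surj[OF v, of "- l" w] lpos by auto
  moreover have "closure (Domain (perturbed v)) = UNIV"
    using skew_adjointD(2)[OF A] Domain_perturbed by simp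
  ultimately show ?thesis
    using skew_adjoint_criterion[OF perturbed_linear, of v l] perturbed_skew[where v = v] by blast
qed

definition evolution :: "real \<Rightarrow> real \<Rightarrow> 'h \<Rightarrow> 'h"
  where "evolution v \<tau> = op_exp \<tau> (perturbed v)"

lemma evolution_unitary: "\<bar>v\<bar> * a < 1 \<Longrightarrow> unitary_group (evolution v)"
  using Stone(1)[OF perturbed_skew_adjoint] by (simp add: evolution_def[abs_def])

lemma evolution_generator: "\<bar>v\<bar> * a < 1 \<Longrightarrow> group_generator (evolution v) = perturbed v"
  using Stone(2)[OF perturbed_skew_adjoint] by (simp add: evolution_def[abs_def])

lemma evolution_invariant: "\<bar>v\<bar> * a < 1 \<Longrightarrow> (x, x') \<in> perturbed v \<Longrightarrow> (evolution v t x, evolution v t x') \<in> perturbed v"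
  using group_generator_invariant[OF evolution_unitary] evolution_generator by blast

lemma evolution_deriv: "\<bar>v\<bar> * a < 1 \<Longrightarrow> (x, x') \<in> perturbed v \<Longrightarrow>
    ((\<lambda>t. evolution v t x) has_vector_derivative evolution v t x') (at t)"
  using group_generator_deriv[OF evolution_unitary] evolution_generator by blast

definition evolve :: "(real \<times> real) list \<Rightarrow> 'h \<Rightarrow> 'h"
  where "evolve vs = fold (\<lambda>(v, \<tau>). evolution v \<tau>) vs"

lemma evolve_simps [simp]: "evolve [] x = x" "evolve ((v, \<tau>) # vs) x = evolve vs (evolution v \<tau> x)"
  "evolve (vs @ ws) x = evolve ws (evolve vs x)"
  by (simp_all add: evolve_def)

end

section \<open>Evolution under a piecewise constant control\<close>

lemma takes_values_le: "takes_values u s vs t \<Longrightarrow> s \<le> t"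
  by (induction u s vs t rule: takes_values.induct) auto

lemma takes_values_ConsD:
  assumes "takes_values u s ((v, \<tau>) # vs) t"
  shows "0 \<le> \<tau>" "v \<in> range u" "\<And>r. s < r \<Longrightarrow> r < s + \<tau> \<Longrightarrow> u r = v" "takes_values u (s + \<tau>) vs t"
proof -
  have *: "0 \<le> \<tau> \<and> v \<in> range u \<and> (\<forall>r. s < r \<and> r < s + \<tau> \<longrightarrow> u r = v) \<and> takes_values u (s + \<tau>) vs t"
    using assms unfolding takes_values.simps .
  show "0 \<le> \<tau>" by (rule conjunct1[OF *])
  show "v \<in> range u" by (rule conjunct1[OF conjunct2[OF *]])
  show "u r = v" if "s < r" "r < s + \<tau>" for r
    using conjunct1[OF conjunct2[OF conjunct2[OF *]]] that by simp
  show "takes_values u (s + \<tau>) vs t"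
    by (rule conjunct2[OF conjunct2[OF conjunct2[OF *]]])
qed

lemma takes_values_append:
  "takes_values u s vs r \<Longrightarrow> takes_values u r ws t \<Longrightarrow> takes_values u s (vs @ ws) t"
proof (induction vs arbitrary: s)
  case (Cons p vs)
  obtain v \<tau> where p: "p = (v, \<tau>)" by (cases p)
  note tv = takes_values_ConsD[OF Cons.prems(1)[unfolded p]]
  have "takes_values u (s + \<tau>) (vs @ ws) t" by (rule Cons.IH[OF tv(4) Cons.prems(2)])
  then show ?case unfolding p append_Cons takes_values.simps by (intro conjI allI impI tv(1,2)) (simp_all add: tv(3))
qed simp

lemma takes_values_ex:
  assumes F: "finite F" "\<And>s t. s \<le> t \<Longrightarrow> {s..t} \<inter> F = {} \<Longrightarrow> u s = u t" and st: "s \<le> t"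
  shows "\<exists>vs. takes_values u s vs t"
  using st
proof (induction "card (F \<inter> {s<..<t})" arbitrary: s t rule: less_induct)
  case less
  show ?case
  proof (cases "F \<inter> {s<..<t} = {}")
    case True
    have "u r = u ((s + t) / 2)" if r: "s < r" "r < t" for r
    proof (cases "r \<le> (s + t) / 2")
      case r2: True
      have "{r..(s + t) / 2} \<subseteq> {s<..<t}" using r by auto
      then show ?thesis using F(2)[OF r2] True by blast
    next
      case False
      have "{(s + t) / 2..r} \<subseteq> {s<..<t}" using r by auto
      then have "u ((s + t) / 2) = u r" using F(2)[of "(s + t) / 2" r] False True by force
      then show ?thesis by (rule sym)
    qed
    moreover have "0 \<le> t - s" and e: "s + (t - s) = t" using less.prems by simp_all
    ultimately have "\<forall>r. s < r \<and> r < s + (t - s) \<longrightarrow> u r = u ((s + t) / 2)" unfolding e by blast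
    with \<open>0 \<le> t - s\<close> e
    have "takes_values u s [(u ((s + t) / 2), t - s)] t" unfolding takes_values.simps by blast
    then show ?thesis by blast
  next
    case False
    then obtain f where f: "f \<in> F" "s < f" "f < t" by auto
    have "card (F \<inter> {s<..<f}) < card (F \<inter> {s<..<t})" "card (F \<inter> {f<..<t}) < card (F \<inter> {s<..<t})"
      using f F(1) by (auto intro!: psubset_card_mono)
    then obtain vs ws where "takes_values u s vs f" "takes_values u f ws t"
      using less.hyps f by (meson less_imp_le)
    then show ?thesis using takes_values_append by blast
  qed
qed

context kato_rellich
begin

lemma evolve_no_time:
  assumes "\<And>r. \<bar>u r\<bar> * a < 1" and "takes_values u s vs s"
  shows "evolve vs x = x"
  using assms(2)
proof (induction vs arbitrary: x)
  case (Cons p vs)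
  obtain v \<tau> where p: "p = (v, \<tau>)" by (cases p)
  have tv: "0 \<le> \<tau>" "v \<in> range u" "takes_values u (s + \<tau>) vs s" using takes_values_ConsD[OF Cons.prems[unfolded p]] by blast+
  have "\<tau> = 0" using takes_values_le[OF tv(3)] tv(1) by simp
  moreover have "evolution v 0 x = x"
    using unitary_groupD(4)[OF evolution_unitary] tv(2) assms(1) by blast
  ultimately show ?case using Cons.IH tv(3) by (simp add: p)
qed simp

text \<open>If the first intervals of both lists have positive length, they overlap, so they carry the same
value; the longer one is cut at the end of the shorter one. Intervals of length \<open>0\<close> may carry
different values but act as the identity.\<close>

lemma evolve_unique:
  assumes adm: "\<And>r. \<bar>u r\<bar> * a < 1" and "takes_values u s vs t" "takes_values u s ws t"
  shows "evolve vs x = evolve ws x"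
  using assms(2,3)
proof (induction "length vs + length ws" arbitrary: s vs ws x rule: less_induct)
  case less
  show ?case
  proof (cases vs)
    case Nil
    then show ?thesis using less.prems evolve_no_time[OF adm] by simp
  next
    case vs: (Cons p vs')
    show ?thesis
    proof (cases ws)
      case Nil
      then show ?thesis using less.prems evolve_no_time[OF adm] by simp
    next
      case ws: (Cons q ws')
      obtain v \<tau> w \<sigma> where p: "p = (v, \<tau>)" and q: "q = (w, \<sigma>)" by (cases p, cases q)
      have v: "0 \<le> \<tau>" "v \<in> range u" "\<And>r. s < r \<Longrightarrow> r < s + \<tau> \<Longrightarrow> u r = v" "takes_values u (s + \<tau>) vs' t"
        using takes_values_ConsD[OF less.prems(1)[unfolded vs p]] by blast+
      have w: "0 \<le> \<sigma>" "w \<in> range u" "\<And>r. s < r \<Longrightarrow> r < s + \<sigma> \<Longrightarrow> u r = w" "takes_values u (s + \<sigma>) ws' t"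
        using takes_values_ConsD[OF less.prems(2)[unfolded ws q]] by blast+
      have adm': "\<bar>v\<bar> * a < 1" "\<bar>w\<bar> * a < 1" using v(2) w(2) adm by auto
      note Uv = unitary_groupD[OF evolution_unitary[OF adm'(1)]]
      consider "\<tau> = 0" | "\<sigma> = 0" | "\<tau> > 0" "\<sigma> > 0" using v(1) w(1) by fastforce
      then show ?thesis
      proof cases
        case 1
        then have "evolve vs' x = evolve ws x"
          using less.hyps[of vs' ws s] v(4) less.prems(2) by (simp add: vs)
        then show ?thesis using 1 Uv(4) by (simp add: vs p)
      next
        case 2
        then have "evolve vs x = evolve ws' x"
          using less.hyps[of vs ws' s] w(4) less.prems(1) by (simp add: ws)
        then show ?thesis using 2 unitary_groupD(4)[OF evolution_unitary[OF adm'(2)]] by (simp add: ws q)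
      next
        case 3
        have "v = w" using v(3)[of "s + min \<tau> \<sigma> / 2"] w(3)[of "s + min \<tau> \<sigma> / 2"] 3 by auto
        show ?thesis
        proof (cases "\<tau> \<le> \<sigma>")
          case True
          have "takes_values u (s + \<tau>) ((w, \<sigma> - \<tau>) # ws') t" using w True v(1) by auto
          then have "evolve vs' (evolution v \<tau> x) = evolve ((w, \<sigma> - \<tau>) # ws') (evolution v \<tau> x)"
            using less.hyps[of vs' "(w, \<sigma> - \<tau>) # ws'" "s + \<tau>"] v(4) by (simp add: vs ws)
          moreover have "evolution v (\<sigma> - \<tau>) (evolution v \<tau> x) = evolution v \<sigma> x"
            using Uv(5)[of "\<sigma> - \<tau>" \<tau> x] by simp
          ultimately show ?thesis by (simp add: vs ws p q \<open>v = w\<close>)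
        next
          case False
          have "takes_values u (s + \<sigma>) ((v, \<tau> - \<sigma>) # vs') t" using v False w(1) by auto
          then have "evolve ((v, \<tau> - \<sigma>) # vs') (evolution v \<sigma> x) = evolve ws' (evolution v \<sigma> x)"
            using less.hyps[of "(v, \<tau> - \<sigma>) # vs'" ws' "s + \<sigma>"] w(4) by (simp add: vs ws)
          moreover have "evolution v (\<tau> - \<sigma>) (evolution v \<sigma> x) = evolution v \<tau> x"
            using Uv(5)[of "\<tau> - \<sigma>" \<sigma> x] by simp
          ultimately show ?thesis by (simp add: vs ws p q \<open>v = w\<close>)
        qed
      qed
    qed
  qed
qed

lemma pc_propagator_eq:
  assumes adm: "\<And>r. \<bar>u r\<bar> * a < 1" and vs: "takes_values u 0 vs t"
  shows "pc_propagator A B u t x = evolve vs x"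
proof -
  have "pc_propagator A B u t x = (THE y. \<exists>vs. takes_values u 0 vs t \<and> y = evolve vs x)"
    unfolding pc_propagator_def evolve_def evolution_def perturbed_def ..
  also have "\<dots> = evolve vs x"
    using vs evolve_unique[where u = u, OF adm] by (intro the_equality) blast+
  finally show ?thesis .
qed

end

locale pc_control = kato_rellich A B a b
  for A B :: "'h::chilbert_space operator" and a b :: real +
  fixes u :: "real \<Rightarrow> real"
  assumes adm: "\<And>r. \<bar>u r\<bar> * a < 1" and pc: "piecewise_constant u"
begin

definition trajectory :: "'h \<Rightarrow> real \<Rightarrow> 'h"
  where "trajectory x t = pc_propagator A B u t x"

lemma takes_values_exists: "s \<le> t \<Longrightarrow> \<exists>vs. takes_values u s vs t"
  using pc takes_values_ex unfolding piecewise_constant_def by metis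

lemma trajectory_0: "trajectory x 0 = x"
  unfolding trajectory_def using pc_propagator_eq[where u = u and vs = "[]" and t = 0 and x = x, OF adm] by simp

lemma trajectory_constant:
  assumes st: "0 \<le> s" "s \<le> t" and v: "v \<in> range u" "\<And>r. s < r \<Longrightarrow> r < t \<Longrightarrow> u r = v"
  shows "trajectory x t = evolution v (t - s) (trajectory x s)"
proof -
  obtain vs where vs: "takes_values u 0 vs s" using takes_values_exists st by blast
  have "takes_values u s [(v, t - s)] t" using st v by auto
  from takes_values_append[OF vs this] show ?thesis
    unfolding trajectory_def pc_propagator_eq[where u = u, OF adm vs] pc_propagator_eq[where u = u, OF adm \<open>takes_values u 0 (vs @ _) t\<close>] by simp
qed

lemma constancy_induct [consumes 1, case_names start step]:
  assumes "0 \<le> t" and "P 0"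
    and step: "\<And>s v \<tau>. 0 \<le> s \<Longrightarrow> P s \<Longrightarrow> 0 \<le> \<tau> \<Longrightarrow> v \<in> range u \<Longrightarrow>
      (\<And>r. s < r \<Longrightarrow> r < s + \<tau> \<Longrightarrow> u r = v) \<Longrightarrow> P (s + \<tau>)"
  shows "P t"
proof -
  have "P t" if "takes_values u s vs t" "0 \<le> s" "P s" for vs s
    using that
  proof (induction vs arbitrary: s)
    case (Cons p vs)
    obtain v \<tau> where p: "p = (v, \<tau>)" by (cases p)
    note tv = takes_values_ConsD[OF Cons.prems(1)[unfolded p]]
    have "P (s + \<tau>)" by (rule step[OF Cons.prems(2,3) tv(1-3)])
    then show ?case using Cons.IH[OF tv(4)] Cons.prems(2) tv(1) by simp
  qed simp
  then show ?thesis using takes_values_exists[OF assms(1)] assms(2) by blast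
qed

lemma trajectory_step:
  assumes "0 \<le> s" "0 \<le> \<tau>" "v \<in> range u" "\<And>r. s < r \<Longrightarrow> r < s + \<tau> \<Longrightarrow> u r = v" and "r \<in> {s..s + \<tau>}"
  shows "trajectory x r = evolution v (r - s) (trajectory x s)"
proof (rule trajectory_constant[OF assms(1) _ assms(3)])
  show "u q = v" if "s < q" "q < r" for q using assms(4)[of q] assms(5) that by simp
qed (use assms(5) in simp)

lemma range_adm: "v \<in> range u \<Longrightarrow> \<bar>v\<bar> * a < 1"
  using adm by auto

lemma trajectory_isometry:
  assumes "0 \<le> t"
  shows "norm (trajectory x t) = norm x \<and> trajectory (x - y) t = trajectory x t - trajectory y t"
  using assms
proof (induction rule: constancy_induct)
  case (step s v \<tau>)
  then show ?case
    using trajectory_step[OF step(1,2,3,4), of "s + \<tau>"] unitary_groupD(3,9)[OF evolution_unitary[OF range_adm[OF step(3)]]]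
    by simp
qed (simp add: trajectory_0)

lemma trajectory_Domain:
  assumes "0 \<le> t" "x \<in> Domain A"
  shows "trajectory x t \<in> Domain A"
  using assms(1)
proof (induction rule: constancy_induct)
  case (step s v \<tau>)
  then have "trajectory x s \<in> Domain (perturbed v)" by (simp add: Domain_perturbed)
  then show ?case
    using evolution_invariant[OF range_adm[OF step(3)]] trajectory_step[OF step(1,2,3,4), of "s + \<tau>" x] step(2)
      Domain_perturbed by fastforce
qed (simp add: trajectory_0 assms(2))

text \<open>The end points of the constancy intervals are the exceptional times; in between the trajectory is an
orbit of a single unitary group.\<close>

lemma trajectory_solution:
  assumes x: "x \<in> Domain A" and t: "0 \<le> t"
  shows "continuous_on {0..t} (trajectory x) \<and> (\<exists>F. finite F \<and> (\<forall>r\<in>{0<..<t} - F.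
    \<exists>y. (trajectory x r, y) \<in> perturbed (u r) \<and> (trajectory x has_vector_derivative y) (at r)))"
  using t
proof (induction rule: constancy_induct)
  case (step s v \<tau>)
  define z where "z = trajectory x s"
  note ad = range_adm[OF step(3)]
  have eq: "trajectory x r = evolution v (r - s) z" if "r \<in> {s..s + \<tau>}" for r
    unfolding z_def by (rule trajectory_step[OF step(1,2,3,4) that])
  have "continuous_on {s..s + \<tau>} (\<lambda>r. evolution v (r - s) z)"
    by (rule continuous_on_compose2[OF unitary_groupD(6)[OF evolution_unitary[OF ad]]]) (auto intro: continuous_intros)
  then have "continuous_on {s..s + \<tau>} (trajectory x)" by (rule continuous_on_eq) (rule eq[symmetric])
  then have "continuous_on ({0..s} \<union> {s..s + \<tau>}) (trajectory x)"
    using step(5) by (intro continuous_on_closed_Un) auto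
  also have "{0..s} \<union> {s..s + \<tau>} = {0..s + \<tau>}" using step(1,2) by auto
  finally have 1: "continuous_on {0..s + \<tau>} (trajectory x)" .
  obtain F where F: "finite F" "\<And>r. r \<in> {0<..<s} - F \<Longrightarrow>
      \<exists>y. (trajectory x r, y) \<in> perturbed (u r) \<and> (trajectory x has_vector_derivative y) (at r)"
    using step(5) by blast
  have "z \<in> Domain (perturbed v)" unfolding z_def Domain_perturbed by (rule trajectory_Domain[OF step(1) x])
  then obtain z' where z': "(z, z') \<in> perturbed v" by blast
  have "\<exists>y. (trajectory x r, y) \<in> perturbed (u r) \<and> (trajectory x has_vector_derivative y) (at r)"
    if r: "r \<in> {0<..<s + \<tau>} - insert s F" for r
  proof (cases "r < s")
    case True
    then show ?thesis using F(2)[of r] r by simp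
  next
    case False
    then have sr: "r \<in> {s<..<s + \<tau>}" using r by auto
    have "((\<lambda>r. evolution v (r - s) z) has_vector_derivative evolution v (r - s) z') (at r)"
      using evolution_deriv[OF ad z', of "r - s"] unfolding has_vector_derivative_iff_difference_quotient
      by (simp add: algebra_simps)
    then have "(trajectory x has_vector_derivative evolution v (r - s) z') (at r)"
      by (rule has_vector_derivative_transform_within_open[where S = "{s<..<s + \<tau>}"]) (use sr eq in auto)
    moreover have "(trajectory x r, evolution v (r - s) z') \<in> perturbed (u r)"
      using evolution_invariant[OF ad z', of "r - s"] eq[of r] step(4)[of r] sr by simp
    ultimately show ?thesis by blast
  qed
  then show ?case using 1 F(1) by blast
qed auto

end

section \<open>Functions of bounded variation\<close>

lemma variation_sum_Suc: "variation_sum u (Suc n) p = variation_sum u n p + \<bar>u (p (Suc n)) - u (p n)\<bar>"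
  by (simp add: variation_sum_def)

lemma is_partition_Suc: "is_partition s t (Suc n) p \<longleftrightarrow> is_partition s (p n) n p \<and> p n < t \<and> p (Suc n) = t"
  by (auto simp: is_partition_def less_Suc_eq)

lemma is_partition_le: "is_partition s t n p \<Longrightarrow> s \<le> t"
  by (induction n arbitrary: t) (auto simp: is_partition_Suc is_partition_def[of _ _ 0] intro: order_trans less_imp_le)

lemma is_partition_ex:
  assumes "s \<le> t"
  shows "\<exists>n p. is_partition s t n p"
proof (cases "s = t")
  case True
  then have "is_partition s t 0 (\<lambda>_. s)" by (simp add: is_partition_def)
  then show ?thesis by blast
next
  case False
  then have "is_partition s t 1 (\<lambda>k. if k = 0 then s else t)" using assms by (simp add: is_partition_def)
  then show ?thesis by blast
qed

lemma total_variation_upper: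
  assumes "bounded_variation u" "is_partition s t n p"
  shows "variation_sum u n p \<le> total_variation s t u"
  unfolding total_variation_def
proof (rule cSup_upper)
  obtain M where "\<And>s t n p. is_partition s t n p \<Longrightarrow> variation_sum u n p \<le> M"
    using assms(1) unfolding bounded_variation_def by blast
  then show "bdd_above {variation_sum u n p |n p. is_partition s t n p}"
    by (intro bdd_aboveI[of _ M]) blast
qed (use assms(2) in blast)

lemma total_variation_le:
  assumes "s \<le> t" "\<And>n p. is_partition s t n p \<Longrightarrow> variation_sum u n p \<le> C"
  shows "total_variation s t u \<le> C"
  unfolding total_variation_def
  by (rule cSup_least) (use is_partition_ex[OF assms(1)] assms(2) in blast)+

lemma total_variation_extend:
  assumes bv: "bounded_variation u" and st: "r \<le> s" "s \<le> t"
  shows "total_variation r s u + \<bar>u t - u s\<bar> \<le> total_variation r t u"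
proof (cases "s = t")
  case False
  have "total_variation r s u \<le> total_variation r t u - \<bar>u t - u s\<bar>"
  proof (rule total_variation_le[OF st(1)])
    fix n p assume p: "is_partition r s n p"
    define q where "q = p(Suc n := t)"
    have "is_partition r t (Suc n) q" using p False st(2) by (auto simp: is_partition_def q_def less_Suc_eq)
    from total_variation_upper[OF bv this]
    have "variation_sum u n q + \<bar>u t - u s\<bar> \<le> total_variation r t u"
      using p by (simp add: variation_sum_Suc q_def is_partition_def)
    moreover have "variation_sum u n q = variation_sum u n p"
      unfolding variation_sum_def q_def by (rule sum.cong) auto
    ultimately show "variation_sum u n p \<le> total_variation r t u - \<bar>u t - u s\<bar>" by simp
  qed
  then show ?thesis by simp
qed simp

lemma variation_sum_le_increment:
  assumes "\<And>s t. s \<le> t \<Longrightarrow> \<bar>w t - w s\<bar> \<le> G t - G s" and "is_partition s t n p"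
  shows "variation_sum w n p \<le> G t - G s"
  using assms(2)
proof (induction n arbitrary: t)
  case 0 then show ?case by (auto simp: is_partition_def variation_sum_def)
next
  case (Suc n)
  then have "is_partition s (p n) n p" "p n < t" "p (Suc n) = t" by (auto simp: is_partition_Suc)
  then show ?case using Suc.IH[of "p n"] assms(1)[of "p n" t] by (simp add: variation_sum_Suc)
qed

text \<open>The clipping at \<open>0\<close> makes this a monotone function on the whole line; on an interval with negative
length the supremum in \<open>total_variation\<close> would be over the empty set.\<close>

definition variation_upto :: "(real \<Rightarrow> real) \<Rightarrow> real \<Rightarrow> real"
  where "variation_upto u t = total_variation 0 (max 0 t) u"

locale bv_control =
  fixes u :: "real \<Rightarrow> real"
  assumes bv: "bounded_variation u" and zero: "\<And>t. t \<le> 0 \<Longrightarrow> u t = 0"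
begin

lemma variation_upto_increment: "s \<le> t \<Longrightarrow> \<bar>u t - u s\<bar> \<le> variation_upto u t - variation_upto u s"
  using total_variation_extend[OF bv, of 0 "max 0 s" "max 0 t"] zero[of s] zero[of t] zero[of 0]
  by (auto simp: variation_upto_def max_def split: if_splits)

lemma variation_upto_mono: "s \<le> t \<Longrightarrow> variation_upto u s \<le> variation_upto u t"
  using variation_upto_increment[of s t] by simp

lemma variation_upto_nonpos: "t \<le> 0 \<Longrightarrow> variation_upto u t = 0"
proof -
  have "variation_sum u n p = 0" if "is_partition 0 0 n p" for n p
  proof (cases n)
    case (Suc m)
    then show ?thesis using that is_partition_le[of 0 "p m" m p] by (auto simp: is_partition_Suc)
  qed (simp add: variation_sum_def)
  then have "total_variation 0 0 u = 0"
    using is_partition_ex[of 0 0] total_variation_upper[OF bv, of 0 0] total_variation_le[of 0 0 u 0]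
    by (metis order_antisym order_refl)
  then show "t \<le> 0 \<Longrightarrow> variation_upto u t = 0" by (simp add: variation_upto_def)
qed

lemma variation_upto_nonneg: "0 \<le> variation_upto u t"
  using variation_upto_mono[of "min 0 t" t] variation_upto_nonpos[of "min 0 t"] by simp

lemma variation_upto_bounded: "\<exists>M. \<forall>t. variation_upto u t \<le> M"
proof -
  obtain M where "\<And>s t n p. is_partition s t n p \<Longrightarrow> variation_sum u n p \<le> M"
    using bv unfolding bounded_variation_def by blast
  then have "variation_upto u t \<le> M" for t
    unfolding variation_upto_def by (intro total_variation_le) auto
  then show ?thesis by blast
qed

lemma abs_le_variation_upto: "\<bar>u t\<bar> \<le> variation_upto u t"
  using variation_upto_increment[of "min 0 t" t] variation_upto_nonpos[of "min 0 t"] zero[of "min 0 t"] by simp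

text \<open>The Jordan decomposition writes \<open>u\<close> as a difference of two increasing functions.\<close>

lemma borel_measurable: "u \<in> borel_measurable borel"
proof -
  have 1: "variation_upto u \<in> borel_measurable borel"
    by (rule borel_measurable_mono) (simp add: mono_def variation_upto_mono)
  have "(\<lambda>t. variation_upto u t - u t) \<in> borel_measurable borel"
  proof (rule borel_measurable_mono, rule monoI)
    show "variation_upto u s - u s \<le> variation_upto u t - u t" if "s \<le> t" for s t
      using variation_upto_increment[OF that] by simp
  qed
  from borel_measurable_diff[OF 1 this] show ?thesis by simp
qed

end

lemma bv_control_controls: "u \<in> controls \<delta> a \<Longrightarrow> bv_control u"
  by unfold_locales (auto simp: controls_def)

lemma same_floor_close:
  fixes x y :: real
  assumes "\<lfloor>real (Suc n) * x\<rfloor> = \<lfloor>real (Suc n) * y\<rfloor>"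
  shows "\<bar>x - y\<bar> \<le> 1 / real (Suc n)"
proof -
  have "\<bar>real (Suc n) * x - real (Suc n) * y\<bar> < 1" using assms by linarith
  then have "real (Suc n) * \<bar>x - y\<bar> < 1" by (simp add: abs_mult right_diff_distrib[symmetric])
  then show ?thesis by (simp add: field_simps)
qed

text \<open>Let \<open>W\<close> be the variation function of \<open>u\<close> with additional unit jumps at \<open>0\<close> and \<open>T\<close>, and let \<open>g n\<close>
send \<open>t\<close> to a fixed representative of its level set under \<open>k n = \<lfloor>(n + 1) W\<rfloor>\<close>. Since \<open>W\<close> is monotone
and bounded, the level sets are finitely many consecutive intervals, so \<open>u \<circ> g n\<close> is piecewise
constant and \<open>g n\<close> is monotone, whence the composition has no more variation than \<open>u\<close>. As \<open>W\<close>
dominates the oscillation of \<open>u\<close> and varies by at most \<open>1 / (n + 1)\<close> on a level set, the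
approximation is even uniform. The two jumps keep the representatives on the same side of \<open>0\<close> and
of \<open>T\<close> as the points that they represent.\<close>

theorem pc_approximation_exists:
  assumes u: "u \<in> controls \<delta> a" and T: "T \<ge> 0"
  shows "\<exists>us. pc_approximation \<delta> a T u us"
proof -
  interpret bv_control u by (rule bv_control_controls[OF u])
  obtain M where M: "\<And>t. variation_upto u t \<le> M" using variation_upto_bounded by blast
  define W where "W t = variation_upto u t + (if t > 0 then 1 else 0) + (if t > T then 1 else 0)" for t
  have W_inc: "variation_upto u t - variation_upto u s \<le> W t - W s" if "s \<le> t" for s t
    using that by (auto simp: W_def)
  have W_mono: "W s \<le> W t" if "s \<le> t" for s t using W_inc[OF that] variation_upto_mono[OF that] by simp
  have W_jump: "W s + 1 \<le> W t" if "s \<le> 0 \<and> 0 < t \<or> s \<le> T \<and> T < t" for s t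
    using that variation_upto_mono[of s t] T by (auto simp: W_def)
  define k where "k n t = \<lfloor>real (Suc n) * W t\<rfloor>" for n t
  have k_mono: "k n s \<le> k n t" if "s \<le> t" for n s t
    unfolding k_def using W_mono[OF that] by (intro floor_mono mult_left_mono) auto
  have k_jump: "k n s < k n t" if "s \<le> 0 \<and> 0 < t \<or> s \<le> T \<and> T < t" for n s t
  proof -
    have "real (Suc n) * (W s + 1) \<le> real (Suc n) * W t" using W_jump[OF that] by (intro mult_left_mono) auto
    then have "real (Suc n) * W s + 1 \<le> real (Suc n) * W t" by (simp add: algebra_simps)
    then show ?thesis unfolding k_def by linarith
  qed
  define g where "g n t = (SOME s. k n s = k n t)" for n t
  have kg: "k n (g n t) = k n t" for n t unfolding g_def by (rule someI) (rule refl)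
  have g_eq: "k n s = k n t \<Longrightarrow> g n s = g n t" for n s t unfolding g_def by simp
  have g_mono: "g n s \<le> g n t" if "s \<le> t" for n s t
  proof (cases "k n s = k n t")
    case False
    then have "k n (g n s) < k n (g n t)" using k_mono[OF that, of n] by (simp add: kg)
    then show ?thesis using k_mono[of "g n t" "g n s" n] by linarith
  next
    case True
    then have "g n s = g n t" by (rule g_eq)
    then show ?thesis by simp
  qed
  have g0: "g n t \<le> 0" if "t \<le> 0" for n t
    using k_jump[of t "g n t" n] kg[of n t] that by force
  have gT: "g n t \<le> T" if "t \<le> T" for n t
    using k_jump[of t "g n t" n] kg[of n t] that by force
  define us where "us n t = u (g n t)" for n t
  have inc: "\<bar>us n t - us n s\<bar> \<le> variation_upto u (g n t) - variation_upto u (g n s)" if "s \<le> t" for n s t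
    unfolding us_def by (rule variation_upto_increment[OF g_mono[OF that]])
  have "us n \<in> controls \<delta> a" for n
  proof -
    have "variation_sum (us n) m p \<le> M" if "is_partition s t m p" for s t m p
      using variation_sum_le_increment[where w = "us n", OF inc that] M[of "g n t"] variation_upto_nonneg[of "g n s"] by simp
    then have "bounded_variation (us n)" unfolding bounded_variation_def by blast
    then show ?thesis using u g0 zero unfolding controls_def us_def by auto
  qed
  moreover have "piecewise_constant (us n)" for n
  proof -
    \<comment> \<open>Between two points of different level sets lies the left end of the level set of the larger point.\<close>
    define F where "F = (\<lambda>j. Inf {t. k n t = j}) ` range (k n)"
    have "0 \<le> W t \<and> W t \<le> M + 2" for t
      using variation_upto_nonneg[of t] M[of t] by (auto simp: W_def)
    then have "0 \<le> k n t \<and> k n t \<le> \<lfloor>real (Suc n) * (M + 2)\<rfloor>" for t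
      unfolding k_def by (auto intro!: floor_mono mult_left_mono simp del: of_nat_Suc)
    then have "range (k n) \<subseteq> {0..\<lfloor>real (Suc n) * (M + 2)\<rfloor>}" by auto
    then have "finite F" unfolding F_def by (rule finite_imageI[OF finite_subset[OF _ finite_atLeastAtMost_int]])
    moreover have "us n s = us n t" if st: "s \<le> t" "{s..t} \<inter> F = {}" for s t
    proof (cases "k n s = k n t")
      case False
      then have lt: "k n s < k n t" using k_mono[OF st(1), of n] by simp
      have lb: "s \<le> r" if "k n r = k n t" for r
        using that lt k_mono[of r s n] by linarith
      have "Inf {r. k n r = k n t} \<in> {s..t}"
      proof -
        have "s \<le> Inf {r. k n r = k n t}" by (rule cInf_greatest) (use lb in auto)
        moreover have "Inf {r. k n r = k n t} \<le> t"
          by (rule cInf_lower) (auto intro!: bdd_belowI[of _ s] lb)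
        ultimately show ?thesis by simp
      qed
      moreover have "Inf {r. k n r = k n t} \<in> F" unfolding F_def by blast
      ultimately show ?thesis using st(2) by blast
    next
      case True
      then have "g n s = g n t" by (rule g_eq)
      then show ?thesis unfolding us_def by simp
    qed
    ultimately show ?thesis unfolding piecewise_constant_def by blast
  qed
  moreover have "total_variation 0 T (us n) \<le> total_variation 0 T u" for n
  proof (rule total_variation_le[OF T])
    fix m p assume p: "is_partition 0 T m p"
    have "variation_sum (us n) m p \<le> variation_upto u (g n T) - variation_upto u (g n 0)"
      by (rule variation_sum_le_increment[OF inc p])
    also have "\<dots> \<le> variation_upto u T"
      using variation_upto_mono[OF gT[of T n]] variation_upto_nonneg[of "g n 0"] by simp
    finally show "variation_sum (us n) m p \<le> total_variation 0 T u" using T by (simp add: variation_upto_def)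
  qed
  moreover have "(\<lambda>n. us n t) \<longlonglongrightarrow> u t" for t
  proof -
    have bound: "norm (us n t - u t) \<le> 1 / real (Suc n)" for n
    proof -
      have Wc: "\<bar>W (g n t) - W t\<bar> \<le> 1 / real (Suc n)"
        using same_floor_close[of n "W (g n t)" "W t"] kg[of n t] unfolding k_def by simp
      have "\<bar>u (g n t) - u t\<bar> \<le> \<bar>W (g n t) - W t\<bar>"
        using variation_upto_increment[of t "g n t"] variation_upto_increment[of "g n t" t]
          W_inc[of t "g n t"] W_inc[of "g n t" t] by (cases "t \<le> g n t") linarith+
      then show ?thesis using Wc unfolding us_def real_norm_def by linarith
    qed
    have "(\<lambda>n. us n t - u t) \<longlonglongrightarrow> 0"
      by (rule Lim_null_comparison[OF always_eventually[OF allI[OF bound]]])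
        (use LIMSEQ_inverse_real_of_nat in \<open>simp add: inverse_eq_divide\<close>)
    then show ?thesis by (rule LIM_zero_cancel)
  qed
  ultimately show ?thesis unfolding pc_approximation_def by blast
qed

section \<open>Dependence of the evolution on the control\<close>

lemma bounded_measurable_integrable_on:
  fixes f :: "real \<Rightarrow> real"
  assumes "f \<in> borel_measurable borel" "\<And>x. \<bar>f x\<bar> \<le> C"
  shows "f integrable_on {s..t}"
proof (rule measurable_bounded_by_integrable_imp_integrable[where g = "\<lambda>_. C"])
  show "f \<in> borel_measurable (lebesgue_on {s..t})"
    using assms(1) by (intro measurable_restrict_space1 measurable_completion) simp
qed (use assms(2) in auto)

context kato_rellich
begin

text \<open>The difference \<open>d\<close> of the two trajectories satisfies \<open>d' = (A + u B) d + (u - w) B y\<close> with the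
trajectory \<open>y\<close> of \<open>w\<close>, except at finitely many times. The first term is skew, so the derivative of
\<open>(norm d)\<^sup>2\<close> is at most \<open>2 \<bar>u - w\<bar> norm d norm (B y)\<close>.\<close>

lemma pc_propagator_distance:
  assumes u: "pc_control A B a b u" and w: "pc_control A B a b w"
    and x: "x \<in> Domain A" and t: "0 \<le> t"
    and bound: "\<And>s y. 0 \<le> s \<Longrightarrow> s \<le> t \<Longrightarrow> (pc_propagator A B w s x, y) \<in> B \<Longrightarrow> norm y \<le> \<beta>"
    and int: "(\<lambda>s. \<bar>u s - w s\<bar>) integrable_on {0..t}"
  shows "(norm (pc_propagator A B u t x - pc_propagator A B w t x))\<^sup>2
    \<le> 4 * norm x * \<beta> * integral {0..t} (\<lambda>s. \<bar>u s - w s\<bar>)"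
proof -
  interpret u: pc_control A B a b u by (rule u)
  interpret w: pc_control A B a b w by (rule w)
  define d where "d s = u.trajectory x s - w.trajectory x s" for s
  obtain F where F: "finite F" "\<And>s. s \<in> {0<..<t} - F \<Longrightarrow>
      \<exists>y. (u.trajectory x s, y) \<in> perturbed (u s) \<and> (u.trajectory x has_vector_derivative y) (at s)"
    using u.trajectory_solution[OF x t] by blast
  obtain G where G: "finite G" "\<And>s. s \<in> {0<..<t} - G \<Longrightarrow>
      \<exists>y. (w.trajectory x s, y) \<in> perturbed (w s) \<and> (w.trajectory x has_vector_derivative y) (at s)"
    using w.trajectory_solution[OF x t] by blast
  have "\<exists>D. ((\<lambda>s. (norm (d s))\<^sup>2) has_real_derivative D) (at s) \<and> D \<le> (4 * norm x * \<beta>) * \<bar>u s - w s\<bar>"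
    if s: "s \<in> {0<..<t} - (F \<union> G)" for s
  proof -
    obtain p where p: "(u.trajectory x s, p) \<in> perturbed (u s)" "(u.trajectory x has_vector_derivative p) (at s)"
      using F(2)[of s] s by blast
    obtain q where q: "(w.trajectory x s, q) \<in> perturbed (w s)" "(w.trajectory x has_vector_derivative q) (at s)"
      using G(2)[of s] s by blast
    obtain q' q'' where q': "(w.trajectory x s, q') \<in> A" "(w.trajectory x s, q'') \<in> B" "q = q' + w s *\<^sub>R q''"
      using q(1) perturbed_iff by blast
    have "(w.trajectory x s, q' + u s *\<^sub>R q'') \<in> perturbed (u s)" using q' perturbed_iff by blast
    from linear_operatorD(7)[OF perturbed_linear p(1) this]
    have dp: "(d s, p - (q' + u s *\<^sub>R q'')) \<in> perturbed (u s)" unfolding d_def .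
    have "rinner (d s) (p - (q' + u s *\<^sub>R q'')) = 0"
      using perturbed_skew[OF dp dp] by (simp add: rinner_commute)
    moreover have "p - q = (p - (q' + u s *\<^sub>R q'')) + (u s - w s) *\<^sub>R q''"
      unfolding q'(3) by (simp add: algebra_simps)
    ultimately have eq: "rinner (d s) (p - q) = (u s - w s) * rinner (d s) q''"
      by (simp only: rinner_add_right rinner_scaleR_right add_0_left)
    have "norm (d s) \<le> 2 * norm x"
      using norm_triangle_ineq4[of "u.trajectory x s" "w.trajectory x s"] s u.trajectory_isometry[of s x] w.trajectory_isometry[of s x]
      by (simp add: d_def)
    moreover have "norm q'' \<le> \<beta>" using bound[of s q''] s q'(2) by (simp add: w.trajectory_def)
    ultimately have "norm (d s) * norm q'' \<le> 2 * norm x * \<beta>" by (intro mult_mono) auto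
    then have "\<bar>rinner (d s) q''\<bar> \<le> 2 * norm x * \<beta>" using rinner_Cauchy_Schwarz[of "d s" q''] by linarith
    then have "\<bar>u s - w s\<bar> * \<bar>rinner (d s) q''\<bar> \<le> \<bar>u s - w s\<bar> * (2 * norm x * \<beta>)" by (intro mult_left_mono) auto
    then have "(u s - w s) * rinner (d s) q'' \<le> \<bar>u s - w s\<bar> * (2 * norm x * \<beta>)"
      by (metis abs_ge_self abs_mult order_trans)
    then have "2 * rinner (d s) (p - q) \<le> 2 * (\<bar>u s - w s\<bar> * (2 * norm x * \<beta>))" unfolding eq by linarith
    also have "\<dots> = (4 * norm x * \<beta>) * \<bar>u s - w s\<bar>" by simp
    finally have "2 * rinner (d s) (p - q) \<le> (4 * norm x * \<beta>) * \<bar>u s - w s\<bar>" .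
    moreover have "((\<lambda>s. (norm (d s))\<^sup>2) has_real_derivative 2 * rinner (d s) (p - q)) (at s)"
      unfolding d_def by (intro norm_sq_has_real_derivative has_vector_derivative_diff p q)
    ultimately show ?thesis by blast
  qed
  then obtain D where D: "\<And>s. s \<in> {0<..<t} - (F \<union> G) \<Longrightarrow>
      ((\<lambda>s. (norm (d s))\<^sup>2) has_real_derivative D s) (at s) \<and> D s \<le> (4 * norm x * \<beta>) * \<bar>u s - w s\<bar>"
    by metis
  \<comment> \<open>At the exceptional times, which include the end points, the integrand is set to zero.\<close>
  define E where "E s = (if s \<in> F \<union> G \<union> {0, t} then 0 else D s)" for s
  have "0 \<le> \<beta>"
  proof -
    have "x \<in> Domain B" using x dom by blast
    then obtain y where "(x, y) \<in> B" by blast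
    then have "norm y \<le> \<beta>" using bound[of 0 y] t w.trajectory_0[of x] by (simp add: w.trajectory_def)
    then show ?thesis using norm_ge_zero order_trans by blast
  qed
  have "(E has_integral ((norm (d t))\<^sup>2 - (norm (d 0))\<^sup>2)) {0..t}"
  proof (rule fundamental_theorem_of_calculus_interior_strong[OF _ t])
    show "finite (F \<union> G \<union> {0, t})" using F(1) G(1) by simp
    show "((\<lambda>s. (norm (d s))\<^sup>2) has_vector_derivative E s) (at s)" if "s \<in> {0<..<t} - (F \<union> G \<union> {0, t})" for s
      using D[of s] that by (simp add: E_def has_real_derivative_iff_has_vector_derivative)
    show "continuous_on {0..t} (\<lambda>s. (norm (d s))\<^sup>2)"
      unfolding d_def by (intro continuous_intros conjunct1[OF u.trajectory_solution[OF x t]] conjunct1[OF w.trajectory_solution[OF x t]])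
  qed
  moreover have "((\<lambda>s. (4 * norm x * \<beta>) * \<bar>u s - w s\<bar>) has_integral
      (4 * norm x * \<beta>) * integral {0..t} (\<lambda>s. \<bar>u s - w s\<bar>)) {0..t}"
    by (intro has_integral_mult_right integrable_integral int)
  moreover have "E s \<le> (4 * norm x * \<beta>) * \<bar>u s - w s\<bar>" if "s \<in> {0..t}" for s
    using D[of s] that \<open>0 \<le> \<beta>\<close> by (auto simp: E_def)
  ultimately have "(norm (d t))\<^sup>2 - (norm (d 0))\<^sup>2 \<le> (4 * norm x * \<beta>) * integral {0..t} (\<lambda>s. \<bar>u s - w s\<bar>)"
    by (rule has_integral_le)
  moreover have "d 0 = 0" by (simp add: d_def u.trajectory_0 w.trajectory_0)
  ultimately show ?thesis by (simp add: d_def u.trajectory_def w.trajectory_def)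
qed

end

section \<open>The regularity estimate for piecewise constant controls\<close>

locale bounded_below_pair = kato_rellich A B a b
  for A B :: "'h::chilbert_space operator" and a b :: real +
  fixes c \<delta> :: real
  assumes lower: "\<And>x x'. (x, x') \<in> A \<Longrightarrow> c * (norm x)\<^sup>2 \<le> rinner x (\<i> *\<^sub>C x')"
    and \<delta>: "0 < \<delta>" "\<delta> < 1"
begin

text \<open>Expanding the square of \<open>norm (A x - \<i> m x)\<close>, the mixed term is \<open>2 m\<close> times the quadratic form of
\<open>\<i> A\<close>, hence at least \<open>2 m c (norm x)\<^sup>2\<close>. For \<open>m \<ge> 4 \<bar>c\<bar>\<close> it eats up at most half of the term
\<open>m\<^sup>2 (norm x)\<^sup>2\<close>.\<close>

lemma shift_norm_lower:
  assumes x: "(x, x') \<in> A" and m: "m \<ge> 4 * \<bar>c\<bar>"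
  shows "norm x' \<le> norm (x' + (\<i> * complex_of_real (- m)) *\<^sub>C x)" (is "_ \<le> ?n")
    "m * norm x \<le> 2 * norm (x' + (\<i> * complex_of_real (- m)) *\<^sub>C x)"
proof -
  have i: "(\<i> * complex_of_real (- m)) *\<^sub>C x = - (m *\<^sub>R (\<i> *\<^sub>C x))"
    by (metis (no_types) mult.commute of_real_minus scaleC_scaleC scaleR_minus_left scaleR_scaleC)
  have "rinner x' (\<i> *\<^sub>C x) = - rinner x (\<i> *\<^sub>C x')"
    using rinner_ii[of x x'] by (simp add: rinner_commute)
  then have "(?n)\<^sup>2
      = (norm x')\<^sup>2 + 2 * m * rinner x (\<i> *\<^sub>C x') + m\<^sup>2 * (norm x)\<^sup>2"
    unfolding i norm_add_sq by (simp add: rinner_simps norm_scaleC power_mult_distrib)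
  moreover have "2 * m * (c * (norm x)\<^sup>2) \<le> 2 * m * rinner x (\<i> *\<^sub>C x')"
    using lower[OF x] m by (intro mult_left_mono) auto
  moreover have "- (m\<^sup>2 / 2) * (norm x)\<^sup>2 \<le> 2 * m * (c * (norm x)\<^sup>2)"
  proof -
    have "m * (m + 4 * c) \<ge> 0" using m by (intro mult_nonneg_nonneg) auto
    then have "- (m\<^sup>2 / 2) \<le> 2 * m * c" by (simp add: power2_eq_square algebra_simps)
    then have "- (m\<^sup>2 / 2) * (norm x)\<^sup>2 \<le> 2 * m * c * (norm x)\<^sup>2" by (intro mult_right_mono) auto
    then show ?thesis by (simp add: mult.assoc)
  qed
  ultimately have key: "(norm x')\<^sup>2 + (m\<^sup>2 / 2) * (norm x)\<^sup>2 \<le> (?n)\<^sup>2"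
    by (simp add: field_simps)
  show "norm x' \<le> ?n"
  proof (rule power2_le_imp_le)
    have "0 \<le> (m\<^sup>2 / 2) * (norm x)\<^sup>2" by simp
    then show "(norm x')\<^sup>2 \<le> (?n)\<^sup>2" using key by linarith
  qed simp
  show "m * norm x \<le> 2 * ?n"
  proof (rule power2_le_imp_le)
    have "(m\<^sup>2 / 2) * (norm x)\<^sup>2 \<le> (?n)\<^sup>2"
      using key zero_le_power2[of "norm x'"] by linarith
    then have "m\<^sup>2 * (norm x)\<^sup>2 \<le> 4 * (?n)\<^sup>2"
      using zero_le_power2[of "?n"] by linarith
    then show "(m * norm x)\<^sup>2 \<le> (2 * ?n)\<^sup>2"
      by (simp add: power_mult_distrib)
  qed simp
qed

text \<open>The point is uniformity in \<open>v\<close>: a single constant \<open>\<kappa>\<close> bounds \<open>B\<close> relative to each of the shifted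
generators that a control can select.\<close>

definition dominating_shift :: "real \<Rightarrow> real \<Rightarrow> bool"
  where "dominating_shift \<mu> \<kappa> \<longleftrightarrow> 0 \<le> \<kappa> \<and>
    (\<forall>v x x' x''. \<bar>v\<bar> \<le> (1 - \<delta>) / a \<longrightarrow> (x, x') \<in> A \<longrightarrow> (x, x'') \<in> B \<longrightarrow>
      norm x'' \<le> \<kappa> * norm (x' + v *\<^sub>R x'' + (\<i> * complex_of_real \<mu>) *\<^sub>C x))"

text \<open>For a large shift the term \<open>b norm x\<close> is absorbed, and \<open>B\<close> is bounded by \<open>a (1 + e)\<close> relative to
\<open>A + \<i> \<mu>\<close>. Passing to \<open>A + v B + \<i> \<mu>\<close> costs the denominator \<open>d = 1 - (1 - \<delta>) (1 + e)\<close>, and the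
resulting \<open>\<kappa> = a (1 + e) / d\<close> tends to \<open>a / \<delta>\<close> as \<open>e\<close> tends to \<open>0\<close>.\<close>

lemma dominating_shift_exists:
  assumes \<eta>: "\<eta> > 0"
  shows "\<exists>\<mu> \<kappa>. dominating_shift \<mu> \<kappa> \<and> 2 * \<kappa> \<le> (2 * a + \<eta>) / \<delta>"
proof -
  \<comment> \<open>This \<open>e\<close> is small enough for \<open>\<kappa> \<le> (a + \<eta> / 2) / \<delta>\<close>.\<close>
  define e where "e = (\<delta> * \<eta> / 2) / (a + \<eta> / 2)"
  define d where "d = \<delta> - e * (1 - \<delta>)"
  \<comment> \<open>The first entry controls the mixed term of the square, the second absorbs \<open>b\<close> into \<open>a e\<close>.\<close>
  define m where "m = max (4 * \<bar>c\<bar>) (2 * b / (a * e))"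
  have den: "a + \<eta> / 2 > 0" using a_pos \<eta> by simp
  have e: "e > 0" "e * (a + \<eta> / 2) = \<delta> * \<eta> / 2"
    unfolding e_def using den \<delta> \<eta> by (simp, metis nonzero_divide_eq_eq less_irrefl)
  have "e < \<delta>" unfolding e_def using den \<delta> a_pos \<eta> by (simp add: field_simps)
  then have d: "d > 0" unfolding d_def using \<delta> e(1) by (smt (verit) mult_left_le)
  define \<kappa> where "\<kappa> = a * (1 + e) / d"
  have \<kappa>: "\<kappa> \<ge> 0" unfolding \<kappa>_def using a_pos e d by simp
  have "\<kappa> \<le> (a + \<eta> / 2) / \<delta>"
  proof -
    have "\<delta> * (a * (1 + e)) \<le> (a + \<eta> / 2) * d"
    proof -
      have "(a + \<eta> / 2) * d = \<delta> * (a + \<eta> / 2) - e * (a + \<eta> / 2) * (1 - \<delta>)"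
      proof -
        have "X * (\<delta> - e * (1 - \<delta>)) = \<delta> * X - e * X * (1 - \<delta>)" for X by (simp add: algebra_simps)
        then show ?thesis unfolding d_def .
      qed
      also have "\<dots> = \<delta> * a + \<delta> * (\<delta> * \<eta> / 2)" unfolding e(2) by (simp add: field_simps)
      finally have 1: "(a + \<eta> / 2) * d = \<delta> * a + \<delta> * (\<delta> * \<eta> / 2)" .
      have "0 \<le> e * (\<eta> / 2)" using e \<eta> by simp
      then have "a * e \<le> \<delta> * \<eta> / 2" using e(2) by (simp add: distrib_left mult.commute)
      then have "\<delta> * (a * e) \<le> \<delta> * (\<delta> * \<eta> / 2)" using \<delta> by (intro mult_left_mono) auto
      then show ?thesis unfolding 1 by (simp add: distrib_left)
    qed
    then show ?thesis unfolding \<kappa>_def using d \<delta> by (simp add: field_simps)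
  qed
  moreover have "2 * a + \<eta> = 2 * (a + \<eta> / 2)" by simp
  then have "(2 * a + \<eta>) / \<delta> = 2 * ((a + \<eta> / 2) / \<delta>)" by (simp only: times_divide_eq_right)
  ultimately have \<kappa>2: "2 * \<kappa> \<le> (2 * a + \<eta>) / \<delta>" by linarith
  have "norm x'' \<le> \<kappa> * norm (x' + v *\<^sub>R x'' + (\<i> * complex_of_real (- m)) *\<^sub>C x)"
    if v: "\<bar>v\<bar> \<le> (1 - \<delta>) / a" and x: "(x, x') \<in> A" "(x, x'') \<in> B" for v x x' x''
  proof -
    let ?n = "norm (x' + (\<i> * complex_of_real (- m)) *\<^sub>C x)"
    let ?N = "norm (x' + v *\<^sub>R x'' + (\<i> * complex_of_real (- m)) *\<^sub>C x)"
    have mc: "m \<ge> 4 * \<bar>c\<bar>" by (simp add: m_def)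
    have "2 * b \<le> m * (a * e)"
    proof -
      have "2 * b / (a * e) \<le> m" by (simp add: m_def)
      then show ?thesis using a_pos e(1) by (simp add: pos_divide_le_eq)
    qed
    then have "2 * b * norm x \<le> (a * e) * (m * norm x)" by (metis mult.assoc mult.commute mult_right_mono norm_ge_zero)
    also have "\<dots> \<le> (a * e) * (2 * ?n)"
      using shift_norm_lower(2)[OF x(1) mc] a_pos e(1) by (intro mult_left_mono) auto
    finally have "b * norm x \<le> a * e * ?n" by simp
    moreover have "a * norm x' \<le> a * ?n" using shift_norm_lower(1)[OF x(1) mc] a_pos by simp
    ultimately have 1: "norm x'' \<le> a * (1 + e) * ?n"
      using rel_bound[OF x] by (simp add: algebra_simps)
    have "x' + (\<i> * complex_of_real (- m)) *\<^sub>C x = (x' + v *\<^sub>R x'' + (\<i> * complex_of_real (- m)) *\<^sub>C x) - v *\<^sub>R x''"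
      by simp
    then have "?n \<le> ?N + norm (v *\<^sub>R x'')" by (metis norm_triangle_ineq4)
    also have "norm (v *\<^sub>R x'') \<le> (1 - \<delta>) / a * norm x''" using mult_right_mono[OF v norm_ge_zero[of x'']] by simp
    finally have "a * (1 + e) * ?n \<le> a * (1 + e) * (?N + (1 - \<delta>) / a * norm x'')"
      using a_pos e(1) by (intro mult_left_mono) auto
    also have "\<dots> = a * (1 + e) * ?N + (1 + e) * (1 - \<delta>) * norm x''" using a_pos by (simp add: field_simps)
    finally have "norm x'' \<le> a * (1 + e) * ?N + (1 + e) * (1 - \<delta>) * norm x''" using 1 by simp
    then have "d * norm x'' \<le> a * (1 + e) * ?N" unfolding d_def by (simp add: algebra_simps)
    then show ?thesis unfolding \<kappa>_def using d by (simp add: field_simps)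
  qed
  then have "dominating_shift (- m) \<kappa>" unfolding dominating_shift_def using \<kappa> by blast
  then show ?thesis using \<kappa>2 by blast
qed

definition shifted_norm :: "real \<Rightarrow> real \<Rightarrow> 'h \<Rightarrow> real"
  where "shifted_norm \<mu> v x = norm (op_app (perturbed v) x + (\<i> * complex_of_real \<mu>) *\<^sub>C x)"

lemma shifted_norm_eq:
  assumes "(x, x') \<in> A" "(x, x'') \<in> B"
  shows "shifted_norm \<mu> v x = norm (x' + v *\<^sub>R x'' + (\<i> * complex_of_real \<mu>) *\<^sub>C x)"
proof -
  have "(x, x' + v *\<^sub>R x'') \<in> perturbed v" using assms perturbed_iff by blast
  then show ?thesis unfolding shifted_norm_def using op_app_eq[OF perturbed_linear] by simp
qed

lemma shifted_norm_0: "(x, x') \<in> A \<Longrightarrow> shifted_norm \<mu> 0 x = norm (x' + (\<i> * complex_of_real \<mu>) *\<^sub>C x)"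
  unfolding shifted_norm_def perturbed_0 using op_app_eq[OF skew_adjointD(1)[OF A]] by simp

text \<open>The group generated by \<open>A + v B\<close> is isometric and commutes with its generator.\<close>

lemma shifted_norm_evolution:
  assumes v: "\<bar>v\<bar> * a < 1" and x: "x \<in> Domain A"
  shows "shifted_norm \<mu> v (evolution v \<tau> x) = shifted_norm \<mu> v x"
proof -
  obtain y where y: "(x, y) \<in> perturbed v" using x Domain_perturbed by blast
  note U = unitary_groupD[OF evolution_unitary[OF v]]
  have "op_app (perturbed v) (evolution v \<tau> x) = evolution v \<tau> y" "op_app (perturbed v) x = y"
    using op_app_eq[OF perturbed_linear] evolution_invariant[OF v y] y by auto
  then show ?thesis unfolding shifted_norm_def using U(1)[of \<tau> y] U(2)[of \<tau>] U(3) by metis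
qed

text \<open>The factor that comes out is \<open>1 + \<kappa> \<bar>w - v\<bar>\<close>; the exponential is preferred because the factors of
successive jumps multiply to the exponential of a variation.\<close>

lemma shifted_norm_change:
  assumes sh: "dominating_shift \<mu> \<kappa>" and v: "\<bar>v\<bar> \<le> (1 - \<delta>) / a" and x: "x \<in> Domain A"
  shows "shifted_norm \<mu> w x \<le> exp (\<kappa> * \<bar>w - v\<bar>) * shifted_norm \<mu> v x"
proof -
  obtain x' x'' where x': "(x, x') \<in> A" "(x, x'') \<in> B" using x dom by blast
  let ?N = "norm (x' + v *\<^sub>R x'' + (\<i> * complex_of_real \<mu>) *\<^sub>C x)"
  have "norm x'' \<le> \<kappa> * ?N" using sh v x' unfolding dominating_shift_def by blast
  then have 1: "\<bar>w - v\<bar> * norm x'' \<le> \<bar>w - v\<bar> * (\<kappa> * ?N)" by (intro mult_left_mono) auto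
  have "x' + w *\<^sub>R x'' + (\<i> * complex_of_real \<mu>) *\<^sub>C x
      = (x' + v *\<^sub>R x'' + (\<i> * complex_of_real \<mu>) *\<^sub>C x) + (w - v) *\<^sub>R x''" by (simp add: algebra_simps)
  then have "shifted_norm \<mu> w x \<le> ?N + \<bar>w - v\<bar> * norm x''"
    unfolding shifted_norm_eq[OF x'] by (metis norm_scaleR norm_triangle_ineq)
  also have "\<dots> \<le> (1 + \<kappa> * \<bar>w - v\<bar>) * ?N" using 1 by (simp add: algebra_simps)
  also have "\<dots> \<le> exp (\<kappa> * \<bar>w - v\<bar>) * ?N" by (intro mult_right_mono exp_ge_add_one_self) auto
  finally show ?thesis unfolding shifted_norm_eq[OF x'] .
qed

lemma controls_bound:
  assumes "u \<in> controls \<delta> a"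
  shows "\<bar>u r\<bar> \<le> (1 - \<delta>) / a" "\<bar>u r\<bar> * a < 1"
proof -
  have "- ((1 - \<delta>) / a) < u r" "u r < (1 - \<delta>) / a" using assms unfolding controls_def by auto
  then have *: "\<bar>u r\<bar> < (1 - \<delta>) / a" by linarith
  then show "\<bar>u r\<bar> \<le> (1 - \<delta>) / a" by simp
  have "\<bar>u r\<bar> * a < 1 - \<delta>" using * a_pos by (simp add: pos_less_divide_eq)
  then show "\<bar>u r\<bar> * a < 1" using \<delta> by simp
qed

lemma pc_control_controls: "u \<in> controls \<delta> a \<Longrightarrow> piecewise_constant u \<Longrightarrow> pc_control A B a b u"
  by unfold_locales (use controls_bound in auto)

text \<open>The shifted norm is constant on every interval and changes only at jumps. In the induction, \<open>q\<close> is a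
time at which the control has the value of the latest interval of positive length; increments of
the variation function between such times bound the jumps. Returning from the last value \<open>u q\<close> to
the value \<open>0\<close> costs another factor \<open>exp (\<kappa> \<bar>u q\<bar>)\<close>, and \<open>\<bar>u q\<bar>\<close> is itself bounded by the variation:
this is the factor \<open>2\<close> in the exponent.\<close>

lemma pc_propagator_regularity:
  assumes sh: "dominating_shift \<mu> \<kappa>" and u: "u \<in> controls \<delta> a" "piecewise_constant u"
    and x: "x \<in> Domain A" and t: "0 \<le> t"
  shows "pc_propagator A B u t x \<in> Domain A"
    "shifted_norm \<mu> 0 (pc_propagator A B u t x) \<le> exp (2 * \<kappa> * variation_upto u t) * shifted_norm \<mu> 0 x"
proof -
  interpret pc_control A B a b u by (rule pc_control_controls[OF u])
  interpret bv_control u by (rule bv_control_controls[OF u(1)])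
  have \<kappa>: "\<kappa> \<ge> 0" using sh unfolding dominating_shift_def by simp
  let ?N = "shifted_norm \<mu>"
  have nn: "0 \<le> ?N v y" for v y unfolding shifted_norm_def by simp
  have D: "trajectory x s \<in> Domain A" if "0 \<le> s" for s by (rule trajectory_Domain[OF that x])
  have "\<exists>q. 0 \<le> q \<and> q \<le> t \<and> ?N (u q) (trajectory x t) \<le> exp (\<kappa> * variation_upto u q) * ?N 0 x"
    using t
  proof (induction rule: constancy_induct)
    case start
    show ?case using zero[of 0] variation_upto_nonpos[of 0] by (intro exI[of _ 0]) (simp add: trajectory_0)
  next
    case (step s v \<tau>)
    define y where "y = trajectory x s"
    note v = range_adm[OF step(3)]
    have y: "y \<in> Domain A" unfolding y_def by (rule D[OF step(1)])
    have traj: "trajectory x (s + \<tau>) = evolution v \<tau> y"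
      using trajectory_step[OF step(1,2,3,4), of "s + \<tau>" x] step(2) by (simp add: y_def)
    obtain q where q: "0 \<le> q" "q \<le> s" "?N (u q) y \<le> exp (\<kappa> * variation_upto u q) * ?N 0 x"
      using step(5) unfolding y_def by blast
    have "\<exists>q. 0 \<le> q \<and> q \<le> s + \<tau> \<and> ?N (u q) (evolution v \<tau> y) \<le> exp (\<kappa> * variation_upto u q) * ?N 0 x"
    proof (cases "\<tau> = 0")
      case True
      then show ?thesis using q unitary_groupD(4)[OF evolution_unitary[OF v]] by auto
    next
      case False
      define q1 where "q1 = s + \<tau> / 2"
      have q1: "u q1 = v" "q \<le> q1" "0 \<le> q1" "q1 \<le> s + \<tau>" using step(4)[of q1] step(2) q False by (auto simp: q1_def)
      have "?N v (evolution v \<tau> y) = ?N v y" by (rule shifted_norm_evolution[OF v y])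
      also have "\<dots> \<le> exp (\<kappa> * \<bar>v - u q\<bar>) * ?N (u q) y"
        by (rule shifted_norm_change[OF sh controls_bound(1)[OF u(1)] y])
      also have "\<dots> \<le> exp (\<kappa> * (variation_upto u q1 - variation_upto u q)) * (exp (\<kappa> * variation_upto u q) * ?N 0 x)"
        using variation_upto_increment[OF q1(2)] \<kappa> q(3) nn unfolding q1(1)
        by (intro mult_mono) (auto intro: mult_left_mono)
      also have "\<dots> = exp (\<kappa> * variation_upto u q1) * ?N 0 x"
        by (simp add: exp_add[symmetric] mult.assoc[symmetric] right_diff_distrib)
      finally show ?thesis using q1 by (intro exI[of _ q1]) simp
    qed
    then show ?case unfolding traj .
  qed
  then obtain q where q: "0 \<le> q" "q \<le> t"
    "?N (u q) (trajectory x t) \<le> exp (\<kappa> * variation_upto u q) * ?N 0 x" by blast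
  show "pc_propagator A B u t x \<in> Domain A" using D[OF t] unfolding trajectory_def .
  have "?N 0 (trajectory x t) \<le> exp (\<kappa> * \<bar>0 - u q\<bar>) * ?N (u q) (trajectory x t)"
    by (rule shifted_norm_change[OF sh controls_bound(1)[OF u(1)] D[OF t]])
  also have "\<dots> \<le> exp (\<kappa> * variation_upto u t) * (exp (\<kappa> * variation_upto u t) * ?N 0 x)"
  proof (intro mult_mono)
    show "exp (\<kappa> * \<bar>0 - u q\<bar>) \<le> exp (\<kappa> * variation_upto u t)"
      using abs_le_variation_upto[of q] variation_upto_mono[OF q(2)] \<kappa> by (auto intro!: mult_left_mono)
    have "exp (\<kappa> * variation_upto u q) * ?N 0 x \<le> exp (\<kappa> * variation_upto u t) * ?N 0 x"
      using variation_upto_mono[OF q(2)] \<kappa> nn by (intro mult_right_mono) (auto intro: mult_left_mono)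
    then show "?N (u q) (trajectory x t) \<le> exp (\<kappa> * variation_upto u t) * ?N 0 x" using q(3) by linarith
  qed (auto simp: nn)
  also have "\<dots> = exp (2 * \<kappa> * variation_upto u t) * ?N 0 x"
    by (simp add: exp_add[symmetric] mult.assoc[symmetric])
  finally show "?N 0 (pc_propagator A B u t x) \<le> exp (2 * \<kappa> * variation_upto u t) * ?N 0 x"
    unfolding trajectory_def .
qed

end

section \<open>The propagator of a control of bounded variation\<close>

lemma tendsto_integral_abs_diff:
  assumes us: "\<And>n. us n \<in> controls \<delta> a" and u: "u \<in> controls \<delta> a" and lim: "\<And>t. (\<lambda>n. us n t) \<longlonglongrightarrow> u t"
  shows "(\<lambda>n. integral {0..t} (\<lambda>s. \<bar>us n s - u s\<bar>)) \<longlonglongrightarrow> 0"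
    "(\<lambda>s. \<bar>us n s - u s\<bar>) integrable_on {0..t}"
proof -
  let ?C = "(1 - \<delta>) / a + (1 - \<delta>) / a"
  have bd: "\<bar>us n s - u s\<bar> \<le> ?C" for n s
  proof -
    have "- ((1 - \<delta>) / a) < us n s" "us n s < (1 - \<delta>) / a" "- ((1 - \<delta>) / a) < u s" "u s < (1 - \<delta>) / a"
      using us[of n] u unfolding controls_def by auto
    then show ?thesis by linarith
  qed
  have m: "(\<lambda>s. us n s - u s) \<in> borel_measurable borel" for n
    by (intro borel_measurable_diff bv_control.borel_measurable bv_control_controls[OF us] bv_control_controls[OF u])
  show int: "(\<lambda>s. \<bar>us n s - u s\<bar>) integrable_on {0..t}" for n
    by (rule bounded_measurable_integrable_on[OF borel_measurable_abs[OF m], of _ ?C]) (unfold abs_abs, rule bd)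
  have "(\<lambda>n. integral {0..t} (\<lambda>s. \<bar>us n s - u s\<bar>)) \<longlonglongrightarrow> integral {0..t} (\<lambda>s. 0)"
  proof (rule dominated_convergence(2)[OF int, where h = "\<lambda>_. ?C"])
    show "(\<lambda>_. ?C) integrable_on {0..t}" by (rule integrable_const_ivl)
    show "(\<lambda>n. \<bar>us n s - u s\<bar>) \<longlonglongrightarrow> 0" for s
      using tendsto_rabs_zero[OF LIM_zero[OF lim[of s]]] .
  qed (unfold real_norm_def abs_abs, rule bd)
  then show "(\<lambda>n. integral {0..t} (\<lambda>s. \<bar>us n s - u s\<bar>)) \<longlonglongrightarrow> 0" by simp
qed

context bounded_below_pair
begin

lemma pc_approximationD:
  assumes "pc_approximation \<delta> a T u us"
  shows "us n \<in> controls \<delta> a" "piecewise_constant (us n)" "total_variation 0 T (us n) \<le> total_variation 0 T u"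
    "(\<lambda>n. us n s) \<longlonglongrightarrow> u s"
  using assms unfolding pc_approximation_def by auto

text \<open>The energy estimate for trajectories of the two approximations applies with one constant for all
indices: by the regularity estimate \<open>B\<close> is bounded along the trajectories, and the variations of the
approximations are bounded by that of \<open>u\<close>.\<close>

lemma pc_approximation_distance:
  assumes u: "u \<in> controls \<delta> a" and t: "0 \<le> t" "t \<le> T" "t \<le> T'"
    and us: "pc_approximation \<delta> a T u us" and ws: "pc_approximation \<delta> a T' u ws"
    and x: "x \<in> Domain A"
  shows "\<exists>K\<ge>0. \<forall>n m. (norm (pc_propagator A B (us n) t x - pc_propagator A B (ws m) t x))\<^sup>2
    \<le> K * (integral {0..t} (\<lambda>s. \<bar>us n s - u s\<bar>) + integral {0..t} (\<lambda>s. \<bar>ws m s - u s\<bar>))"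
proof -
  interpret bv_control u by (rule bv_control_controls[OF u])
  obtain \<mu> \<kappa> where sh: "dominating_shift \<mu> \<kappa>" using dominating_shift_exists[of 1] by auto
  then have \<kappa>: "\<kappa> \<ge> 0" unfolding dominating_shift_def by simp
  define \<beta> where "\<beta> = \<kappa> * (exp (2 * \<kappa> * total_variation 0 T' u) * shifted_norm \<mu> 0 x)"
  have nn: "0 \<le> shifted_norm \<mu> v y" for v y unfolding shifted_norm_def by simp
  have \<beta>: "\<beta> \<ge> 0" unfolding \<beta>_def using \<kappa> nn by simp
  have bound: "norm y \<le> \<beta>" if s: "0 \<le> s" "s \<le> t" and y: "(pc_propagator A B (ws m) s x, y) \<in> B" for m s y
  proof -
    let ?p = "pc_propagator A B (ws m) s x"
    note R = pc_propagator_regularity[OF sh pc_approximationD(1,2)[OF ws] x s(1), of m]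
    interpret w: bv_control "ws m" by (rule bv_control_controls[OF pc_approximationD(1)[OF ws]])
    obtain p' where p: "(?p, p') \<in> A" using R(1) by blast
    have "norm y \<le> \<kappa> * norm (p' + 0 *\<^sub>R y + (\<i> * complex_of_real \<mu>) *\<^sub>C ?p)"
    proof -
      have "\<bar>0::real\<bar> \<le> (1 - \<delta>) / a" using \<delta> a_pos by simp
      then show ?thesis using sh p y unfolding dominating_shift_def by blast
    qed
    then have "norm y \<le> \<kappa> * shifted_norm \<mu> 0 ?p" by (simp add: shifted_norm_0[OF p])
    also have "\<dots> \<le> \<kappa> * (exp (2 * \<kappa> * variation_upto (ws m) s) * shifted_norm \<mu> 0 x)"
      using R(2) \<kappa> by (intro mult_left_mono)
    also have "\<dots> \<le> \<beta>"
    proof -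
      have "variation_upto (ws m) s \<le> variation_upto (ws m) T'" using s t by (intro w.variation_upto_mono) simp
      also have "\<dots> \<le> total_variation 0 T' u"
        using pc_approximationD(3)[OF ws, of m] t by (simp add: variation_upto_def)
      finally show ?thesis unfolding \<beta>_def using \<kappa> nn by (intro mult_left_mono mult_right_mono) (auto intro: mult_left_mono)
    qed
    finally show ?thesis .
  qed
  have "(norm (pc_propagator A B (us n) t x - pc_propagator A B (ws m) t x))\<^sup>2
    \<le> (4 * norm x * \<beta>) * (integral {0..t} (\<lambda>s. \<bar>us n s - u s\<bar>) + integral {0..t} (\<lambda>s. \<bar>ws m s - u s\<bar>))" for n m
  proof -
    note I = tendsto_integral_abs_diff(2)[OF pc_approximationD(1)[OF us] u pc_approximationD(4)[OF us], of n t]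
      tendsto_integral_abs_diff(2)[OF pc_approximationD(1)[OF ws] u pc_approximationD(4)[OF ws], of m t]
    have J: "(\<lambda>s. \<bar>us n s - ws m s\<bar>) integrable_on {0..t}"
    proof (rule bounded_measurable_integrable_on[OF borel_measurable_abs[OF borel_measurable_diff]])
      show "us n \<in> borel_measurable borel" "ws m \<in> borel_measurable borel"
        using bv_control.borel_measurable[OF bv_control_controls] pc_approximationD(1) us ws by blast+
      show "\<bar>\<bar>us n s - ws m s\<bar>\<bar> \<le> (1 - \<delta>) / a + (1 - \<delta>) / a" for s
        using controls_bound(1)[OF pc_approximationD(1)[OF us], of n s] controls_bound(1)[OF pc_approximationD(1)[OF ws], of m s] by linarith
    qed
    have "(norm (pc_propagator A B (us n) t x - pc_propagator A B (ws m) t x))\<^sup>2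
        \<le> (4 * norm x * \<beta>) * integral {0..t} (\<lambda>s. \<bar>us n s - ws m s\<bar>)"
      using pc_approximationD(1,2)[OF us] pc_approximationD(1,2)[OF ws] bound
      by (intro pc_propagator_distance pc_control_controls x t J) auto
    also have "\<dots> \<le> (4 * norm x * \<beta>) * integral {0..t} (\<lambda>s. \<bar>us n s - u s\<bar> + \<bar>ws m s - u s\<bar>)"
      using \<beta> by (intro mult_left_mono integral_le J integrable_add I) auto
    also have "integral {0..t} (\<lambda>s. \<bar>us n s - u s\<bar> + \<bar>ws m s - u s\<bar>)
        = integral {0..t} (\<lambda>s. \<bar>us n s - u s\<bar>) + integral {0..t} (\<lambda>s. \<bar>ws m s - u s\<bar>)"
      by (rule integral_add[OF I])
    finally show ?thesis .
  qed
  moreover have "0 \<le> 4 * norm x * \<beta>" using \<beta> by simp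
  ultimately show ?thesis by blast
qed

lemma pc_approximation_isometry:
  assumes "pc_approximation \<delta> a T u us" "0 \<le> t"
  shows "norm (pc_propagator A B (us n) t x) = norm x"
    "pc_propagator A B (us n) t (x - y) = pc_propagator A B (us n) t x - pc_propagator A B (us n) t y"
proof -
  interpret pc_control A B a b "us n" by (rule pc_control_controls[OF pc_approximationD(1,2)[OF assms(1)]])
  show "norm (pc_propagator A B (us n) t x) = norm x"
    "pc_propagator A B (us n) t (x - y) = pc_propagator A B (us n) t x - pc_propagator A B (us n) t y"
    using trajectory_isometry[OF assms(2)] unfolding trajectory_def by auto
qed

lemma pc_approximations_close:
  assumes u: "u \<in> controls \<delta> a" and t: "0 \<le> t" "t \<le> T" "t \<le> T'"
    and us: "pc_approximation \<delta> a T u us" and ws: "pc_approximation \<delta> a T' u ws"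
    and e: "e > 0"
  shows "\<exists>N. \<forall>n\<ge>N. \<forall>m\<ge>N. norm (pc_propagator A B (us n) t x - pc_propagator A B (ws m) t x) < e"
proof -
  define U where "U n = pc_propagator A B (us n) t" for n
  define W where "W n = pc_propagator A B (ws n) t" for n
  define I where "I vs n = integral {0..t} (\<lambda>s. \<bar>vs n s - u s\<bar>)" for vs :: "nat \<Rightarrow> real \<Rightarrow> real" and n
  note iso = pc_approximation_isometry[OF us t(1), folded U_def] pc_approximation_isometry[OF ws t(1), folded W_def]
  have "x \<in> closure (Domain A)" using skew_adjointD(2)[OF A] by simp
  then obtain y where y: "y \<in> Domain A" "dist y x < e / 3"
    unfolding closure_approachable using e by (meson divide_pos_pos zero_less_numeral)
  then have yx: "norm (x - y) < e / 3" by (simp add: dist_norm norm_minus_commute)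
  obtain K where K: "K \<ge> 0" "\<And>n m. (norm (U n y - W m y))\<^sup>2
    \<le> K * (I us n + I ws m)"
    using pc_approximation_distance[OF u t us ws y(1)] unfolding U_def W_def I_def by blast
  define r where "r = (e / 3)\<^sup>2 / (2 * (K + 1))"
  have r: "r > 0" unfolding r_def using e K(1) by simp
  have "\<forall>\<^sub>F n in sequentially. I us n < r"
    using order_tendstoD(2)[OF tendsto_integral_abs_diff(1)[OF pc_approximationD(1)[OF us] u pc_approximationD(4)[OF us]] r]
    unfolding I_def .
  then obtain N1 where N1: "\<And>n. n \<ge> N1 \<Longrightarrow> I us n < r"
    unfolding eventually_sequentially by blast
  have "\<forall>\<^sub>F n in sequentially. I ws n < r"
    using order_tendstoD(2)[OF tendsto_integral_abs_diff(1)[OF pc_approximationD(1)[OF ws] u pc_approximationD(4)[OF ws]] r]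
    unfolding I_def .
  then obtain N2 where N2: "\<And>n. n \<ge> N2 \<Longrightarrow> I ws n < r"
    unfolding eventually_sequentially by blast
  have "norm (U n x - W m x) < e"
    if n: "n \<ge> max N1 N2" "m \<ge> max N1 N2" for n m
  proof -
    have "I us n + I ws m \<le> 2 * r"
      using N1[of n] N2[of m] n by simp
    then have "K * (I us n + I ws m) \<le> K * (2 * r)"
      using K(1) by (rule mult_left_mono)
    also have "\<dots> < (K + 1) * (2 * r)" using r by (simp add: algebra_simps)
    also have "(K + 1) * (2 * r) = r * (2 * (K + 1))" by simp
    also have "\<dots> = (e / 3)\<^sup>2"
      unfolding r_def by (subst times_divide_eq_left, rule nonzero_mult_div_cancel_right) (use K(1) in simp)
    finally have "(norm (U n y - W m y))\<^sup>2 < (e / 3)\<^sup>2"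
      using K(2)[of n m] by linarith
    then have 1: "norm (U n y - W m y) < e / 3"
      by (rule power_less_imp_less_base) (use e in simp)
    have eq: "U n x - W m x
        = (U n (x - y) - W m (x - y))
          + (U n y - W m y)"
      by (simp add: iso)
    have "norm (U n (x - y) - W m (x - y)) \<le> 2 * norm (x - y)"
      using norm_triangle_ineq4[of "U n (x - y)" "W m (x - y)"]
      by (simp add: iso(1,3))
    then show ?thesis
      unfolding eq using 1 yx
        norm_triangle_ineq[of "U n (x - y) - W m (x - y)"
          "U n y - W m y"] by linarith
  qed
  then show ?thesis unfolding U_def W_def by blast
qed

text \<open>Closeness of a sequence to itself is the Cauchy property, closeness of two sequences is the
independence of the limit, and the existence of one sequence makes the limit unique.\<close>

theorem propagator_tendsto:
  assumes u: "u \<in> controls \<delta> a" and t: "0 \<le> t" "t \<le> T" and us: "pc_approximation \<delta> a T u us"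
  shows "(\<lambda>n. pc_propagator A B (us n) t x) \<longlonglongrightarrow> propagator \<delta> a A B u t x"
proof -
  obtain ws where ws: "pc_approximation \<delta> a t u ws" using pc_approximation_exists[OF u t(1)] by blast
  have "Cauchy (\<lambda>n. pc_propagator A B (ws n) t x)"
    unfolding Cauchy_def dist_norm
    using pc_approximations_close[OF u t(1) order_refl order_refl ws ws] by blast
  then obtain \<phi> where \<phi>: "(\<lambda>n. pc_propagator A B (ws n) t x) \<longlonglongrightarrow> \<phi>"
    using Cauchy_convergent_iff convergent_def by blast
  have lim: "(\<lambda>n. pc_propagator A B (vs n) t x) \<longlonglongrightarrow> \<phi>" if "t \<le> S" "pc_approximation \<delta> a S u vs" for S vs
  proof -
    have "(\<lambda>n. pc_propagator A B (vs n) t x - pc_propagator A B (ws n) t x) \<longlonglongrightarrow> 0"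
    proof (rule LIMSEQ_I)
      fix e :: real assume "e > 0"
      from pc_approximations_close[OF u t(1) that(1) order_refl that(2) ws this, of x]
      show "\<exists>N. \<forall>n\<ge>N. norm (pc_propagator A B (vs n) t x - pc_propagator A B (ws n) t x - 0) < e"
        unfolding diff_zero by blast
    qed
    from tendsto_add[OF this \<phi>] show ?thesis by simp
  qed
  have "propagator \<delta> a A B u t x = \<phi>"
    unfolding propagator_def
  proof (rule the_equality)
    show "\<forall>T\<ge>t. \<forall>us. pc_approximation \<delta> a T u us \<longrightarrow> (\<lambda>n. pc_propagator A B (us n) t x) \<longlonglongrightarrow> \<phi>"
      using lim by blast
    fix \<rho> assume "\<forall>T\<ge>t. \<forall>us. pc_approximation \<delta> a T u us \<longrightarrow> (\<lambda>n. pc_propagator A B (us n) t x) \<longlonglongrightarrow> \<rho>"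
    then have "(\<lambda>n. pc_propagator A B (ws n) t x) \<longlonglongrightarrow> \<rho>" using ws by blast
    then show "\<rho> = \<phi>" using \<phi> LIMSEQ_unique by blast
  qed
  then show ?thesis using lim[OF t(2) us] by simp
qed

lemma propagator_isometry:
  assumes u: "u \<in> controls \<delta> a" and t: "0 \<le> t"
  shows "norm (propagator \<delta> a A B u t x) = norm x"
    "propagator \<delta> a A B u t (x - y) = propagator \<delta> a A B u t x - propagator \<delta> a A B u t y"
proof -
  obtain us where us: "pc_approximation \<delta> a t u us" using pc_approximation_exists[OF u t] by blast
  note lim = propagator_tendsto[OF u t order_refl us]
  show "norm (propagator \<delta> a A B u t x) = norm x"
    using tendsto_norm[OF lim[of x]] by (simp add: pc_approximation_isometry[OF us t] LIMSEQ_const_iff)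
  show "propagator \<delta> a A B u t (x - y) = propagator \<delta> a A B u t x - propagator \<delta> a A B u t y"
    using tendsto_diff[OF lim[of x] lim[of y]] lim[of "x - y"]
    by (simp add: pc_approximation_isometry[OF us t] LIMSEQ_unique)
qed

text \<open>The graph of \<open>A + \<i> \<mu>\<close> is convex and closed. Convex combinations of late pairs
\<open>(\<phi> n, (A + \<i> \<mu>) (\<phi> n))\<close> with convergent second components still have first components tending to
\<open>x\<close>, so the limit pair is in the graph.\<close>

lemma shifted_norm_lower_semicontinuous:
  assumes D: "\<And>n. \<phi> n \<in> Domain A" and bound: "\<And>n. shifted_norm \<mu> 0 (\<phi> n) \<le> C" and lim: "\<phi> \<longlonglongrightarrow> x"
  shows "x \<in> Domain A" "shifted_norm \<mu> 0 x \<le> C"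
proof -
  note L = linear_operatorD[OF skew_adjointD(1)[OF A]]
  let ?i = "\<lambda>y. (\<i> * complex_of_real \<mu>) *\<^sub>C (y::'h)"
  have "\<exists>z. \<forall>n. (\<phi> n, z n - ?i (\<phi> n)) \<in> A \<and> norm (z n) \<le> C"
  proof (intro choice allI)
    fix n
    obtain p where p: "(\<phi> n, p) \<in> A" using D by blast
    then show "\<exists>z. (\<phi> n, z - ?i (\<phi> n)) \<in> A \<and> norm z \<le> C"
      using bound[of n] by (intro exI[of _ "p + ?i (\<phi> n)"]) (simp add: shifted_norm_0[OF p])
  qed
  then obtain z where z: "\<And>n. (\<phi> n, z n - ?i (\<phi> n)) \<in> A" "\<And>n. norm (z n) \<le> C" by blast
  obtain y l where y: "\<And>n. y n \<in> convex hull (z ` {n..})" "y \<longlonglongrightarrow> l"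
    using convex_combinations_converge[of z C, OF z(2)] by blast
  \<comment> \<open>Taking hulls of pairs ensures that both components are combined with the same weights.\<close>
  define H where "H n = convex hull ((\<lambda>m. (\<phi> m, z m)) ` {n..})" for n
  have "z ` {n..} = snd ` ((\<lambda>m. (\<phi> m, z m)) ` {n..})" "\<phi> ` {n..} = fst ` ((\<lambda>m. (\<phi> m, z m)) ` {n..})" for n
    by (auto simp: image_image)
  then have H: "snd ` H n = convex hull (z ` {n..})" "fst ` H n = convex hull (\<phi> ` {n..})" for n
    unfolding H_def by (simp_all add: convex_hull_linear_image linear_snd linear_fst)
  have "\<exists>w. (w, y n) \<in> H n" for n using y(1)[of n] unfolding H(1)[symmetric] by force
  then obtain w where w: "\<And>n. (w n, y n) \<in> H n" by metis
  have "convex {(p, q). (p, q - ?i p) \<in> A}"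
  proof (rule convexI)
    fix P Q :: "'h \<times> 'h" and s t :: real
    assume "P \<in> {(p, q). (p, q - ?i p) \<in> A}" "Q \<in> {(p, q). (p, q - ?i p) \<in> A}"
    then obtain p q p' q' where PQ: "P = (p, q)" "Q = (p', q')"
      and *: "(p, q - ?i p) \<in> A" "(p', q' - ?i p') \<in> A" by blast
    have "(s *\<^sub>R p + t *\<^sub>R p', s *\<^sub>R (q - ?i p) + t *\<^sub>R (q' - ?i p')) \<in> A"
      using L(3)[OF L(5)[OF *(1)] L(5)[OF *(2)]] .
    moreover have "s *\<^sub>R (q - ?i p) + t *\<^sub>R (q' - ?i p') = s *\<^sub>R q + t *\<^sub>R q' - ?i (s *\<^sub>R p + t *\<^sub>R p')"
      by (simp add: scaleC_add_right scaleC_scaleR scaleR_diff_right)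
    ultimately show "s *\<^sub>R P + t *\<^sub>R Q \<in> {(p, q). (p, q - ?i p) \<in> A}" by (simp add: PQ)
  qed
  then have "H n \<subseteq> {(p, q). (p, q - ?i p) \<in> A}" for n
    unfolding H_def using z(1) by (intro hull_minimal) auto
  then have inA: "(w n, y n - ?i (w n)) \<in> A" for n using w[of n] by auto
  have wlim: "w \<longlonglongrightarrow> x"
  proof (rule LIMSEQ_I)
    fix e :: real assume e: "e > 0"
    obtain N where N: "\<And>n. n \<ge> N \<Longrightarrow> norm (\<phi> n - x) < e" using LIMSEQ_D[OF lim e] by blast
    have "norm (w n - x) < e" if n: "n \<ge> N" for n
    proof -
      have "convex hull (\<phi> ` {n..}) \<subseteq> ball x e"
        using N n by (intro hull_minimal) (auto simp: dist_norm norm_minus_commute)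
      moreover have "w n \<in> convex hull (\<phi> ` {n..})" using w[of n] unfolding H(2)[symmetric] by force
      ultimately show ?thesis by (auto simp: dist_norm norm_minus_commute)
    qed
    then show "\<exists>N. \<forall>n\<ge>N. norm (w n - x) < e" by blast
  qed
  have "(\<lambda>n. y n - ?i (w n)) \<longlonglongrightarrow> l - ?i x"
    by (intro tendsto_diff y(2) bounded_linear.tendsto[OF bounded_linear_scaleC] wlim)
  from skew_adjoint_closed[OF A inA wlim this] have x: "(x, l - ?i x) \<in> A" .
  then show "x \<in> Domain A" by blast
  have "norm (y n) \<le> C" for n
  proof -
    have "convex hull (z ` {n..}) \<subseteq> cball 0 C" using z(2) by (intro hull_minimal) auto
    then show ?thesis using y(1)[of n] by auto
  qed
  then have "norm l \<le> C" using Lim_norm_ubound[OF _ y(2)] by auto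
  then show "shifted_norm \<mu> 0 x \<le> C" by (simp add: shifted_norm_0[OF x])
qed

theorem propagator_regularity:
  assumes sh: "dominating_shift \<mu> \<kappa>" and u: "u \<in> controls \<delta> a" and x: "x \<in> Domain A" and t: "0 \<le> t"
  shows "propagator \<delta> a A B u t x \<in> Domain A"
    "shifted_norm \<mu> 0 (propagator \<delta> a A B u t x) \<le> exp (2 * \<kappa> * total_variation 0 t u) * shifted_norm \<mu> 0 x"
proof -
  have \<kappa>: "\<kappa> \<ge> 0" using sh unfolding dominating_shift_def by simp
  obtain us where us: "pc_approximation \<delta> a t u us" using pc_approximation_exists[OF u t] by blast
  note R = pc_propagator_regularity[OF sh pc_approximationD(1,2)[OF us] x t]
  have b: "shifted_norm \<mu> 0 (pc_propagator A B (us n) t x) \<le> exp (2 * \<kappa> * total_variation 0 t u) * shifted_norm \<mu> 0 x" for n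
  proof -
    have "2 * \<kappa> * variation_upto (us n) t \<le> 2 * \<kappa> * total_variation 0 t u"
      using pc_approximationD(3)[OF us, of n] t \<kappa> by (auto simp: variation_upto_def intro: mult_left_mono)
    then have "exp (2 * \<kappa> * variation_upto (us n) t) * shifted_norm \<mu> 0 x \<le> exp (2 * \<kappa> * total_variation 0 t u) * shifted_norm \<mu> 0 x"
      by (intro mult_right_mono) (auto simp: shifted_norm_def)
    then show ?thesis using R(2)[of n] by linarith
  qed
  show "propagator \<delta> a A B u t x \<in> Domain A"
    "shifted_norm \<mu> 0 (propagator \<delta> a A B u t x) \<le> exp (2 * \<kappa> * total_variation 0 t u) * shifted_norm \<mu> 0 x"
    using shifted_norm_lower_semicontinuous[OF R(1) b propagator_tendsto[OF u t order_refl us]] by auto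
qed

text \<open>The propagator is linear, so a bound in the graph norm is enough; the graph norms of \<open>A\<close> and of the
shifted operator are equivalent.\<close>

lemma propagator_graph_norm_continuous:
  assumes u: "u \<in> controls \<delta> a" and t: "0 \<le> t"
  shows "graph_norm_continuous_on A (Domain A) (propagator \<delta> a A B u t)"
proof -
  let ?U = "propagator \<delta> a A B u t"
  obtain \<mu> \<kappa> where sh: "dominating_shift \<mu> \<kappa>" using dominating_shift_exists[of 1] by auto
  define E where "E = exp (2 * \<kappa> * total_variation 0 t u)"
  define C where "C = 1 + E + (1 + E) * \<bar>\<mu>\<bar>"
  have "E > 0" by (simp add: E_def)
  then have C: "C > 0" unfolding C_def by (intro add_pos_nonneg) auto
  have key: "graph_norm A (?U z) \<le> C * graph_norm A z" if z: "z \<in> Domain A" for z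
  proof -
    obtain z' where z': "(z, z') \<in> A" using z by blast
    obtain w where w: "(?U z, w) \<in> A" using propagator_regularity(1)[OF sh u z t] by blast
    have app: "op_app A z = z'" "op_app A (?U z) = w" using op_app_eq[OF skew_adjointD(1)[OF A]] z' w by auto
    have nU: "norm (?U z) = norm z" by (rule propagator_isometry[OF u t])
    have nI: "norm ((\<i> * complex_of_real \<mu>) *\<^sub>C y) = \<bar>\<mu>\<bar> * norm y" for y :: 'h
      by (simp add: norm_scaleC norm_mult)
    have "norm w \<le> norm (w + (\<i> * complex_of_real \<mu>) *\<^sub>C ?U z) + \<bar>\<mu>\<bar> * norm z"
      using norm_triangle_ineq4[of "w + (\<i> * complex_of_real \<mu>) *\<^sub>C ?U z" "(\<i> * complex_of_real \<mu>) *\<^sub>C ?U z"]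
      by (simp add: nI nU)
    also have "norm (w + (\<i> * complex_of_real \<mu>) *\<^sub>C ?U z) \<le> E * norm (z' + (\<i> * complex_of_real \<mu>) *\<^sub>C z)"
      using propagator_regularity(2)[OF sh u z t] by (simp add: shifted_norm_0[OF z'] shifted_norm_0[OF w] E_def)
    also have "\<dots> \<le> E * (norm z' + \<bar>\<mu>\<bar> * norm z)"
      using norm_triangle_ineq[of z' "(\<i> * complex_of_real \<mu>) *\<^sub>C z"] \<open>E > 0\<close> by (simp add: nI)
    finally have "graph_norm A (?U z) \<le> norm z + E * norm z' + (1 + E) * \<bar>\<mu>\<bar> * norm z"
      unfolding graph_norm_def app nU by (simp add: algebra_simps)
    also have "\<dots> \<le> C * (norm z + norm z')"
      unfolding C_def using \<open>E > 0\<close> by (simp add: algebra_simps add_increasing)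
    finally show ?thesis unfolding graph_norm_def app by simp
  qed
  show ?thesis
    unfolding graph_norm_continuous_on_def
  proof (intro ballI allI impI)
    fix x and e :: real assume x: "x \<in> Domain A" and e: "e > 0"
    have "graph_norm A (?U y - ?U x) < e" if y: "y \<in> Domain A" and d: "graph_norm A (y - x) < e / C" for y
    proof -
      have "y - x \<in> Domain A" using x y linear_operatorD(7)[OF skew_adjointD(1)[OF A]] by blast
      then have "graph_norm A (?U (y - x)) \<le> C * graph_norm A (y - x)" by (rule key)
      also have "\<dots> < e" using d C by (simp add: pos_less_divide_eq mult.commute)
      finally show ?thesis by (simp add: propagator_isometry[OF u t])
    qed
    then show "\<exists>d>0. \<forall>y\<in>Domain A. graph_norm A (y - x) < d \<longrightarrow> graph_norm A (?U y - ?U x) < e"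
      using e C by (intro exI[of _ "e / C"]) auto
  qed
qed

end

section \<open>Square roots of bounded operators\<close>

context
  fixes X :: "'h::chilbert_space \<Rightarrow> 'h"
  assumes X: "bounded_linear X" and X_norm: "\<And>x. norm (X x) \<le> norm x"
    and X_sym: "\<And>x y. rinner (X x) y = rinner x (X y)"
begin

interpretation X: bounded_linear X by (rule X)

text \<open>The fixed points \<open>Y\<close> of \<open>Y \<mapsto> (X + Y\<^sup>2) / 2\<close> are those for which \<open>1 - Y\<close> is a square root of \<open>1 - X\<close>.\<close>

fun sqrt_iter :: "nat \<Rightarrow> 'h \<Rightarrow> 'h" where
  "sqrt_iter 0 x = 0"
| "sqrt_iter (Suc k) x = (1/2) *\<^sub>R (X x + sqrt_iter k (sqrt_iter k x))"

text \<open>The same iteration for the number \<open>1\<close> in place of \<open>X\<close>. It dominates the norms of the operators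
\<open>sqrt_iter k\<close> and of their increments, so that the convergence of a bounded increasing sequence of
real numbers implies the convergence of the operators.\<close>

fun sqrt_majorant :: "nat \<Rightarrow> real" where
  "sqrt_majorant 0 = 0"
| "sqrt_majorant (Suc k) = (1 + (sqrt_majorant k)\<^sup>2) / 2"

lemma sqrt_majorant_bounds: "0 \<le> sqrt_majorant k" "sqrt_majorant k \<le> 1"
proof (induction k)
  case (Suc k)
  { case 1 show ?case by simp }
  { case 2 show ?case using Suc power_le_one[of "sqrt_majorant k" 2] by simp }
qed simp_all

lemma sqrt_majorant_incseq: "incseq sqrt_majorant"
proof (rule incseq_SucI)
  fix k
  have "0 \<le> (1 - sqrt_majorant k)\<^sup>2" by simp
  then show "sqrt_majorant k \<le> sqrt_majorant (Suc k)" by (simp add: power2_eq_square algebra_simps)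
qed

lemma sqrt_iter_linear: "linear (sqrt_iter k)"
proof (induction k)
  case 0 then show ?case by (simp add: linear_iff)
next
  case (Suc k)
  interpret Y: linear "sqrt_iter k" by (rule Suc)
  show ?case by (rule linearI) (simp_all add: X.add X.scaleR Y.add Y.scaleR algebra_simps)
qed

lemma sqrt_iter_norm: "norm (sqrt_iter k x) \<le> sqrt_majorant k * norm x"
proof (induction k arbitrary: x)
  case (Suc k)
  have "norm (sqrt_iter k (sqrt_iter k x)) \<le> sqrt_majorant k * (sqrt_majorant k * norm x)"
    using Suc[of "sqrt_iter k x"] mult_left_mono[OF Suc[of x] sqrt_majorant_bounds(1)[of k]] by linarith
  then have "norm (X x + sqrt_iter k (sqrt_iter k x)) \<le> norm x + sqrt_majorant k * (sqrt_majorant k * norm x)"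
    using norm_triangle_ineq[of "X x" "sqrt_iter k (sqrt_iter k x)"] X_norm[of x] by linarith
  then have "norm (X x + sqrt_iter k (sqrt_iter k x)) / 2 \<le> (norm x + sqrt_majorant k * (sqrt_majorant k * norm x)) / 2"
    by (rule divide_right_mono) simp
  moreover have "norm (sqrt_iter (Suc k) x) = norm (X x + sqrt_iter k (sqrt_iter k x)) / 2"
    unfolding sqrt_iter.simps(2) norm_scaleR by simp
  moreover have "sqrt_majorant (Suc k) * norm x = (norm x + sqrt_majorant k * (sqrt_majorant k * norm x)) / 2"
    by (simp add: power2_eq_square algebra_simps)
  ultimately show ?case by (simp only:)
qed simp

lemma sqrt_iter_sym: "rinner (sqrt_iter k x) y = rinner x (sqrt_iter k y)"
  by (induction k arbitrary: x y) (simp_all add: rinner_simps X_sym)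

lemma sqrt_iter_commutes:
  assumes P: "linear P" and c: "\<And>x. P (X x) = X (P x)"
  shows "P (sqrt_iter k x) = sqrt_iter k (P x)"
proof -
  interpret P: linear P by (rule P)
  show ?thesis by (induction k arbitrary: x) (simp_all add: P.zero P.scaleR P.add c)
qed

lemma sqrt_iter_commute: "sqrt_iter j (sqrt_iter k x) = sqrt_iter k (sqrt_iter j x)"
proof -
  have "sqrt_iter j (X x) = X (sqrt_iter j x)" for x
    using sqrt_iter_commutes[OF bounded_linear.linear[OF X], of j x] by simp
  then show ?thesis by (rule sqrt_iter_commutes[OF sqrt_iter_linear])
qed

lemma sqrt_iter_step:
  "norm (sqrt_iter (Suc k) x - sqrt_iter k x) \<le> (sqrt_majorant (Suc k) - sqrt_majorant k) * norm x"
proof (induction k arbitrary: x)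
  case 0 then show ?case using X_norm[of x] by simp
next
  case (Suc k)
  interpret Y: linear "sqrt_iter k" by (rule sqrt_iter_linear)
  interpret Z: linear "sqrt_iter (Suc k)" by (rule sqrt_iter_linear)
  define Y where "Y = sqrt_iter k"
  define Z where "Z = sqrt_iter (Suc k)"
  define y where "y = sqrt_majorant k"
  define z where "z = sqrt_majorant (Suc k)"
  have IH: "norm (Z x - Y x) \<le> (z - y) * norm x" for x unfolding Y_def Z_def y_def z_def by (rule Suc)
  have ZZ: "sqrt_iter (Suc (Suc k)) x = (1/2) *\<^sub>R (X x + Z (Z x))" unfolding Z_def by (rule sqrt_iter.simps(2))
  have YY: "sqrt_iter (Suc k) x = (1/2) *\<^sub>R (X x + Y (Y x))" unfolding Y_def by (rule sqrt_iter.simps(2))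
  have "sqrt_iter (Suc (Suc k)) x - sqrt_iter (Suc k) x = (1/2) *\<^sub>R (Z (Z x) - Y (Y x))"
    unfolding ZZ YY scaleR_diff_right[symmetric] by simp
  also have "Z (Z x) - Y (Y x) = Z (Z x + Y x) - Y (Z x + Y x)"
    using sqrt_iter_commute[of "Suc k" k x] unfolding Y_def[symmetric] Z_def[symmetric]
    by (simp add: Y.add[folded Y_def] Z.add[folded Z_def])
  finally have "norm (sqrt_iter (Suc (Suc k)) x - sqrt_iter (Suc k) x) = norm (Z (Z x + Y x) - Y (Z x + Y x)) / 2"
    by simp
  also have "\<dots> \<le> (z - y) * norm (Z x + Y x) / 2" using IH by simp
  also have "\<dots> \<le> (z - y) * ((z + y) * norm x) / 2"
  proof -
    have "norm (Z x + Y x) \<le> (z + y) * norm x"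
      using norm_triangle_ineq[of "Z x" "Y x"] sqrt_iter_norm[of "Suc k" x] sqrt_iter_norm[of k x]
      unfolding Y_def[symmetric] Z_def[symmetric] y_def[symmetric] z_def[symmetric] by (simp add: algebra_simps)
    moreover have "0 \<le> z - y" using sqrt_majorant_incseq unfolding z_def y_def incseq_Suc_iff by simp
    ultimately show ?thesis by (intro divide_right_mono mult_left_mono) auto
  qed
  also have "\<dots> = (sqrt_majorant (Suc (Suc k)) - sqrt_majorant (Suc k)) * norm x"
    unfolding sqrt_majorant.simps(2)[of "Suc k"] z_def[symmetric] sqrt_majorant.simps(2)[of k, folded y_def z_def]
    unfolding z_def y_def by (simp add: power2_eq_square field_simps)
  finally show ?case .
qed

lemma sqrt_iter_diff:
  assumes "n \<le> m"
  shows "norm (sqrt_iter m x - sqrt_iter n x) \<le> (sqrt_majorant m - sqrt_majorant n) * norm x"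
  using assms
proof (induction m rule: dec_induct)
  case (step m)
  have "norm (sqrt_iter (Suc m) x - sqrt_iter n x) \<le> norm (sqrt_iter (Suc m) x - sqrt_iter m x) + norm (sqrt_iter m x - sqrt_iter n x)"
    unfolding dist_norm[symmetric] by (rule dist_triangle)
  then show ?case using step.IH sqrt_iter_step[of m x] by (simp add: left_diff_distrib del: sqrt_iter.simps sqrt_majorant.simps)
qed simp

lemma sqrt_iter_convergent: "convergent (\<lambda>k. sqrt_iter k x)"
proof -
  have "convergent sqrt_majorant"
    using incseq_convergent[OF sqrt_majorant_incseq, of 1] sqrt_majorant_bounds(2) by (metis convergentI)
  then have C: "Cauchy sqrt_majorant" by (rule convergent_Cauchy)
  have "Cauchy (\<lambda>k. sqrt_iter k x)"
  proof (rule metric_CauchyI)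
    fix e :: real assume e: "e > 0"
    define d where "d = e / (norm x + 1)"
    have pos: "norm x + 1 > 0" by (intro add_nonneg_pos) auto
    then have d: "d > 0" unfolding d_def using e by simp
    obtain N where N: "\<And>m n. m \<ge> N \<Longrightarrow> n \<ge> N \<Longrightarrow> dist (sqrt_majorant m) (sqrt_majorant n) < d"
      using metric_CauchyD[OF C d] by blast
    have *: "dist (sqrt_iter m x) (sqrt_iter n x) < e" if "n \<ge> N" "n \<le> m" for m n
    proof -
      have "sqrt_majorant m - sqrt_majorant n \<le> d" using N[of m n] that unfolding dist_real_def by simp
      then have "(sqrt_majorant m - sqrt_majorant n) * norm x \<le> d * norm x" by (intro mult_right_mono) auto
      also have "\<dots> < d * (norm x + 1)" using d by simp
      also have "\<dots> = e" unfolding d_def using pos by simp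
      finally show ?thesis using sqrt_iter_diff[OF that(2), of x] unfolding dist_norm by linarith
    qed
    show "\<exists>M. \<forall>m\<ge>M. \<forall>n\<ge>M. dist (sqrt_iter m x) (sqrt_iter n x) < e"
      by (rule exI[of _ N]) (metis * dist_commute nle_le)
  qed
  then show ?thesis by (simp add: Cauchy_convergent_iff)
qed

text \<open>The bound on \<open>1 - S\<close> expresses that \<open>S\<close> is positive with norm at most \<open>2\<close>, and it is the hypothesis
needed to take the square root of \<open>S\<close> in turn.\<close>

lemma bounded_sqrt_exists:
  "\<exists>S. bounded_linear S \<and> (\<forall>x y. rinner (S x) y = rinner x (S y)) \<and> (\<forall>x. S (S x) = x - X x) \<and>
    (\<forall>x. norm (x - S x) \<le> norm x) \<and>
    (\<forall>P. bounded_linear P \<and> (\<forall>x. P (X x) = X (P x)) \<longrightarrow> (\<forall>x. P (S x) = S (P x)))"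
proof -
  obtain Y where Y: "\<And>x. (\<lambda>k. sqrt_iter k x) \<longlonglongrightarrow> Y x"
    using sqrt_iter_convergent unfolding convergent_def by metis
  have add: "Y (x + y) = Y x + Y y" for x y
    using tendsto_add[OF Y[of x] Y[of y]] Y[of "x + y"] LIMSEQ_unique
    by (fastforce simp: linear_add[OF sqrt_iter_linear])
  have scale: "Y (r *\<^sub>R x) = r *\<^sub>R Y x" for r x
    using tendsto_scaleR[OF tendsto_const Y[of x], of r] Y[of "r *\<^sub>R x"] LIMSEQ_unique
    by (fastforce simp: linear_scale[OF sqrt_iter_linear])
  have norm1: "norm (sqrt_iter k x) \<le> norm x" for k x
    using sqrt_iter_norm[of k x] mult_right_mono[OF sqrt_majorant_bounds(2)[of k] norm_ge_zero[of x]] by simp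
  have norm: "norm (Y x) \<le> norm x" for x
    by (rule Lim_norm_ubound[OF _ Y]) (auto simp: norm1)
  have bl: "bounded_linear Y"
    by (rule bounded_linear_intro[of _ 1]) (simp_all add: add scale norm)
  have sym: "rinner (Y x) y = rinner x (Y y)" for x y
  proof -
    have "(\<lambda>k. rinner (sqrt_iter k x) y) \<longlonglongrightarrow> rinner (Y x) y" "(\<lambda>k. rinner x (sqrt_iter k y)) \<longlonglongrightarrow> rinner x (Y y)"
      by (intro bounded_bilinear.tendsto[OF bounded_bilinear_rinner] tendsto_const Y)+
    then show ?thesis using LIMSEQ_unique by (simp add: sqrt_iter_sym)
  qed
  have sq: "Y (Y x) = 2 *\<^sub>R Y x - X x" for x
  proof -
    have "(\<lambda>k. sqrt_iter k (sqrt_iter k x - Y x)) \<longlonglongrightarrow> 0"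
      by (rule Lim_null_comparison[OF always_eventually[OF allI[OF norm1]]])
        (use tendsto_norm_zero[OF LIM_zero[OF Y[of x]]] in simp)
    from tendsto_add[OF this Y[of "Y x"]] have "(\<lambda>k. sqrt_iter k (sqrt_iter k x)) \<longlonglongrightarrow> Y (Y x)"
      by (simp add: linear_diff[OF sqrt_iter_linear])
    then have "(\<lambda>k. (1/2) *\<^sub>R (X x + sqrt_iter k (sqrt_iter k x))) \<longlonglongrightarrow> (1/2) *\<^sub>R (X x + Y (Y x))"
      by (intro tendsto_intros)
    then have "(\<lambda>k. sqrt_iter (Suc k) x) \<longlonglongrightarrow> (1/2) *\<^sub>R (X x + Y (Y x))" by simp
    then have "Y x = (1/2) *\<^sub>R (X x + Y (Y x))" using LIMSEQ_Suc[OF Y[of x]] LIMSEQ_unique by blast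
    then have "2 *\<^sub>R Y x = X x + Y (Y x)" by (metis scaleR_scaleR scaleR_one nonzero_mult_div_cancel_left times_divide_eq_right zero_neq_numeral)
    then show ?thesis by simp
  qed
  have com: "P (Y x) = Y (P x)" if P: "bounded_linear P" "\<And>x. P (X x) = X (P x)" for P x
  proof -
    have "(\<lambda>k. P (sqrt_iter k x)) \<longlonglongrightarrow> P (Y x)" by (rule bounded_linear.tendsto[OF P(1) Y])
    then have "(\<lambda>k. sqrt_iter k (P x)) \<longlonglongrightarrow> P (Y x)"
      using sqrt_iter_commutes[OF bounded_linear.linear[OF P(1)] P(2)] by simp
    then show ?thesis using Y LIMSEQ_unique by blast
  qed
  define S where "S x = x - Y x" for x
  have "bounded_linear S" unfolding S_def by (intro bounded_linear_sub bounded_linear_ident bl)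
  moreover have "rinner (S x) y = rinner x (S y)" for x y by (simp add: S_def rinner_simps sym)
  moreover have "S (S x) = x - X x" for x
    using sq[of x] by (simp add: S_def linear_diff[OF bounded_linear.linear[OF bl]] scaleR_2)
  moreover have "norm (x - S x) \<le> norm x" for x by (simp add: S_def norm)
  moreover have "P (S x) = S (P x)" if "bounded_linear P" "\<And>x. P (X x) = X (P x)" for P x
    using com[OF that] linear_diff[OF bounded_linear.linear[OF that(1)]] by (simp add: S_def)
  ultimately show ?thesis by blast
qed

end

section \<open>The domain of the modulus\<close>

text \<open>Let \<open>K = \<i> A\<close> and let \<open>R\<close> be the inverse of \<open>K + m\<close>, which is bounded and positive. Then \<open>M = K R\<close> is
a symmetric contraction that commutes with \<open>R\<close>, its modulus \<open>S\<close> is the bounded square root of \<open>M\<^sup>2\<close>,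
and \<open>P = S R\<close> with \<open>R\<close> inverted is the modulus of \<open>K\<close>. In this form its domain is the range of \<open>R\<close>,
which is the domain of \<open>A\<close>. Positivity of \<open>P\<close> uses the square root \<open>Q\<close> of \<open>S\<close>: the inner product of
\<open>R w\<close> and \<open>S w\<close> is that of \<open>R (Q w)\<close> and \<open>Q w\<close>.\<close>

lemma modulus_exists:
  fixes A :: "'h::chilbert_space operator"
  assumes A: "skew_adjoint A" and lower: "\<And>x x'. (x, x') \<in> A \<Longrightarrow> c * (norm x)\<^sup>2 \<le> rinner x (\<i> *\<^sub>C x')"
    and shift: "\<And>x x'. (x, x') \<in> A \<Longrightarrow> norm x' \<le> norm (x' - (\<i> * complex_of_real m) *\<^sub>C x)"
    and inj: "\<And>x x'. (x, x') \<in> A \<Longrightarrow> m * norm x \<le> 2 * norm (x' - (\<i> * complex_of_real m) *\<^sub>C x)"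
    and m: "m > 0" "c + m \<ge> 0"
  shows "\<exists>P. self_adjoint P \<and> positive_operator P \<and> P O P = A O op_adjoint A"
proof -
  note L = linear_operatorD[OF skew_adjointD(1)[OF A]]
  have ii: "\<i> *\<^sub>C \<i> *\<^sub>C x = - x" for x :: 'h
    by (simp add: scaleC_scaleC scaleC_minus1)
  have im: "(\<i> * complex_of_real m) *\<^sub>C x = m *\<^sub>R (\<i> *\<^sub>C x)" for x :: 'h
    by (metis mult.commute scaleC_scaleC scaleR_scaleC)
  have surj: "\<exists>x x'. (x, x') \<in> A \<and> \<i> *\<^sub>C x' + m *\<^sub>R x = w" for w
  proof -
    have "\<exists>x x'. (x, x') \<in> A \<and> x' - (\<i> * complex_of_real m) *\<^sub>C x = - (\<i> *\<^sub>C w)"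
    proof (rule skew_adjoint_resolvent_surj[OF A])
      show "m / 2 > 0" using m by simp
      show "m / 2 * norm x \<le> norm (x' - (\<i> * complex_of_real m) *\<^sub>C x)" if "(x, x') \<in> A" for x x'
        using inj[OF that] by simp
      show "x = 0" if "(x, - (cnj (\<i> * complex_of_real m) *\<^sub>C x)) \<in> A" for x
      proof -
        have "- (cnj (\<i> * complex_of_real m) *\<^sub>C x) = (\<i> * complex_of_real m) *\<^sub>C x"
          by (metis complex_cnj_complex_of_real complex_cnj_i complex_cnj_mult minus_minus mult_minus1 mult_minus_left scaleC_minus1 scaleC_scaleC)
        then show ?thesis using inj[OF that] m(1) by (simp add: mult_le_0_iff)
      qed
    qed
    then obtain x x' where x: "(x, x') \<in> A" "x' - (\<i> * complex_of_real m) *\<^sub>C x = - (\<i> *\<^sub>C w)" by blast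
    have "\<i> *\<^sub>C (x' - m *\<^sub>R (\<i> *\<^sub>C x)) = \<i> *\<^sub>C (- (\<i> *\<^sub>C w))" using x(2) unfolding im by simp
    then have "\<i> *\<^sub>C x' + m *\<^sub>R x = w" by (simp add: scaleC_diff_right scaleC_minus_right scaleC_scaleR ii)
    with x show ?thesis by blast
  qed
  have inj0: "x = 0" if "(x, x') \<in> A" "\<i> *\<^sub>C x' + m *\<^sub>R x = 0" for x x'
  proof -
    have "\<i> *\<^sub>C x' = - (m *\<^sub>R x)" using that(2) by (simp add: add_eq_0_iff2)
    then have "\<i> *\<^sub>C \<i> *\<^sub>C x' = - (m *\<^sub>R (\<i> *\<^sub>C x))" by (simp add: scaleC_minus_right scaleC_scaleR)
    then have "x' - (\<i> * complex_of_real m) *\<^sub>C x = 0" unfolding im ii by simp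
    then show ?thesis using inj[OF that(1)] m(1) by (simp add: mult_le_0_iff)
  qed
  \<comment> \<open>Here \<open>R\<close> is the inverse of \<open>K + m = \<i> (A - \<i> m)\<close>, and \<open>R' = A R\<close>.\<close>
  obtain R R' where R: "\<And>w. (R w, R' w) \<in> A" "\<And>w. \<i> *\<^sub>C R' w + m *\<^sub>R R w = w"
    using surj by metis
  have R_eq: "R w = x" if "(x, x') \<in> A" "\<i> *\<^sub>C x' + m *\<^sub>R x = w" for x x' w
  proof -
    have "R w - x = 0"
    proof (rule inj0[OF L(7)[OF R(1) that(1)]])
      show "\<i> *\<^sub>C (R' w - x') + m *\<^sub>R (R w - x) = 0"
        using R(2)[of w] that(2) by (simp add: scaleC_diff_right scaleR_diff_right algebra_simps)
    qed
    then show ?thesis by simp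
  qed
  define M where "M w = \<i> *\<^sub>C R' w" for w
  have M: "M w = w - m *\<^sub>R R w" for w using R(2)[of w] unfolding M_def by (simp add: algebra_simps)
  have RA: "(R w, - (\<i> *\<^sub>C M w)) \<in> A" for w using R(1)[of w] unfolding M_def ii by simp
  have R_add: "R (x + y) = R x + R y" for x y
  proof (rule R_eq[OF L(3)[OF R(1) R(1)]])
    have "\<i> *\<^sub>C (R' x + R' y) + m *\<^sub>R (R x + R y) = (\<i> *\<^sub>C R' x + m *\<^sub>R R x) + (\<i> *\<^sub>C R' y + m *\<^sub>R R y)"
      by (simp add: scaleC_add_right scaleR_add_right)
    then show "\<i> *\<^sub>C (R' x + R' y) + m *\<^sub>R (R x + R y) = x + y" unfolding R(2) .
  qed
  have R_scaleC: "R (k *\<^sub>C x) = k *\<^sub>C R x" for k x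
  proof (rule R_eq[OF L(4)[OF R(1)]])
    have "\<i> *\<^sub>C k *\<^sub>C R' x + m *\<^sub>R k *\<^sub>C R x = k *\<^sub>C (\<i> *\<^sub>C R' x + m *\<^sub>R R x)"
      by (simp add: scaleC_add_right scaleC_scaleC scaleC_scaleR mult.commute)
    then show "\<i> *\<^sub>C k *\<^sub>C R' x + m *\<^sub>R k *\<^sub>C R x = k *\<^sub>C x" unfolding R(2) .
  qed
  have R_scaleR: "R (r *\<^sub>R x) = r *\<^sub>R R x" for r x unfolding scaleR_scaleC by (rule R_scaleC)
  have w_norm: "norm (R' w - (\<i> * complex_of_real m) *\<^sub>C R w) = norm w" for w
  proof -
    have "\<i> *\<^sub>C (R' w - m *\<^sub>R (\<i> *\<^sub>C R w)) = w"
      using R(2)[of w] by (simp add: scaleC_diff_right scaleC_scaleR ii)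
    then have "norm w = norm (\<i> *\<^sub>C (R' w - m *\<^sub>R (\<i> *\<^sub>C R w)))" by simp
    then show ?thesis unfolding im by (simp add: norm_scaleC)
  qed
  have M_norm: "norm (M w) \<le> norm w" for w
    using shift[OF R(1)[of w]] unfolding w_norm M_def by (simp add: norm_scaleC)
  have R_norm: "norm (R w) \<le> norm w * (2 / m)" for w
    using inj[OF R(1)[of w]] m(1) unfolding w_norm by (simp add: field_simps)
  have R_bl: "bounded_linear R" by (rule bounded_linear_intro) (rule R_add R_scaleR R_norm)+
  have M_bl: "bounded_linear M"
    unfolding M by (intro bounded_linear_sub bounded_linear_ident bounded_linear_compose[OF bounded_linear_scaleR_right] R_bl)
  have K_sym: "rinner (\<i> *\<^sub>C x') y = rinner x (\<i> *\<^sub>C y')" if "(x, x') \<in> A" "(y, y') \<in> A" for x x' y y'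
    using skew_adjointD(3)[OF A that(1) L(4)[OF that(2), of \<i>]] by (simp add: rinner_ii)
  have R_sym: "rinner (R x) y = rinner x (R y)" for x y
  proof -
    have "rinner (R x) (\<i> *\<^sub>C R' y + m *\<^sub>R R y) = rinner (\<i> *\<^sub>C R' x + m *\<^sub>R R x) (R y)"
      using K_sym[OF R(1) R(1), of x y] by (simp add: rinner_simps)
    then show ?thesis unfolding R(2) .
  qed
  have M_sym: "rinner (M x) y = rinner x (M y)" for x y by (simp add: M rinner_simps R_sym)
  have RM: "R (M x) = M (R x)" for x
    by (simp add: M linear_diff[OF bounded_linear.linear[OF R_bl]] R_scaleR)
  have M_scaleC: "M (k *\<^sub>C x) = k *\<^sub>C M x" for k x
    by (simp add: M R_scaleC scaleC_diff_right scaleC_scaleR)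
  have R_inj: "w = 0" if "R w = 0" for w
  proof -
    have "(0, R' w) \<in> A" using R(1)[of w] that by simp
    then have "R' w = 0" using L(1) L(2) by blast
    then show ?thesis using R(2)[of w] that by (simp add: scaleC_zero_right)
  qed
  have R_inj': "v = w" if "R v = R w" for v w
    using R_inj[of "v - w"] that by (simp add: linear_diff[OF bounded_linear.linear[OF R_bl]])
  have R_pos: "0 \<le> rinner (R w) w" for w
  proof -
    have "rinner (R w) w = rinner (R w) (\<i> *\<^sub>C R' w) + m * (norm (R w))\<^sup>2"
      by (subst (2) R(2)[of w, symmetric]) (simp add: rinner_simps rinner_self)
    moreover have "0 \<le> (c + m) * (norm (R w))\<^sup>2" using m(2) by simp
    ultimately show ?thesis using lower[OF R(1)[of w]] by (simp add: distrib_right)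
  qed
  \<comment> \<open>The norm bound on \<open>1 - M\<^sup>2\<close> is what the construction of the square root of \<open>M\<^sup>2\<close> asks for.\<close>
  have MM_norm: "norm (x - M (M x)) \<le> norm x" for x
  proof (rule power2_le_imp_le)
    have "(norm (M (M x)))\<^sup>2 \<le> (norm (M x))\<^sup>2" using M_norm by (intro power_mono) auto
    moreover have "rinner x (M (M x)) = (norm (M x))\<^sup>2" by (simp add: M_sym[symmetric] rinner_self)
    ultimately show "(norm (x - M (M x)))\<^sup>2 \<le> (norm x)\<^sup>2"
      using zero_le_power2[of "norm (M x)"] unfolding norm_diff_sq by linarith
  qed simp
  have "bounded_linear (\<lambda>x. x - M (M x))"
    by (intro bounded_linear_sub bounded_linear_ident bounded_linear_compose[OF M_bl] M_bl)
  from bounded_sqrt_exists[OF this MM_norm]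
  obtain S where S: "bounded_linear S" "\<And>x y. rinner (S x) y = rinner x (S y)" "\<And>x. S (S x) = M (M x)"
    "\<And>x. norm (x - S x) \<le> norm x"
    "\<And>P x. bounded_linear P \<Longrightarrow> (\<And>x. P (x - M (M x)) = P x - M (M (P x))) \<Longrightarrow> P (S x) = S (P x)"
    by (auto simp: rinner_simps M_sym)
  have RS: "R (S x) = S (R x)" for x
    by (rule S(5)[OF R_bl]) (simp add: linear_diff[OF bounded_linear.linear[OF R_bl]] RM)
  have S_scaleC: "S (k *\<^sub>C x) = k *\<^sub>C S x" for k x
    by (rule S(5)[OF bounded_linear_scaleC, symmetric]) (simp add: scaleC_diff_right M_scaleC)
  have "bounded_linear (\<lambda>x. x - S x)" by (intro bounded_linear_sub bounded_linear_ident S)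
  from bounded_sqrt_exists[OF this S(4)]
  obtain Q where Q: "\<And>x y. rinner (Q x) y = rinner x (Q y)" "\<And>x. Q (Q x) = S x"
    and Q_com: "\<forall>P. bounded_linear P \<and> (\<forall>x. P (x - S x) = P x - S (P x)) \<longrightarrow> (\<forall>x. P (Q x) = Q (P x))"
    by (auto simp: rinner_simps S(2))
  have RQ: "R (Q x) = Q (R x)" for x
    using Q_com R_bl by (simp add: linear_diff[OF bounded_linear.linear[OF R_bl]] RS)
  define P where "P = {(R w, S w) | w. True}"
  have P_iff: "(x, y) \<in> P \<longleftrightarrow> (\<exists>w. x = R w \<and> y = S w)" for x y unfolding P_def by blast
  have rangeR: "\<exists>w. x = R w" if "(x, x') \<in> A" for x x' using R_eq[OF that refl] by metis
  have DP: "Domain P = Domain A"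
  proof (intro set_eqI iffI)
    fix x assume "x \<in> Domain P" then show "x \<in> Domain A" using R(1) by (auto simp: P_iff Domain_iff)
  next
    fix x assume "x \<in> Domain A" then show "x \<in> Domain P" using rangeR by (auto simp: P_iff Domain_iff)
  qed
  have "linear_operator P"
    unfolding linear_operator_def
  proof (intro conjI)
    show "single_valued P" unfolding single_valued_def P_iff using R_inj' by blast
    show "(0, 0) \<in> P" unfolding P_iff
      by (rule exI[of _ 0]) (simp add: linear_0[OF bounded_linear.linear[OF R_bl]] linear_0[OF bounded_linear.linear[OF S(1)]])
    show "\<forall>(x, x')\<in>P. \<forall>(y, y')\<in>P. (x + y, x' + y') \<in> P"
      unfolding P_def by (auto simp flip: R_add linear_add[OF bounded_linear.linear[OF S(1)]])
    show "\<forall>k. \<forall>(x, x')\<in>P. (k *\<^sub>C x, k *\<^sub>C x') \<in> P"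
      unfolding P_def by (auto simp flip: R_scaleC S_scaleC)
  qed
  have two: "(2 * m) *\<^sub>R y = m *\<^sub>R y + m *\<^sub>R y" for y :: 'h by (metis mult_2 scaleR_add_left)
  have sqR: "M (M x) = x - R ((2 * m) *\<^sub>R x - m\<^sup>2 *\<^sub>R R x)" for x
    unfolding two by (simp add: M linear_diff[OF bounded_linear.linear[OF R_bl]] R_add R_scaleR power2_eq_square algebra_simps)
  \<comment> \<open>A solution of \<open>S v = R z\<close> lies in the range of \<open>R\<close> because \<open>S\<^sup>2 = M\<^sup>2\<close> differs
    from the identity by an operator with values in that range. This gives both the maximality of \<open>P\<close> and the domain of \<open>P\<^sup>2\<close>.\<close>
  have lift: "\<exists>g. v = R g \<and> z = S g" if "S v = R z" for v z
  proof -
    have "M (M v) = R (S z)" using S(3)[of v] that RS[of z] by simp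
    then have v: "v = R (S z + ((2 * m) *\<^sub>R v - m\<^sup>2 *\<^sub>R R v))" using sqR[of v] unfolding R_add by (metis diff_add_cancel)
    then obtain g where g: "v = R g" by blast
    then have "R z = R (S g)" using that RS by simp
    then show ?thesis using R_inj' g by blast
  qed
  have SR_sym: "rinner (R v) (S w) = rinner (S v) (R w)" for v w
    using S(2)[of "R v" w] R_sym[of "S v" w] by (simp add: RS)
  have "op_adjoint P = P"
  proof (intro set_eqI iffI; clarify)
    fix y z assume "(y, z) \<in> op_adjoint P"
    then have "cinner y (S w) = cinner z (R w)" for w unfolding op_adjoint_def P_def by blast
    then have "rinner y (S w) = rinner z (R w)" for w by (simp add: rinner_def)
    then have "rinner (S y - R z) w = 0" for w by (simp add: rinner_simps S(2) R_sym)
    then have "S y - R z = 0" by (metis rinner_self norm_eq_zero power_eq_0_iff)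
    then show "(y, z) \<in> P" using lift[of y z] unfolding P_iff by simp
  next
    fix y z assume "(y, z) \<in> P"
    then obtain v where v: "y = R v" "z = S v" unfolding P_iff by blast
    have "cinner y (S w) = cinner z (R w)" for w
    proof (rule complex_eqI)
      show "Re (cinner y (S w)) = Re (cinner z (R w))" using SR_sym[of v w] by (simp add: v rinner_def)
      show "Im (cinner y (S w)) = Im (cinner z (R w))" using SR_sym[of "\<i> *\<^sub>C v" w]
        by (simp add: v Im_cinner R_scaleC S_scaleC)
    qed
    then show "(y, z) \<in> op_adjoint P" unfolding op_adjoint_def P_def by blast
  qed
  then have "self_adjoint P"
    unfolding self_adjoint_def densely_defined_def DP using \<open>linear_operator P\<close> skew_adjointD(2)[OF A] by simp
  moreover have "positive_operator P"
    unfolding positive_operator_def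
  proof clarify
    fix x y assume "(x, y) \<in> P"
    then obtain w where w: "x = R w" "y = S w" unfolding P_iff by blast
    have "rinner (R w) (S w) = rinner (R (Q w)) (Q w)" by (simp add: Q(2)[symmetric] Q(1)[symmetric] RQ)
    then show "0 \<le> Re (cinner x y)" using R_pos[of "Q w"] by (simp add: w rinner_def)
  qed
  moreover have "P O P = A O op_adjoint A"
  proof -
    have adj: "op_adjoint A = op_scale (- 1) A" using A unfolding skew_adjoint_def by simp
    have AA: "(R (R g), - (\<i> *\<^sub>C R (M g))) \<in> A" "(- (\<i> *\<^sub>C R (M g)), - S (S g)) \<in> A" for g
    proof -
      show "(R (R g), - (\<i> *\<^sub>C R (M g))) \<in> A" using RA[of "R g"] by (simp add: RM)
      show "(- (\<i> *\<^sub>C R (M g)), - S (S g)) \<in> A"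
        using L(6)[OF L(4)[OF RA[of "M g"], of \<i>]] by (simp add: scaleC_minus_right ii S(3))
    qed
    have "(x, z) \<in> P O P \<longleftrightarrow> (\<exists>g. x = R (R g) \<and> z = S (S g))" for x z
    proof
      assume "(x, z) \<in> P O P"
      then obtain v w where *: "x = R v" "S v = R w" "z = S w" unfolding relcomp_unfold P_def by blast
      with lift[of v w] show "\<exists>g. x = R (R g) \<and> z = S (S g)" by blast
    next
      assume "\<exists>g. x = R (R g) \<and> z = S (S g)"
      then obtain g where "x = R (R g)" "z = S (S g)" by blast
      then have "(x, S (R g)) \<in> P" "(S (R g), z) \<in> P" unfolding P_iff using RS[of g] by metis+
      then show "(x, z) \<in> P O P" by blast
    qed
    moreover have "(x, z) \<in> A O op_adjoint A \<longleftrightarrow> (\<exists>g. x = R (R g) \<and> z = S (S g))" for x z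
    proof
      assume "(x, z) \<in> A O op_adjoint A"
      then obtain x' x'' where *: "(x, x') \<in> A" "(x', x'') \<in> A" "z = - x''"
        unfolding adj op_scale_def relcomp_unfold by (auto simp: scaleC_minus1)
      obtain v where v: "x = R v" using rangeR *(1) by blast
      then have "x' = - (\<i> *\<^sub>C M v)" using L(1)[OF *(1)] RA[of v] by simp
      then have "M v = \<i> *\<^sub>C x'" by (simp add: scaleC_minus_right ii)
      then have "(M v, \<i> *\<^sub>C x'') \<in> A" using L(4)[OF *(2)] by simp
      then obtain h where "M v = R h" using rangeR by blast
      then have "v = R (h + m *\<^sub>R v)" using M[of v] by (simp add: R_add R_scaleR algebra_simps)
      then obtain g where g: "v = R g" by blast
      have "x' = - (\<i> *\<^sub>C R (M g))" using L(1)[OF *(1)] AA(1)[of g] v g by simp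
      then have "x'' = - S (S g)" using L(1)[OF *(2)] AA(2)[of g] by simp
      then show "\<exists>g. x = R (R g) \<and> z = S (S g)" using v g *(3) by auto
    next
      assume "\<exists>g. x = R (R g) \<and> z = S (S g)"
      then obtain g where g: "x = R (R g)" "z = S (S g)" by blast
      have "(- (\<i> *\<^sub>C R (M g)), z) \<in> op_adjoint A"
        unfolding adj op_scale_def using AA(2)[of g] g(2) by (auto intro!: exI[of _ "- S (S g)"] simp: scaleC_minus1)
      then show "(x, z) \<in> A O op_adjoint A" using AA(1)[of g] g(1) by blast
    qed
    ultimately have eq: "(x, z) \<in> P O P \<longleftrightarrow> (x, z) \<in> A O op_adjoint A" for x z by (simp only:)
    show ?thesis
    proof (rule set_eqI)
      show "p \<in> P O P \<longleftrightarrow> p \<in> A O op_adjoint A" for p by (cases p) (simp only: eq)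
    qed
  qed
  ultimately show ?thesis by blast
qed

lemma skew_adjoint_scale_self_adjoint:
  assumes "self_adjoint P"
  shows "skew_adjoint (op_scale \<i> P)"
proof -
  have P: "linear_operator P" "densely_defined P" "op_adjoint P = P" using assms unfolding self_adjoint_def by auto
  have "Domain (op_scale \<i> P) = Domain P" unfolding op_scale_def by auto
  moreover have "op_adjoint (op_scale \<i> P) = op_scale (- 1) (op_scale \<i> P)"
  proof -
    have "(y, z) \<in> op_adjoint (op_scale \<i> P) \<longleftrightarrow> (y, \<i> *\<^sub>C z) \<in> op_adjoint P" for y z
    proof -
      have "cinner y (\<i> *\<^sub>C x') = cinner z x \<longleftrightarrow> cinner y x' = cinner (\<i> *\<^sub>C z) x" for x x'
        unfolding cinner_scaleC_right cinner_scaleC_left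
        by (metis complex_cnj_i complex_i_mult_minus minus_minus mult_minus_left)
      moreover have "(\<forall>(x, x')\<in>op_scale \<i> P. cinner y x' = cinner z x) \<longleftrightarrow> (\<forall>(x, x')\<in>P. cinner y (\<i> *\<^sub>C x') = cinner z x)"
        unfolding op_scale_def by blast
      ultimately show ?thesis unfolding op_adjoint_def by simp
    qed
    moreover have "(y, z) \<in> op_scale (- 1) (op_scale \<i> P) \<longleftrightarrow> (y, \<i> *\<^sub>C z) \<in> P" for y z
    proof
      assume "(y, z) \<in> op_scale (- 1) (op_scale \<i> P)"
      then obtain p where "(y, p) \<in> P" "z = (- 1) *\<^sub>C \<i> *\<^sub>C p" unfolding op_scale_def by auto
      then show "(y, \<i> *\<^sub>C z) \<in> P" by (simp add: scaleC_scaleC scaleC_one)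
    next
      assume "(y, \<i> *\<^sub>C z) \<in> P"
      moreover have "z = (- 1) *\<^sub>C \<i> *\<^sub>C \<i> *\<^sub>C z" by (simp add: scaleC_scaleC scaleC_one)
      ultimately show "(y, z) \<in> op_scale (- 1) (op_scale \<i> P)" unfolding op_scale_def by blast
    qed
    ultimately show ?thesis unfolding P(3) by auto
  qed
  ultimately show ?thesis
    unfolding skew_adjoint_def densely_defined_def using linear_op_scale[OF P(1)] P(2)
    by (simp add: densely_defined_def)
qed

text \<open>On the domain of the common square, \<open>(norm (T1 z))\<^sup>2\<close> is minus the inner product of \<open>z\<close> with the
square applied to \<open>z\<close>, hence equal to \<open>(norm (T2 z))\<^sup>2\<close>. The products \<open>G n\<close> of two resolvents of \<open>T1\<close>
map the domain of \<open>T1\<close> into that of the square and approximate the identity in the graph norm of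
\<open>T1\<close>, therefore \<open>G n x\<close> converges in the graph norm of \<open>T2\<close> too.\<close>

lemma Domain_subset_of_equal_squares:
  fixes T1 T2 :: "'h::chilbert_space operator"
  assumes T1: "skew_adjoint T1" and T2: "skew_adjoint T2" and sq: "T1 O T1 = T2 O T2"
  shows "Domain T1 \<subseteq> Domain T2"
proof
  note L1 = linear_operatorD[OF skew_adjointD(1)[OF T1]] and L2 = linear_operatorD[OF skew_adjointD(1)[OF T2]]
  fix x assume "x \<in> Domain T1"
  then obtain x' where x: "(x, x') \<in> T1" by blast
  define r where "r n = 1 / real (Suc n)" for n
  have r: "r n \<noteq> 0" "- r n \<noteq> 0" for n unfolding r_def by auto
  have rlim: "r \<longlonglongrightarrow> 0" unfolding r_def using LIMSEQ_inverse_real_of_nat by (simp add: inverse_eq_divide)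
  define G where "G n w = resolvent T1 (r n) (resolvent T1 (- r n) w)" for n w
  have Glim: "(\<lambda>n. G n w) \<longlonglongrightarrow> w" for w
  proof -
    have 1: "(\<lambda>n. resolvent T1 (- r n) w) \<longlonglongrightarrow> w"
      by (rule resolvent_tendsto_id[OF T1]) (use r tendsto_minus[OF rlim] in auto)
    have "(\<lambda>n. resolvent T1 (r n) (resolvent T1 (- r n) w - w)) \<longlonglongrightarrow> 0"
      by (rule Lim_null_comparison[OF always_eventually[OF allI[OF resolvent_contraction[OF T1 r(1)]]]])
        (use tendsto_norm_zero[OF LIM_zero[OF 1]] in simp)
    from tendsto_add[OF this resolvent_tendsto_id[OF T1 r(1) rlim, of w]] show ?thesis
      by (simp add: G_def linear_diff[OF bounded_linear.linear[OF resolvent_bounded_linear[OF T1 r(1)]]])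
  qed
  have GT: "(G n x, G n x') \<in> T1" for n
    unfolding G_def by (intro resolvent_commutes[OF T1] r x)
  have "\<exists>y. (G n x', y) \<in> T1" for n
    unfolding G_def using resolvent_in[OF T1 r(1)] by blast
  then obtain z where z: "\<And>n. (G n x', z n) \<in> T1" by metis
  have "(G n x, z n) \<in> T2 O T2" for n using GT z unfolding sq[symmetric] by blast
  then obtain y where y: "\<And>n. (G n x, y n) \<in> T2" "\<And>n. (y n, z n) \<in> T2" unfolding relcomp_unfold by simp metis
  have eq: "norm (y n - y k) = norm (G n x' - G k x')" for n k
  proof -
    have "(norm (y n - y k))\<^sup>2 = - rinner (G n x - G k x) (z n - z k)"
      using skew_adjointD(3)[OF T2 L2(7)[OF y(1)[of n] y(1)[of k]] L2(7)[OF y(2)[of n] y(2)[of k]]] by (simp add: rinner_self)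
    also have "\<dots> = (norm (G n x' - G k x'))\<^sup>2"
      using skew_adjointD(3)[OF T1 L1(7)[OF GT[of n] GT[of k]] L1(7)[OF z[of n] z[of k]]] by (simp add: rinner_self)
    finally show ?thesis by (simp add: power2_eq_iff_nonneg)
  qed
  have "Cauchy (\<lambda>n. G n x')" using Glim[of x'] by (rule LIMSEQ_imp_Cauchy)
  then have "Cauchy y" unfolding Cauchy_def dist_norm eq .
  then obtain l where "y \<longlonglongrightarrow> l" using Cauchy_convergent_iff convergent_def by blast
  from skew_adjoint_closed[OF T2 y(1) Glim this] show "x \<in> Domain T2" by blast
qed

text \<open>Any square root of \<open>- A\<^sup>2\<close> that the choice operator may select has the domain of \<open>A\<close>, because its
multiple by \<open>\<i>\<close> is a skew-adjoint operator with the same square as \<open>A\<close>.\<close>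

lemma (in bounded_below_pair) Domain_modulus: "Domain (op_modulus A) = Domain A"
proof -
  define m where "m = 4 * \<bar>c\<bar> + 1"
  have neg: "(\<i> * complex_of_real (- m)) *\<^sub>C x = - ((\<i> * complex_of_real m) *\<^sub>C x)" for x :: 'h
    by (metis mult_minus_right of_real_minus scaleC_minus1 scaleC_scaleC mult_minus1)
  have "\<exists>P. self_adjoint P \<and> positive_operator P \<and> P O P = A O op_adjoint A"
  proof (rule modulus_exists[OF A lower])
    show "norm x' \<le> norm (x' - (\<i> * complex_of_real m) *\<^sub>C x)"
      "m * norm x \<le> 2 * norm (x' - (\<i> * complex_of_real m) *\<^sub>C x)" if "(x, x') \<in> A" for x x'
      using shift_norm_lower[OF that, of m] unfolding neg by (simp_all add: m_def)
  qed (auto simp: m_def)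
  then have P: "self_adjoint (op_modulus A)" "op_modulus A O op_modulus A = A O op_adjoint A"
    unfolding op_modulus_def by (metis (mono_tags, lifting) someI_ex)+
  define T where "T = op_scale \<i> (op_modulus A)"
  have T: "skew_adjoint T" unfolding T_def by (rule skew_adjoint_scale_self_adjoint[OF P(1)])
  have lin: "linear_operator (op_modulus A)" using P(1) unfolding self_adjoint_def by simp
  have adj: "op_adjoint A = op_scale (- 1) A" using A unfolding skew_adjoint_def by simp
  have ii: "\<i> *\<^sub>C \<i> *\<^sub>C x = - x" for x :: 'h by (simp add: scaleC_scaleC scaleC_minus1)
  have "(x, z) \<in> T O T \<longleftrightarrow> (x, - z) \<in> op_modulus A O op_modulus A" for x z
  proof
    assume "(x, z) \<in> T O T"
    then obtain p q where "(x, p) \<in> op_modulus A" "(\<i> *\<^sub>C p, q) \<in> op_modulus A" "z = \<i> *\<^sub>C q"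
      unfolding T_def op_scale_def by auto
    moreover from this have "(p, - (\<i> *\<^sub>C q)) \<in> op_modulus A"
      using linear_operatorD(6)[OF lin linear_operatorD(4)[OF lin, of "\<i> *\<^sub>C p" q \<i>]] by (simp add: ii)
    ultimately show "(x, - z) \<in> op_modulus A O op_modulus A" by auto
  next
    assume "(x, - z) \<in> op_modulus A O op_modulus A"
    then obtain p where p: "(x, p) \<in> op_modulus A" "(p, - z) \<in> op_modulus A" by blast
    have "(\<i> *\<^sub>C p, \<i> *\<^sub>C \<i> *\<^sub>C (- z)) \<in> T"
      unfolding T_def op_scale_def using linear_operatorD(4)[OF lin p(2), of \<i>] by blast
    moreover have "(x, \<i> *\<^sub>C p) \<in> T" unfolding T_def op_scale_def using p(1) by blast
    ultimately show "(x, z) \<in> T O T" by (auto simp: ii)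
  qed
  moreover have "(x, z) \<in> A O A \<longleftrightarrow> (x, - z) \<in> A O op_adjoint A" for x z
    unfolding adj op_scale_def by (auto simp: scaleC_minus1 relcomp_unfold)
  ultimately have eq: "(x, z) \<in> T O T \<longleftrightarrow> (x, z) \<in> A O A" for x z unfolding P(2) by (simp only:)
  have "T O T = A O A"
  proof (rule set_eqI)
    show "p \<in> T O T \<longleftrightarrow> p \<in> A O A" for p by (cases p) (simp only: eq)
  qed
  then have "Domain T = Domain A"
    using Domain_subset_of_equal_squares[OF T A] Domain_subset_of_equal_squares[OF A T] by auto
  moreover have "Domain T = Domain (op_modulus A)" unfolding T_def op_scale_def by auto
  ultimately show ?thesis by simp
qed

section \<open>Regularity of the propagator\<close>

theorem proposition6:
  fixes A B :: "'h::chilbert_space operator" and a b \<delta> :: real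
  assumes "separable_space (euclidean :: 'h topology)"
    and "a > 0" and "b \<ge> 0"
    and "skew_adjoint A"
    and "bounded_from_below (op_scale \<i> A)"
    and "linear_operator B" and "skew_symmetric B"
    and "Domain A \<subseteq> Domain B"
    and "\<forall>\<psi>\<in>Domain A. norm (op_app B \<psi>) \<le> a * norm (op_app A \<psi>) + b * norm \<psi>"
    and "0 < \<delta>" and "\<delta> < 1"
  shows "(\<forall>u\<in>controls \<delta> a. \<forall>t\<ge>0.
      propagator \<delta> a A B u t ` Domain (op_modulus A) \<subseteq> Domain (op_modulus A) \<and>
      graph_norm_continuous_on A (Domain (op_modulus A)) (propagator \<delta> a A B u t)) \<and>
    (\<forall>\<eta>>0. \<exists>\<mu>::real. \<forall>\<psi>\<in>Domain A. \<forall>u\<in>controls \<delta> a. \<forall>t\<ge>0.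
      let A\<^sub>\<mu> = op_add A (op_scale (\<i> * complex_of_real \<mu>) Id) in
      propagator \<delta> a A B u t \<psi> \<in> Domain A\<^sub>\<mu> \<and>
      norm (op_app A\<^sub>\<mu> (propagator \<delta> a A B u t \<psi>))
        \<le> exp ((2 * a + \<eta>) / \<delta> * total_variation 0 t u) * norm (op_app A\<^sub>\<mu> \<psi>))"
proof -
  note LA = skew_adjointD(1)[OF \<open>skew_adjoint A\<close>]
  obtain c where c: "\<And>x x'. (x, x') \<in> A \<Longrightarrow> c * (norm x)\<^sup>2 \<le> rinner x (\<i> *\<^sub>C x')"
    using assms(5) unfolding bounded_from_below_def op_scale_def rinner_def by blast
  interpret bounded_below_pair A B a b c \<delta>
  proof
    show "rinner x' y = - rinner x y'" if "(x, x') \<in> B" "(y, y') \<in> B" for x x' y y'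
      using assms(7) that unfolding skew_symmetric_def rinner_def by fastforce
    show "norm x'' \<le> a * norm x' + b * norm x" if x: "(x, x') \<in> A" "(x, x'') \<in> B" for x x' x''
      using assms(9) x op_app_eq[OF LA x(1)] op_app_eq[OF assms(6) x(2)] by fastforce
  qed (use assms c in auto)
  have "propagator \<delta> a A B u t ` Domain (op_modulus A) \<subseteq> Domain (op_modulus A) \<and>
      graph_norm_continuous_on A (Domain (op_modulus A)) (propagator \<delta> a A B u t)"
    if u: "u \<in> controls \<delta> a" and t: "t \<ge> 0" for u t
  proof -
    obtain \<mu> \<kappa> where "dominating_shift \<mu> \<kappa>" using dominating_shift_exists[of 1] by auto
    then show ?thesis
      unfolding Domain_modulus using propagator_regularity(1)[OF _ u _ t] propagator_graph_norm_continuous[OF u t] by blast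
  qed
  moreover have "\<exists>\<mu>::real. \<forall>\<psi>\<in>Domain A. \<forall>u\<in>controls \<delta> a. \<forall>t\<ge>0.
      let A\<^sub>\<mu> = op_add A (op_scale (\<i> * complex_of_real \<mu>) Id) in
      propagator \<delta> a A B u t \<psi> \<in> Domain A\<^sub>\<mu> \<and>
      norm (op_app A\<^sub>\<mu> (propagator \<delta> a A B u t \<psi>))
        \<le> exp ((2 * a + \<eta>) / \<delta> * total_variation 0 t u) * norm (op_app A\<^sub>\<mu> \<psi>)" if "\<eta> > 0" for \<eta>
  proof -
    obtain \<mu> \<kappa> where sh: "dominating_shift \<mu> \<kappa>" and \<kappa>: "2 * \<kappa> \<le> (2 * a + \<eta>) / \<delta>"
      using dominating_shift_exists[OF \<open>\<eta> > 0\<close>] by blast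
    define A' where "A' = op_add A (op_scale (\<i> * complex_of_real \<mu>) Id)"
    have "linear_operator (Id :: 'h operator)" unfolding linear_operator_def by (auto simp: single_valued_def)
    then have LA': "linear_operator A'" unfolding A'_def by (intro linear_op_add linear_op_scale LA)
    have A': "(x, x' + (\<i> * complex_of_real \<mu>) *\<^sub>C x) \<in> A'" if "(x, x') \<in> A" for x x'
      unfolding A'_def op_add_def op_scale_def using that by auto
    have norm_A': "x \<in> Domain A' \<and> norm (op_app A' x) = shifted_norm \<mu> 0 x" if "x \<in> Domain A" for x
    proof -
      obtain x' where x: "(x, x') \<in> A" using \<open>x \<in> Domain A\<close> by blast
      show ?thesis using A'[OF x] op_app_eq[OF LA' A'[OF x]] by (auto simp: shifted_norm_0[OF x])
    qed
    have "propagator \<delta> a A B u t \<psi> \<in> Domain A' \<and>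
        norm (op_app A' (propagator \<delta> a A B u t \<psi>)) \<le> exp ((2 * a + \<eta>) / \<delta> * total_variation 0 t u) * norm (op_app A' \<psi>)"
      if \<psi>: "\<psi> \<in> Domain A" and u: "u \<in> controls \<delta> a" and t: "t \<ge> 0" for \<psi> u t
    proof -
      note R = propagator_regularity[OF sh u \<psi> t]
      have "0 \<le> total_variation 0 t u"
        using bv_control.variation_upto_nonneg[OF bv_control_controls[OF u], of t] t by (simp add: variation_upto_def)
      then have "exp (2 * \<kappa> * total_variation 0 t u) \<le> exp ((2 * a + \<eta>) / \<delta> * total_variation 0 t u)"
        using mult_right_mono[OF \<kappa>] by simp
      then have "exp (2 * \<kappa> * total_variation 0 t u) * shifted_norm \<mu> 0 \<psi>
          \<le> exp ((2 * a + \<eta>) / \<delta> * total_variation 0 t u) * shifted_norm \<mu> 0 \<psi>"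
        by (rule mult_right_mono) (simp add: shifted_norm_def)
      then show ?thesis using R norm_A'[OF R(1)] norm_A'[OF \<psi>] by simp
    qed
    then show ?thesis unfolding Let_def A'_def by blast
  qed
  ultimately show ?thesis by blast
qed

end
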